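(* Let $\mathcal I=[0,b)$, $X=\{x_n\}_{n=1}^\infty$, $d_n=x_n-x_{n-1}$ with $\sup_nd_n<\infty$, and $\beta=\{\beta_n\}_{n=1}^\infty\subset\mathbb R\setminus\{0\}$ be as in the context. The operator $\mathrm H_{X,\beta}$ has equal deficiency indices and $\mathrm n_+(\mathrm H_{X,\beta})=\mathrm n_-(\mathrm H_{X,\beta})\le1$. Moreover, $\mathrm H_{X,\beta}$ is self-adjoint if and only if at least one of the following conditions is satisfied: (i) $\sum_{n=1}^\infty d_n=\infty$, i.e., $\mathcal I=\mathbb R_+$; (ii) $\displaystyle\sum_{n=1}^\infty\left[d_{n+1}\left|\sum_{i=1}^n(\beta_i+d_i)\right|^2\right]=\infty$.
   Context: Let $\mathcal I=[0,b)$, $0<b\le+\infty$, and $X=\{x_n\}_{n=1}^\infty$, $x_0=0$, with $0=x_0<x_1<x_2<\dots<b$ and $\lim_nx_n=b$; $d_n=x_n-x_{n-1}$; it is assumed that $d^*=\sup_nd_n<\infty$ and $\beta_n\ne0$ for all $n$. $W^{2,2}(\mathcal I\setminus X)=\{f\in L^2(\mathcal I): f,f'\in AC_{loc}(\mathcal I\setminus X),\ f''\in L^2(\mathcal I)\}$, and $W^{2,2}_{\mathrm{comp}}(\mathcal I\setminus X)$ is the set of its elements whose support is compact in $\mathcal I=[0,b)$. $\mathrm H_{X,\beta}$ (the Hamiltonian of $\delta'$-interactions of strengths $\beta_n$ at $x_n$) is the closure in $L^2(\mathcal I)$ of the symmetric operator $-\mathrm d^2/\mathrm dx^2$ with domain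 $$\{f\in W^{2,2}_{\mathrm{comp}}(\mathcal I\setminus X): f'(0+)=0,\ f'(x_n+)=f'(x_n-),\ f(x_n+)-f(x_n-)=\beta_nf'(x_n),\ n\in\mathbb N\}.$$ $\mathrm n_\pm(T)=\dim\ker(T^*\mp\mathrm i)$ are the deficiency indices. *)

theory Defs
  imports "HOL-Analysis.Analysis"
begin

text \<open>
  Elements of \<open>L\<^sup>2(M)\<close> are represented by square-integrable functions, equality in \<open>L\<^sup>2(M)\<close> being
  equality almost everywhere.  An operator is represented by its graph, a set of pairs of
  representatives.
\<close>

definition L2 :: "'a measure \<Rightarrow> ('a \<Rightarrow> complex) set" where
  "L2 M = {f. f \<in> borel_measurable M \<and> integrable M (\<lambda>t. (cmod (f t))\<^sup>2)}"

definition L2_inner :: "'a measure \<Rightarrow> ('a \<Rightarrow> complex) \<Rightarrow> ('a \<Rightarrow> complex) \<Rightarrow> complex" where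
  "L2_inner M f g = (LINT t|M. f t * cnj (g t))"

definition L2_tendsto :: "'a measure \<Rightarrow> (nat \<Rightarrow> 'a \<Rightarrow> complex) \<Rightarrow> ('a \<Rightarrow> complex) \<Rightarrow> bool" where
  "L2_tendsto M F f \<longleftrightarrow> (\<lambda>n. LINT t|M. (cmod (F n t - f t))\<^sup>2) \<longlonglongrightarrow> 0"

type_synonym 'a op_graph = "(('a \<Rightarrow> complex) \<times> ('a \<Rightarrow> complex)) set"

text \<open>
  Closures and adjoints are saturated: they contain, with a pair \<open>(f, g)\<close>, every pair of
  \<open>L\<^sup>2\<close> functions equal to \<open>f\<close> and \<open>g\<close> almost everywhere.  Equality of such graphs as sets
  is therefore equality of the operators on \<open>L\<^sup>2(M)\<close>.
\<close>

definition op_closure :: "'a measure \<Rightarrow> 'a op_graph \<Rightarrow> 'a op_graph" where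
  "op_closure M T = {(f, g). f \<in> L2 M \<and> g \<in> L2 M \<and>
     (\<exists>F G. (\<forall>n::nat. (F n, G n) \<in> T) \<and> L2_tendsto M F f \<and> L2_tendsto M G g)}"

definition op_adjoint :: "'a measure \<Rightarrow> 'a op_graph \<Rightarrow> 'a op_graph" where
  "op_adjoint M T = {(g, h). g \<in> L2 M \<and> h \<in> L2 M \<and>
     (\<forall>(f, k) \<in> T. L2_inner M k g = L2_inner M f h)}"

definition densely_defined :: "'a measure \<Rightarrow> 'a op_graph \<Rightarrow> bool" where
  "densely_defined M T \<longleftrightarrow>
     (\<forall>f \<in> L2 M. \<exists>F. (\<forall>n::nat. F n \<in> Domain T) \<and> L2_tendsto M F f)"

definition self_adjoint :: "'a measure \<Rightarrow> 'a op_graph \<Rightarrow> bool" where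
  "self_adjoint M T \<longleftrightarrow> densely_defined M T \<and> op_adjoint M T = T"

definition L2_independent :: "'a measure \<Rightarrow> ('a \<Rightarrow> complex) set \<Rightarrow> bool" where
  "L2_independent M B \<longleftrightarrow>
     (\<forall>c :: ('a \<Rightarrow> complex) \<Rightarrow> complex.
        (AE t in M. (\<Sum>f\<in>B. c f * f t) = 0) \<longrightarrow> (\<forall>f\<in>B. c f = 0))"

text \<open>
  Complex dimension modulo equality almost everywhere; the value is \<open>\<infinity>\<close> for every
  infinite-dimensional subspace.
\<close>

definition L2_dim :: "'a measure \<Rightarrow> ('a \<Rightarrow> complex) set \<Rightarrow> enat" where
  "L2_dim M S = (SUP B \<in> {B. finite B \<and> B \<subseteq> S \<and> L2_independent M B}. enat (card B))"

definition op_ker_shift :: "'a measure \<Rightarrow> 'a op_graph \<Rightarrow> complex \<Rightarrow> ('a \<Rightarrow> complex) set"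
  \<comment> \<open>the kernel of \<open>T - z\<close>, for a saturated graph \<open>T\<close>\<close>
  where "op_ker_shift M T z = {g \<in> L2 M. (g, \<lambda>t. z * g t) \<in> T}"

definition deficiency_plus :: "'a measure \<Rightarrow> 'a op_graph \<Rightarrow> enat" where
  "deficiency_plus M T = L2_dim M (op_ker_shift M (op_adjoint M T) \<i>)"

definition deficiency_minus :: "'a measure \<Rightarrow> 'a op_graph \<Rightarrow> enat" where
  "deficiency_minus M T = L2_dim M (op_ker_shift M (op_adjoint M T) (- \<i>))"

definition abs_cont_on :: "real \<Rightarrow> real \<Rightarrow> (real \<Rightarrow> complex) \<Rightarrow> bool" where
  "abs_cont_on c d f \<longleftrightarrow>
     (\<forall>\<epsilon>>0. \<exists>\<delta>>0. \<forall>(n::nat) u v.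
        (\<forall>i<n. c \<le> u i \<and> u i \<le> v i \<and> v i \<le> d) \<longrightarrow>
        disjoint_family_on (\<lambda>i. {u i<..<v i}) {..<n} \<longrightarrow>
        (\<Sum>i<n. v i - u i) < \<delta> \<longrightarrow>
        (\<Sum>i<n. cmod (f (v i) - f (u i))) < \<epsilon>)"

definition AC_loc :: "real set \<Rightarrow> (real \<Rightarrow> complex) \<Rightarrow> bool" where
  "AC_loc S f \<longleftrightarrow> (\<forall>c d. c \<le> d \<and> {c..d} \<subseteq> S \<longrightarrow> abs_cont_on c d f)"

definition half_open :: "ereal \<Rightarrow> real set" where
  "half_open b = {t. 0 \<le> t \<and> ereal t < b}"

text \<open>
  \<open>W22 b X f f' f''\<close>: \<open>f\<close> lies in \<open>W\<^sup>2\<^sup>,\<^sup>2([0,b) - X)\<close> with first derivative \<open>f'\<close> and second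
  derivative \<open>f''\<close>, the latter as an almost everywhere derivative.  The values of these functions on
  \<open>X\<close> and outside \<open>[0,b)\<close> are irrelevant.  The point \<open>0\<close> belongs to \<open>[0,b) - X\<close>, so the
  derivative there is one-sided and absolute continuity holds up to \<open>0\<close>.
\<close>

definition W22 ::
  "ereal \<Rightarrow> real set \<Rightarrow> (real \<Rightarrow> complex) \<Rightarrow> (real \<Rightarrow> complex) \<Rightarrow> (real \<Rightarrow> complex) \<Rightarrow> bool" where
  "W22 b X f f' f'' \<longleftrightarrow>
     f \<in> L2 (lebesgue_on (half_open b)) \<and>
     AC_loc (half_open b - X) f \<and>
     (\<forall>t \<in> half_open b - X. (f has_vector_derivative f' t) (at t within (half_open b - X))) \<and>
     AC_loc (half_open b - X) f' \<and>
     (AE t in lebesgue_on (half_open b). (f' has_vector_derivative f'' t) (at t)) \<and>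
     f'' \<in> L2 (lebesgue_on (half_open b))"

definition comp_support :: "ereal \<Rightarrow> real set \<Rightarrow> (real \<Rightarrow> complex) \<Rightarrow> bool" where
  "comp_support b X f \<longleftrightarrow>
     compact (closure {t \<in> half_open b - X. f t \<noteq> 0}) \<and>
     closure {t \<in> half_open b - X. f t \<noteq> 0} \<subseteq> half_open b"

text \<open>
  The graph of \<open>-d\<^sup>2/dx\<^sup>2\<close> on the compactly supported functions satisfying the interface
  conditions; \<open>x 0 = 0\<close> is the left endpoint, the interaction centres are \<open>x n\<close>, \<open>n \<ge> 1\<close>, and
  \<open>\<beta> 0\<close> is not used.
\<close>

definition H_delta'_min :: "ereal \<Rightarrow> (nat \<Rightarrow> real) \<Rightarrow> (nat \<Rightarrow> real) \<Rightarrow> real op_graph" where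
  "H_delta'_min b x \<beta> = {(f, g). \<exists>f' f''.
     W22 b (x ` {1..}) f f' f'' \<and>
     comp_support b (x ` {1..}) f \<and>
     (f' \<longlongrightarrow> 0) (at_right 0) \<and>
     (\<forall>n\<ge>1. \<exists>f'x f_right f_left.
        (f' \<longlongrightarrow> f'x) (at_right (x n)) \<and> (f' \<longlongrightarrow> f'x) (at_left (x n)) \<and>
        (f \<longlongrightarrow> f_right) (at_right (x n)) \<and> (f \<longlongrightarrow> f_left) (at_left (x n)) \<and>
        f_right - f_left = complex_of_real (\<beta> n) * f'x) \<and>
     g = (\<lambda>t. - f'' t)}"

definition H_delta' :: "ereal \<Rightarrow> (nat \<Rightarrow> real) \<Rightarrow> (nat \<Rightarrow> real) \<Rightarrow> real op_graph" where
  "H_delta' b x \<beta> = op_closure (lebesgue_on (half_open b)) (H_delta'_min b x \<beta>)"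

definition gap :: "(nat \<Rightarrow> real) \<Rightarrow> nat \<Rightarrow> real" where
  "gap x n = x n - x (n - 1)"  \<comment> \<open>only used for \<open>n \<ge> 1\<close>\<close>

end

theory Submission
  imports Defs
begin

text \<open>
  Together with the interface conditions, the homogeneous equation \<open>u'' = 0\<close> has the
  solutions \<open>1\<close> and a function \<open>v\<close> of slope \<open>1\<close> that jumps by \<open>\<beta>\<^sub>n\<close> at \<open>x\<^sub>n\<close>.
  Variation of constants turns \<open>- u'' = h\<close> with the boundary and interface conditions into
  \<open>u(t) = c - \<integral>\<^sub>0\<^sup>t (v(t) - v(s)) h(s) ds\<close>, and the adjoint of the minimal operator consists of
  the square-integrable pairs \<open>(u, h)\<close> of this form.  Volterra uniqueness bounds the deficiency
  indices by \<open>1\<close>, and complex conjugation exchanges them.  If the Wronskian of two elements of the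
  adjoint does not vanish at \<open>b\<close>, a Gronwall argument shows that \<open>1\<close> and \<open>v\<close> are square
  integrable; conversely these two functions then destroy the symmetry of the adjoint.  So
  self-adjointness fails exactly if \<open>1\<close> and \<open>v\<close> are both in \<open>L\<^sup>2\<close>.  The first means that
  \<open>\<Sum> d\<^sub>n\<close> is finite, and since \<open>v(x\<^sub>n+) = \<Sum>\<^sub>i\<^sub>\<le>\<^sub>n (\<beta>\<^sub>i + d\<^sub>i)\<close>, the second then means
  that the series in (ii) converges.
\<close>

section \<open>Square-integrable functions\<close>

text \<open>A solution \<open>u\<close> jumps at every centre, so integration by parts on
  \<open>[0,t]\<close> is not directly available. It is carried out for \<open>u - v * u'\<close>
  and \<open>u'\<close> instead, which are continuous across the centres: the interface conditions
  are absorbed into \<open>v\<close>, and one Fubini identity for indefinite integrals replaces a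
  summation over the cells. Nothing is known in advance about the regularity of an element of the
  adjoint. It is therefore tested only against explicit elements of the minimal operator, those with
  piecewise constant second derivative; their images are two-step functions of mean zero, and these
  already determine a locally integrable function up to an additive constant. Self-adjointness is
  decided without the deficiency indices, by the symmetry or asymmetry of the adjoint. To pass from
  a symmetric adjoint back to the closure, a pair in the adjoint is projected orthogonally onto the
  closed graph, and this is where completeness of \<open>L2\<close> enters. The same projection,
  applied to the domain alone, gives its density.\<close>

definition L2_sq :: "'a measure \<Rightarrow> ('a \<Rightarrow> complex) \<Rightarrow> real" where
  "L2_sq M f = (LINT t|M. (cmod (f t))\<^sup>2)"

lemma L2_measurable: "f \<in> L2 M \<Longrightarrow> f \<in> borel_measurable M"
  and L2_integrable_sq: "f \<in> L2 M \<Longrightarrow> integrable M (\<lambda>t. (cmod (f t))\<^sup>2)"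
  by (auto simp: L2_def)

lemma L2_tendsto_iff: "L2_tendsto M F f \<longleftrightarrow> (\<lambda>n. L2_sq M (\<lambda>t. F n t - f t)) \<longlonglongrightarrow> 0"
  by (simp add: L2_tendsto_def L2_sq_def)

lemma L2_sq_nonneg [simp]: "0 \<le> L2_sq M f"
  by (simp add: L2_sq_def)

lemma cmod_add_sq_le: "(cmod (a + b))\<^sup>2 \<le> 2 * (cmod a)\<^sup>2 + 2 * (cmod b)\<^sup>2"
proof -
  have "(cmod (a + b))\<^sup>2 \<le> (cmod a + cmod b)\<^sup>2"
    by (intro power_mono norm_triangle_ineq) auto
  also have "\<dots> \<le> 2 * (cmod a)\<^sup>2 + 2 * (cmod b)\<^sup>2"
    using sum_squares_bound[of "cmod a" "cmod b"] by (simp add: power2_sum)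
  finally show ?thesis .
qed

lemma L2_zero [simp]: "(\<lambda>t. 0) \<in> L2 M"
  by (simp add: L2_def)

lemma L2_add:
  assumes "f \<in> L2 M" "g \<in> L2 M"
  shows "(\<lambda>t. f t + g t) \<in> L2 M"
proof -
  have [measurable]: "f \<in> borel_measurable M" "g \<in> borel_measurable M"
    using assms by (auto simp: L2_def)
  have "integrable M (\<lambda>t. (cmod (f t + g t))\<^sup>2)"
    by (rule Bochner_Integration.integrable_bound
          [of _ "\<lambda>t. 2 * (cmod (f t))\<^sup>2 + 2 * (cmod (g t))\<^sup>2"])
       (use assms in \<open>auto simp: L2_def intro!: AE_I2 cmod_add_sq_le\<close>)
  then show ?thesis by (simp add: L2_def)
qed

lemma L2_cmult: "f \<in> L2 M \<Longrightarrow> (\<lambda>t. c * f t) \<in> L2 M"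
  by (auto simp: L2_def norm_mult power_mult_distrib)

lemma L2_uminus: "f \<in> L2 M \<Longrightarrow> (\<lambda>t. - f t) \<in> L2 M"
  by (auto simp: L2_def)

lemma L2_diff: "f \<in> L2 M \<Longrightarrow> g \<in> L2 M \<Longrightarrow> (\<lambda>t. f t - g t) \<in> L2 M"
  using L2_add[of f M "\<lambda>t. - g t"] L2_uminus[of g M] by simp

lemma borel_measurable_cnj [measurable]:
  fixes f :: "'a \<Rightarrow> complex"
  shows "f \<in> borel_measurable M \<Longrightarrow> (\<lambda>t. cnj (f t)) \<in> borel_measurable M"
  by (rule measurable_compose[OF _ borel_measurable_continuous_onI]) (auto intro!: continuous_intros)

lemma L2_cnj: "f \<in> L2 M \<Longrightarrow> (\<lambda>t. cnj (f t)) \<in> L2 M"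
  by (auto simp: L2_def)

lemma L2_AE_cong:
  assumes "f \<in> L2 M" "AE t in M. f t = g t" "g \<in> borel_measurable M"
  shows "g \<in> L2 M"
proof -
  have [measurable]: "f \<in> borel_measurable M" "g \<in> borel_measurable M"
    using assms by (auto simp: L2_def)
  have "integrable M (\<lambda>t. (cmod (g t))\<^sup>2) \<longleftrightarrow> integrable M (\<lambda>t. (cmod (f t))\<^sup>2)"
    by (rule integrable_cong_AE) (use assms(2) in auto)
  then show ?thesis using assms by (simp add: L2_def)
qed

lemma integrable_mult_L2:
  assumes "f \<in> L2 M" "g \<in> L2 M"
  shows "integrable M (\<lambda>t. f t * g t)"
proof (rule Bochner_Integration.integrable_bound)
  show "integrable M (\<lambda>t. (cmod (f t))\<^sup>2 + (cmod (g t))\<^sup>2)"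
    using assms by (auto simp: L2_def)
  show "(\<lambda>t. f t * g t) \<in> borel_measurable M"
    using assms by (auto simp: L2_def)
  have "cmod (f t) * cmod (g t) \<le> (cmod (f t))\<^sup>2 + (cmod (g t))\<^sup>2" for t
    using sum_squares_bound[of "cmod (f t)" "cmod (g t)"]
      mult_nonneg_nonneg[of "cmod (f t)" "cmod (g t)"] unfolding mult.assoc by (smt (verit) norm_ge_zero)
  then show "AE t in M. norm (f t * g t) \<le> norm ((cmod (f t))\<^sup>2 + (cmod (g t))\<^sup>2)"
    by (simp add: norm_mult)
qed

lemma integrable_L2_inner:
  "f \<in> L2 M \<Longrightarrow> g \<in> L2 M \<Longrightarrow> integrable M (\<lambda>t. f t * cnj (g t))"
  by (intro integrable_mult_L2 L2_cnj)

lemma L2_inner_diff_left: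
  "f \<in> L2 M \<Longrightarrow> g \<in> L2 M \<Longrightarrow> h \<in> L2 M \<Longrightarrow>
    L2_inner M (\<lambda>t. f t - g t) h = L2_inner M f h - L2_inner M g h"
  by (simp add: L2_inner_def left_diff_distrib integrable_L2_inner)

lemma L2_inner_diff_right:
  "f \<in> L2 M \<Longrightarrow> g \<in> L2 M \<Longrightarrow> h \<in> L2 M \<Longrightarrow>
    L2_inner M h (\<lambda>t. f t - g t) = L2_inner M h f - L2_inner M h g"
  by (simp add: L2_inner_def right_diff_distrib integrable_L2_inner)

lemma L2_inner_cmult_left: "L2_inner M (\<lambda>t. c * f t) h = c * L2_inner M f h"
  by (simp add: L2_inner_def mult.assoc)

lemma L2_inner_uminus_right: "L2_inner M f (\<lambda>t. - h t) = - L2_inner M f h"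
  by (simp add: L2_inner_def)

lemma L2_inner_commute: "L2_inner M f g = cnj (L2_inner M g f)"
  unfolding L2_inner_def by (simp add: mult.commute flip: Bochner_Integration.integral_cnj)

lemma L2_inner_self: "L2_inner M f f = of_real (L2_sq M f)"
  by (simp add: L2_inner_def L2_sq_def complex_norm_square[symmetric] del: of_real_power)

lemma L2_sq_eq_0_iff: "f \<in> L2 M \<Longrightarrow> L2_sq M f = 0 \<longleftrightarrow> (AE t in M. f t = 0)"
  unfolding L2_sq_def by (subst integral_nonneg_eq_0_iff_AE) (auto simp: L2_def)

text \<open>Optimising the real parameter \<open>s\<close> in \<open>0 \<le> \<integral>(|f| - s |g|)\<^sup>2\<close>.\<close>

lemma L2_Cauchy_Schwarz:
  assumes "f \<in> L2 M" "g \<in> L2 M"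
  shows "(cmod (L2_inner M f g))\<^sup>2 \<le> L2_sq M f * L2_sq M g"
proof -
  define I where "I = (LINT t|M. cmod (f t) * cmod (g t))"
  have fg: "integrable M (\<lambda>t. cmod (f t) * cmod (g t))"
    using integrable_norm[OF integrable_mult_L2[OF assms]] by (simp add: norm_mult)
  have I: "cmod (L2_inner M f g) \<le> I"
    unfolding I_def L2_inner_def using integral_norm_bound[of M "\<lambda>t. f t * cnj (g t)"]
    by (simp add: norm_mult)
  have Q: "0 \<le> L2_sq M f - 2 * s * I + s\<^sup>2 * L2_sq M g" for s
  proof -
    have "0 \<le> (LINT t|M. (cmod (f t) - s * cmod (g t))\<^sup>2)"
      by simp
    also have "\<dots> = (LINT t|M. (cmod (f t))\<^sup>2 - 2 * s * (cmod (f t) * cmod (g t)) + s\<^sup>2 * (cmod (g t))\<^sup>2)"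
      by (simp add: power2_diff power_mult_distrib algebra_simps)
    also have "\<dots> = L2_sq M f - 2 * s * I + s\<^sup>2 * L2_sq M g"
      unfolding I_def L2_sq_def
      using fg assms[THEN L2_integrable_sq] by simp
    finally show ?thesis .
  qed
  have "I\<^sup>2 \<le> L2_sq M f * L2_sq M g"
  proof (cases "L2_sq M g = 0")
    case True
    have "I = 0"
    proof (rule ccontr)
      assume "I \<noteq> 0"
      \<comment> \<open>For \<open>L2_sq M g = 0\<close> the inequality \<open>Q\<close> is affine
        in \<open>s\<close>, and this \<open>s\<close> makes its right-hand side equal to
        -1.\<close>
      then show False
        using Q[of "(L2_sq M f + 1) / (2 * I)"] True by (simp add: field_simps)
    qed
    then show ?thesis by simp
  next
    case False
    then have pos: "L2_sq M g > 0" using L2_sq_nonneg[of M g] by linarith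
    have "0 \<le> L2_sq M f - I\<^sup>2 / L2_sq M g"
      using Q[of "I / L2_sq M g"] pos by (simp add: power2_eq_square field_simps)
    then show ?thesis using pos by (simp add: field_simps)
  qed
  moreover have "(cmod (L2_inner M f g))\<^sup>2 \<le> I\<^sup>2"
    using I by (intro power_mono) auto
  ultimately show ?thesis by linarith
qed

lemma L2_inner_tendsto:
  assumes F: "\<And>n. F n \<in> L2 M" and f: "f \<in> L2 M" and g: "g \<in> L2 M" and lim: "L2_tendsto M F f"
  shows "(\<lambda>n. L2_inner M (F n) g) \<longlonglongrightarrow> L2_inner M f g"
proof -
  have "(\<lambda>n. sqrt (L2_sq M (\<lambda>t. F n t - f t) * L2_sq M g)) \<longlonglongrightarrow> sqrt (0 * L2_sq M g)"
    using lim unfolding L2_tendsto_iff by (intro tendsto_intros)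
  then have 0: "(\<lambda>n. sqrt (L2_sq M (\<lambda>t. F n t - f t) * L2_sq M g)) \<longlonglongrightarrow> 0"
    by simp
  have "(\<lambda>n. L2_inner M (F n) g - L2_inner M f g) \<longlonglongrightarrow> 0"
  proof (rule Lim_null_comparison[OF always_eventually 0], rule allI)
    fix n
    have "L2_inner M (F n) g - L2_inner M f g = L2_inner M (\<lambda>t. F n t - f t) g"
      using F f g by (simp add: L2_inner_diff_left)
    then show "norm (L2_inner M (F n) g - L2_inner M f g) \<le> sqrt (L2_sq M (\<lambda>t. F n t - f t) * L2_sq M g)"
      using L2_Cauchy_Schwarz[OF L2_diff[OF F f] g, of n] by (simp add: real_le_rsqrt)
  qed
  then show ?thesis by (simp add: LIM_zero_iff)
qed

lemma L2_tendsto_const [simp]: "L2_tendsto M (\<lambda>n. f) f"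
  by (simp add: L2_tendsto_def)

lemma L2_tendsto_AE_cong:
  assumes "L2_tendsto M F f" "\<And>n. F n \<in> L2 M" "f \<in> L2 M" "g \<in> L2 M" "AE t in M. f t = g t"
  shows "L2_tendsto M F g"
proof -
  have "L2_sq M (\<lambda>t. F n t - f t) = L2_sq M (\<lambda>t. F n t - g t)" for n
    unfolding L2_sq_def
    by (rule integral_cong_AE)
       (use assms(2)[of n] assms(3-5) in \<open>auto simp: L2_def\<close>)
  then show ?thesis using assms(1) by (simp add: L2_tendsto_iff)
qed

subsection \<open>Completeness\<close>

lemma nn_integral_L2_sq: "f \<in> L2 M \<Longrightarrow> (\<integral>\<^sup>+ t. ennreal ((cmod (f t))\<^sup>2) \<partial>M) = ennreal (L2_sq M f)"
  unfolding L2_sq_def by (rule nn_integral_eq_integral) (auto simp: L2_def)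

text \<open>Along a subsequence with \<open>\<parallel>F (r (k+1)) - F (r k)\<parallel>\<^sup>2 \<le> 8\<^sup>-\<^sup>k\<close> the sum
  \<open>\<Sum> 4\<^sup>k |F (r (k+1)) - F (r k)|\<^sup>2\<close> is integrable, hence almost everywhere finite, which makes
  the subsequence converge pointwise; Fatou's lemma identifies the limit.\<close>

lemma L2_complete:
  fixes F :: "nat \<Rightarrow> 'a \<Rightarrow> complex"
  assumes F: "\<And>n. F n \<in> L2 M"
    and Cauchy: "\<And>e. e > 0 \<Longrightarrow> \<exists>N. \<forall>m\<ge>N. \<forall>n\<ge>N. L2_sq M (\<lambda>t. F m t - F n t) < e"
  shows "\<exists>f\<in>L2 M. L2_tendsto M F f"
proof -
  have [measurable]: "F n \<in> borel_measurable M" for n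
    using F by (auto simp: L2_def)
  have "\<exists>N. \<forall>m\<ge>N. \<forall>n\<ge>N. L2_sq M (\<lambda>t. F m t - F n t) < (1/8)^k" for k :: nat
    by (intro Cauchy) auto
  then obtain N where N: "\<And>k m n. m \<ge> N k \<Longrightarrow> n \<ge> N k \<Longrightarrow> L2_sq M (\<lambda>t. F m t - F n t) < (1/8)^k"
    by metis
  \<comment> \<open>The summand \<open>k\<close> makes \<open>r\<close> dominate the identity, so
    late indices are reached; the partial sums give monotonicity and \<open>r k >= N k\<close>,
    hence squared distance below 8^-k between consecutive terms.\<close>
  define r where "r k = k + (\<Sum>j\<le>k. N j)" for k
  have rN: "r k \<ge> N k" for k
    unfolding r_def by (rule trans_le_add2, rule member_le_sum) auto
  have r_mono: "r k \<le> r (Suc k)" "k \<le> r k" for k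
    by (auto simp: r_def)
  define D where "D k t = F (r (Suc k)) t - F (r k) t" for k t
  have [measurable]: "D k \<in> borel_measurable M" for k
    unfolding D_def by measurable
  have DL: "D k \<in> L2 M" for k
    unfolding D_def by (intro L2_diff F)
  have D: "L2_sq M (D k) \<le> (1/8)^k" for k
    unfolding D_def using N[of k "r (Suc k)" "r k"] rN[of k] r_mono(1)[of k] by force
  have "(\<integral>\<^sup>+ t. (\<Sum>k. ennreal (4^k * (cmod (D k t))\<^sup>2)) \<partial>M) = (\<Sum>k. \<integral>\<^sup>+ t. ennreal (4^k * (cmod (D k t))\<^sup>2) \<partial>M)"
    by (rule nn_integral_suminf) auto
  also have "\<dots> = (\<Sum>k. ennreal (4^k * L2_sq M (D k)))"
    by (simp add: ennreal_mult nn_integral_cmult nn_integral_L2_sq[OF DL])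
  also have "\<dots> \<le> (\<Sum>k. ennreal ((1/2)^k))"
  proof (intro suminf_le ennreal_leI summableI)
    fix k
    have "4^k * L2_sq M (D k) \<le> 4^k * (1/8)^k"
      using D by (intro mult_left_mono) auto
    also have "\<dots> = (1/2)^k" by (simp add: power_mult_distrib[symmetric])
    finally show "4^k * L2_sq M (D k) \<le> (1/2)^k" .
  qed
  also have "\<dots> < \<infinity>"
    by (simp add: suminf_ennreal2 summable_geometric del: power_one_over)
  finally have "(\<integral>\<^sup>+ t. (\<Sum>k. ennreal (4^k * (cmod (D k t))\<^sup>2)) \<partial>M) \<noteq> \<infinity>"
    by simp
  then have fin: "AE t in M. (\<Sum>k. ennreal (4^k * (cmod (D k t))\<^sup>2)) \<noteq> \<infinity>"
    by (intro nn_integral_noteq_infinite) auto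
  have conv_pt: "convergent (\<lambda>k. F (r k) t)"
    if fin: "(\<Sum>k. ennreal (4^k * (cmod (D k t))\<^sup>2)) \<noteq> \<infinity>" for t
  proof -
    have "summable (\<lambda>k. 4^k * (cmod (D k t))\<^sup>2)"
      using fin by (intro summable_suminf_not_top) auto
    then have "bounded (range (\<lambda>k. 4^k * (cmod (D k t))\<^sup>2))"
      by (intro convergent_imp_bounded[OF summable_LIMSEQ_zero])
    then obtain C where "\<And>k. norm (4^k * (cmod (D k t))\<^sup>2) \<le> C"
      unfolding bounded_iff by auto
    then have C: "(2^k * cmod (D k t))\<^sup>2 \<le> C" for k
      by (simp add: power_mult_distrib power_mult[symmetric] mult.commute[of _ 2] power_mult)
    \<comment> \<open>The weight 4^k turns mere boundedness of the summands into geometric decay of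
      the increments.\<close>
    have D_le: "norm (D k t) \<le> sqrt C * (1/2)^k" for k
      using real_le_rsqrt[OF C[of k]] by (simp add: field_simps)
    have "summable (\<lambda>k. sqrt C * (1/2::real)^k)"
      by (intro summable_mult summable_geometric) simp
    then have "summable (\<lambda>k. D k t)"
      by (rule summable_comparison_test'[of _ 0]) (rule D_le)
    then have "convergent (\<lambda>n. F (r 0) t + (\<Sum>k<n. D k t))"
      by (intro convergent_add convergent_const) (simp add: summable_iff_convergent)
    moreover have "F (r 0) t + (\<Sum>k<n. D k t) = F (r n) t" for n
      unfolding D_def by (subst sum_lessThan_telescope) simp
    ultimately show ?thesis by simp
  qed
  have conv: "AE t in M. convergent (\<lambda>k. F (r k) t)"
    using fin by eventually_elim (rule conv_pt)
  define f where "f t = lim (\<lambda>k. F (r k) t)" for t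
  have [measurable]: "f \<in> borel_measurable M"
    unfolding f_def by measurable
  have lim: "AE t in M. (\<lambda>k. F (r k) t) \<longlonglongrightarrow> f t"
    using conv by eventually_elim (simp add: f_def convergent_LIMSEQ_iff)
  \<comment> \<open>The bound \<open>e\<close> is left free: \<open>e = 1\<close>, which is the tail
    bound (1/8)^0 after \<open>N 0\<close>, places the limit in \<open>L2\<close>, and small
    \<open>e\<close> gives the convergence.\<close>
  have Fatou: "(\<integral>\<^sup>+ t. ennreal ((cmod (F n t - f t))\<^sup>2) \<partial>M) \<le> ennreal e"
    if e: "\<And>m n. m \<ge> N' \<Longrightarrow> n \<ge> N' \<Longrightarrow> L2_sq M (\<lambda>t. F m t - F n t) < e" and n: "n \<ge> N'" for e N' n
  proof -
    have "(\<integral>\<^sup>+ t. ennreal ((cmod (F n t - f t))\<^sup>2) \<partial>M)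
        = (\<integral>\<^sup>+ t. liminf (\<lambda>k. ennreal ((cmod (F n t - F (r k) t))\<^sup>2)) \<partial>M)"
    proof (rule nn_integral_cong_AE, use lim in eventually_elim)
      case (elim t)
      have "(\<lambda>k. ennreal ((cmod (F n t - F (r k) t))\<^sup>2)) \<longlonglongrightarrow> ennreal ((cmod (F n t - f t))\<^sup>2)"
        by (intro tendsto_intros elim)
      then show ?case by (rule lim_imp_Liminf[OF trivial_limit_sequentially, symmetric])
    qed
    also have "\<dots> \<le> liminf (\<lambda>k. \<integral>\<^sup>+ t. ennreal ((cmod (F n t - F (r k) t))\<^sup>2) \<partial>M)"
      by (rule nn_integral_liminf) auto
    also have "\<dots> = liminf (\<lambda>k. ennreal (L2_sq M (\<lambda>t. F n t - F (r k) t)))"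
      by (simp add: nn_integral_L2_sq[OF L2_diff[OF F F]])
    also have "\<dots> \<le> limsup (\<lambda>k. ennreal (L2_sq M (\<lambda>t. F n t - F (r k) t)))"
      by (rule Liminf_le_Limsup) auto
    also have "\<dots> \<le> ennreal e"
    proof (rule Limsup_bounded)
      have "ennreal (L2_sq M (\<lambda>t. F n t - F (r k) t)) \<le> ennreal e" if "k \<ge> N'" for k
        using e[OF n, of "r k"] r_mono(2)[of k] that by (intro ennreal_leI less_imp_le) auto
      then show "\<forall>\<^sub>F k in sequentially. ennreal (L2_sq M (\<lambda>t. F n t - F (r k) t)) \<le> ennreal e"
        unfolding eventually_sequentially by blast
    qed
    finally show ?thesis .
  qed
  have diffL: "\<exists>n. (\<lambda>t. F n t - f t) \<in> L2 M"
  proof -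
    have "(\<integral>\<^sup>+ t. ennreal ((cmod (F (N 0) t - f t))\<^sup>2) \<partial>M) \<le> ennreal 1"
      by (rule Fatou[of "N 0"]) (use N[of 0] in auto)
    then have "integrable M (\<lambda>t. (cmod (F (N 0) t - f t))\<^sup>2)"
      by (intro integrableI_nonneg) (auto simp: le_less_trans)
    then show ?thesis by (intro exI[of _ "N 0"]) (auto simp: L2_def)
  qed
  then obtain n where "(\<lambda>t. F n t - f t) \<in> L2 M" ..
  then have fL: "f \<in> L2 M"
    using L2_diff[OF F[of n]] by fastforce
  have "(\<lambda>n. L2_sq M (\<lambda>t. F n t - f t)) \<longlonglongrightarrow> 0"
  proof (rule LIMSEQ_I)
    fix e :: real assume "e > 0"
    then obtain N' where "\<forall>m\<ge>N'. \<forall>n\<ge>N'. L2_sq M (\<lambda>t. F m t - F n t) < e / 2"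
      using Cauchy[of "e/2"] by auto
    then have "ennreal (L2_sq M (\<lambda>t. F n t - f t)) \<le> ennreal (e / 2)" if "n \<ge> N'" for n
      using Fatou[of N' "e/2" n] that by (simp add: nn_integral_L2_sq[OF L2_diff[OF F fL]])
    then have "L2_sq M (\<lambda>t. F n t - f t) < e" if "n \<ge> N'" for n
      using that \<open>e > 0\<close> by (fastforce simp: ennreal_le_iff)
    then show "\<exists>N'. \<forall>n\<ge>N'. norm (L2_sq M (\<lambda>t. F n t - f t) - 0) < e"
      by auto
  qed
  then show ?thesis using fL by (auto simp: L2_tendsto_iff)
qed

subsection \<open>Orthogonal projection onto the closure of an operator graph\<close>

text \<open>The parallelogram law for \<open>f - u\<close> and \<open>f - w\<close>. Their half sum
  is \<open>f\<close> minus the midpoint of \<open>u\<close> and \<open>w\<close>; as the midpoint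
  cannot beat the infimum of the distances, two nearly optimal points are close to each
  other.\<close>

lemma L2_parallelogram:
  assumes "f \<in> L2 M" "u \<in> L2 M" "w \<in> L2 M"
  shows "L2_sq M (\<lambda>t. u t - w t) =
    2 * L2_sq M (\<lambda>t. f t - u t) + 2 * L2_sq M (\<lambda>t. f t - w t) - 4 * L2_sq M (\<lambda>t. f t - (1/2) * (u t + w t))"
proof -
  have par: "(cmod (a - c))\<^sup>2 = 2 * (cmod (z - a))\<^sup>2 + 2 * (cmod (z - c))\<^sup>2 - 4 * (cmod (z - (1/2) * (a + c)))\<^sup>2" for a c z
    unfolding cmod_power2 by (simp add: power2_eq_square field_simps)
  define A B C where "A t = (cmod (f t - u t))\<^sup>2" and "B t = (cmod (f t - w t))\<^sup>2"
    and "C t = (cmod (f t - (1/2) * (u t + w t)))\<^sup>2" for t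
  have "integrable M A" "integrable M B" "integrable M C"
    unfolding A_def[abs_def] B_def[abs_def] C_def[abs_def]
    using assms by (intro L2_integrable_sq L2_diff L2_cmult L2_add; simp)+
  moreover have "(cmod (u t - w t))\<^sup>2 = 2 * A t + 2 * B t - 4 * C t" for t
    unfolding A_def B_def C_def by (rule par)
  ultimately have "L2_sq M (\<lambda>t. u t - w t) = 2 * integral\<^sup>L M A + 2 * integral\<^sup>L M B - 4 * integral\<^sup>L M C"
    by (simp add: L2_sq_def)
  then show ?thesis
    by (simp only: L2_sq_def A_def[abs_def] B_def[abs_def] C_def[abs_def])
qed

text \<open>Supplies the first-order condition of a minimal distance. The parameter \<open>z\<close>
  is complex so that its argument can be aligned with the inner product.\<close>

lemma L2_sq_expand:
  assumes "f \<in> L2 M" "u \<in> L2 M"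
  shows "L2_sq M (\<lambda>t. f t - z * u t) =
    L2_sq M f - 2 * Re (z * L2_inner M u f) + (cmod z)\<^sup>2 * L2_sq M u"
proof -
  have "complex_of_real (L2_sq M (\<lambda>t. f t - z * u t))
      = L2_inner M (\<lambda>t. f t - z * u t) (\<lambda>t. f t - z * u t)"
    by (simp add: L2_inner_self)
  also have "\<dots> = L2_inner M f f - z * L2_inner M u f - cnj z * L2_inner M f u + z * cnj z * L2_inner M u u"
  proof -
    have R: "L2_inner M g (\<lambda>t. z * u t) = cnj z * L2_inner M g u" for g
      using L2_inner_commute[of M g "\<lambda>t. z * u t"] L2_inner_commute[of M g u]
      by (simp add: L2_inner_cmult_left)
    show ?thesis
      using assms by (simp add: L2_inner_diff_left L2_inner_diff_right L2_diff L2_cmult R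
          L2_inner_cmult_left algebra_simps)
  qed
  also have "\<dots> = of_real (L2_sq M f - 2 * Re (z * L2_inner M u f) + (cmod z)\<^sup>2 * L2_sq M u)"
  proof -
    have e: "A - X - Y + Z = A - (X + Y) + Z" for A X Y Z :: complex
      by simp
    have e1: "cnj z * L2_inner M f u = cnj (z * L2_inner M u f)"
      using L2_inner_commute[of M f u] by simp
    have e2: "z * L2_inner M u f + cnj (z * L2_inner M u f) = of_real (2 * Re (z * L2_inner M u f))"
      by (rule complex_add_cnj)
    have e3: "z * cnj z * L2_inner M u u = of_real ((cmod z)\<^sup>2 * L2_sq M u)"
      by (simp add: L2_inner_self complex_norm_square del: of_real_power)
    show ?thesis
      by (simp only: e e1 e2 e3 L2_inner_self[of M f] of_real_add of_real_diff)
  qed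
  finally show ?thesis
    by (simp only: of_real_eq_iff)
qed

text \<open>The limit of a minimising sequence for the distance of \<open>(f, h)\<close> to \<open>S\<close> exists by the
  parallelogram identity; the orthogonality is the first-order condition of the minimum.\<close>

lemma graph_projection:
  assumes S: "\<And>u w. (u, w) \<in> S \<Longrightarrow> u \<in> L2 M \<and> w \<in> L2 M"
    and S0: "S \<noteq> {}"
    and add: "\<And>u w u' w'. (u, w) \<in> S \<Longrightarrow> (u', w') \<in> S \<Longrightarrow> ((\<lambda>t. u t + u' t), (\<lambda>t. w t + w' t)) \<in> S"
    and mult: "\<And>c u w. (u, w) \<in> S \<Longrightarrow> ((\<lambda>t. c * u t), (\<lambda>t. c * w t)) \<in> S"
    and f: "f \<in> L2 M" and h: "h \<in> L2 M"
  obtains f0 h0 where "(f0, h0) \<in> op_closure M S"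
    and "\<And>u w. (u, w) \<in> S \<Longrightarrow> L2_inner M u (\<lambda>t. f t - f0 t) + L2_inner M w (\<lambda>t. h t - h0 t) = 0"
proof -
  \<comment> \<open>The squared distance from \<open>(f, h)\<close> in the direct sum of two copies
    of \<open>L2 M\<close>.\<close>
  define Q where "Q p = L2_sq M (\<lambda>t. f t - fst p t) + L2_sq M (\<lambda>t. h t - snd p t)" for p
  define d where "d = Inf (Q ` S)"
  have bdd: "bdd_below (Q ` S)"
    by (rule bdd_belowI[of _ 0]) (auto simp: Q_def)
  have d_le: "d \<le> Q p" if "p \<in> S" for p
    unfolding d_def using that bdd by (intro cInf_lower) auto
  have "\<exists>p\<in>S. Q p < d + inverse (real (Suc n))" for n
    using S0 cInf_lessD[of "Q ` S" "d + inverse (real (Suc n))"] unfolding d_def by auto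
  then obtain p where p: "\<And>n. p n \<in> S" "\<And>n. Q (p n) < d + inverse (real (Suc n))"
    by metis
  define U W where "U n = fst (p n)" and "W n = snd (p n)" for n
  have UW: "(U n, W n) \<in> S" and UL: "U n \<in> L2 M" and WL: "W n \<in> L2 M" for n
    using p(1)[of n] S[of "U n" "W n"] by (auto simp: U_def W_def)
  have Qn: "Q (U n, W n) < d + inverse (real (Suc n))" for n
    using p(2)[of n] by (simp add: U_def W_def)
  have sum_small: "L2_sq M (\<lambda>t. U m t - U n t) + L2_sq M (\<lambda>t. W m t - W n t)
      < 2 * inverse (real (Suc m)) + 2 * inverse (real (Suc n))" for m n
  proof -
    have "d \<le> Q ((\<lambda>t. (1/2) * (U m t + U n t)), (\<lambda>t. (1/2) * (W m t + W n t)))"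
      by (intro d_le mult[of "\<lambda>t. U m t + U n t" "\<lambda>t. W m t + W n t" "1/2"] add UW)
    then show ?thesis
      using Qn[of m] Qn[of n] L2_parallelogram[OF f UL[of m] UL[of n]]
        L2_parallelogram[OF h WL[of m] WL[of n]]
      by (simp add: Q_def)
  qed
  have "\<exists>N. \<forall>m\<ge>N. \<forall>n\<ge>N. L2_sq M (\<lambda>t. U m t - U n t) + L2_sq M (\<lambda>t. W m t - W n t) < e"
    if e: "e > 0" for e
  proof -
    obtain N where N: "inverse (real (Suc N)) < e / 4"
      using reals_Archimedean[of "e/4"] e by auto
    have k: "inverse (real (Suc k)) < e / 4" if "k \<ge> N" for k
      using N le_imp_inverse_le[of "real (Suc N)" "real (Suc k)"] that by linarith
    have "L2_sq M (\<lambda>t. U m t - U n t) + L2_sq M (\<lambda>t. W m t - W n t) < e"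
      if "m \<ge> N" "n \<ge> N" for m n
      using sum_small[of m n] k[OF that(1)] k[OF that(2)] by linarith
    then show ?thesis by blast
  qed
  note Cau = this
  have "\<exists>N. \<forall>m\<ge>N. \<forall>n\<ge>N. L2_sq M (\<lambda>t. U m t - U n t) < e" if "e > 0" for e
    using Cau[OF that] L2_sq_nonneg by (smt (verit, best))
  then obtain f0 where f0: "f0 \<in> L2 M" "L2_tendsto M U f0"
    using L2_complete[of U M] UL by blast
  have "\<exists>N. \<forall>m\<ge>N. \<forall>n\<ge>N. L2_sq M (\<lambda>t. W m t - W n t) < e" if "e > 0" for e
    using Cau[OF that] L2_sq_nonneg by (smt (verit, best))
  then obtain h0 where h0: "h0 \<in> L2 M" "L2_tendsto M W h0"
    using L2_complete[of W M] WL by blast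
  have "(f0, h0) \<in> op_closure M S"
    using f0 h0 UW by (auto simp: op_closure_def)
  moreover have "L2_inner M u (\<lambda>t. f t - f0 t) + L2_inner M w (\<lambda>t. h t - h0 t) = 0"
    if uw: "(u, w) \<in> S" for u w
  proof -
    note uL = S[OF uw, THEN conjunct1] and wL = S[OF uw, THEN conjunct2]
    define ip where "ip n = L2_inner M u (\<lambda>t. f t - U n t) + L2_inner M w (\<lambda>t. h t - W n t)" for n
    define ip0 where "ip0 = L2_inner M u (\<lambda>t. f t - f0 t) + L2_inner M w (\<lambda>t. h t - h0 t)"
    define N where "N = L2_sq M u + L2_sq M w"
    have "(\<lambda>n. cnj (L2_inner M (\<lambda>t. U n t) u)) \<longlonglongrightarrow> cnj (L2_inner M f0 u)"
      "(\<lambda>n. cnj (L2_inner M (\<lambda>t. W n t) w)) \<longlonglongrightarrow> cnj (L2_inner M h0 w)"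
      using f0 h0 UL WL uL wL by (auto intro!: tendsto_cnj L2_inner_tendsto)
    then have "(\<lambda>n. (L2_inner M u f - L2_inner M u (U n)) + (L2_inner M w h - L2_inner M w (W n)))
        \<longlonglongrightarrow> (L2_inner M u f - L2_inner M u f0) + (L2_inner M w h - L2_inner M w h0)"
      by (intro tendsto_intros) (simp_all flip: L2_inner_commute)
    then have ip: "ip \<longlonglongrightarrow> ip0"
      unfolding ip_def[abs_def] ip0_def using f h f0 h0 UL WL uL wL
      by (simp add: L2_inner_diff_right)
    \<comment> \<open>The limit \<open>(f0, h0)\<close> need not lie in \<open>S\<close>, so the
      perturbation is made at the minimising sequence, at the price of its defect 1/(n+1), which
      disappears in the limit.\<close>
    have ineq: "2 * Re (z * ip n) \<le> inverse (real (Suc n)) + (cmod z)\<^sup>2 * N" for z n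
    proof -
      have "((\<lambda>t. U n t + z * u t), (\<lambda>t. W n t + z * w t)) \<in> S"
        by (intro add UW mult uw)
      then have "d \<le> Q ((\<lambda>t. U n t + z * u t), (\<lambda>t. W n t + z * w t))"
        by (rule d_le)
      also have "\<dots> = L2_sq M (\<lambda>t. (f t - U n t) - z * u t) + L2_sq M (\<lambda>t. (h t - W n t) - z * w t)"
        by (simp add: Q_def algebra_simps)
      also have "\<dots> = Q (U n, W n) - 2 * Re (z * ip n) + (cmod z)\<^sup>2 * N"
        using L2_sq_expand[OF L2_diff[OF f UL] uL, of n z] L2_sq_expand[OF L2_diff[OF h WL] wL, of n z]
        by (simp add: Q_def ip_def N_def algebra_simps)
      finally show ?thesis using Qn[of n] by linarith
    qed
    have lim: "2 * Re (z * ip0) \<le> (cmod z)\<^sup>2 * N" for z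
    proof (rule LIMSEQ_le)
      show "(\<lambda>n. 2 * Re (z * ip n)) \<longlonglongrightarrow> 2 * Re (z * ip0)"
        by (intro tendsto_intros ip)
      have "(\<lambda>n. inverse (real (Suc n)) + (cmod z)\<^sup>2 * N) \<longlonglongrightarrow> 0 + (cmod z)\<^sup>2 * N"
        by (intro tendsto_intros LIMSEQ_inverse_real_of_nat)
      then show "(\<lambda>n. inverse (real (Suc n)) + (cmod z)\<^sup>2 * N) \<longlonglongrightarrow> (cmod z)\<^sup>2 * N"
        by simp
    qed (use ineq in blast)
    have "ip0 = 0"
    proof (rule ccontr)
      assume "ip0 \<noteq> 0"
      have Nn: "N \<ge> 0" by (simp add: N_def)
      \<comment> \<open>For \<open>z = s * cnj ip0\<close> the bound \<open>lim\<close> reads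
        \<open>2 s |ip0|^2 <= s^2 |ip0|^2 N\<close>. Any positive \<open>s\<close> with
        \<open>s N < 2\<close> contradicts it; \<open>N + 1\<close> avoids a division by
        zero.\<close>
      define s where "s = 1 / (N + 1)"
      have s: "s > 0" "s * N < 2"
        using Nn by (auto simp: s_def field_simps)
      have "2 * Re (of_real s * cnj ip0 * ip0) \<le> (cmod (of_real s * cnj ip0))\<^sup>2 * N"
        by (rule lim)
      moreover have "Re (of_real s * cnj ip0 * ip0) = s * (cmod ip0)\<^sup>2"
        unfolding cmod_power2 by (simp add: power2_eq_square algebra_simps)
      ultimately have "2 * (s * (cmod ip0)\<^sup>2) \<le> s * (cmod ip0)\<^sup>2 * (s * N)"
        by (simp add: norm_mult power_mult_distrib power2_eq_square mult_ac)
      moreover have "s * (cmod ip0)\<^sup>2 * (s * N) < s * (cmod ip0)\<^sup>2 * 2"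
        using s \<open>ip0 \<noteq> 0\<close> by (intro mult_strict_left_mono) auto
      ultimately show False by linarith
    qed
    then show ?thesis by (simp add: ip0_def)
  qed
  ultimately show ?thesis by (rule that)
qed

section \<open>Adjoints and closures of symmetric graphs\<close>

lemma op_adjoint_closure:
  assumes "\<And>f k. (f, k) \<in> T \<Longrightarrow> f \<in> L2 M \<and> k \<in> L2 M"
  shows "op_adjoint M (op_closure M T) = op_adjoint M T"
proof (intro equalityI subsetI)
  fix p assume p: "p \<in> op_adjoint M (op_closure M T)"
  have "T \<subseteq> op_closure M T"
  proof (rule subrelI)
    fix f k assume fk: "(f, k) \<in> T"
    have "\<exists>F G. (\<forall>n::nat. (F n, G n) \<in> T) \<and> L2_tendsto M F f \<and> L2_tendsto M G k"
      by (rule exI[of _ "\<lambda>n. f"], rule exI[of _ "\<lambda>n. k"]) (simp add: fk)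
    then show "(f, k) \<in> op_closure M T"
      using assms[OF fk] by (simp add: op_closure_def)
  qed
  then show "p \<in> op_adjoint M T"
    using p by (auto simp: op_adjoint_def)
next
  fix p assume "p \<in> op_adjoint M T"
  then obtain g h where p: "p = (g, h)" and g: "g \<in> L2 M" and h: "h \<in> L2 M"
    and T: "\<And>f k. (f, k) \<in> T \<Longrightarrow> L2_inner M k g = L2_inner M f h"
    unfolding op_adjoint_def by blast
  have "L2_inner M k g = L2_inner M f h" if fk: "(f, k) \<in> op_closure M T" for f k
  proof -
    from fk obtain F G where f: "f \<in> L2 M" and k: "k \<in> L2 M" and FG: "\<And>n::nat. (F n, G n) \<in> T"
      and lim: "L2_tendsto M F f" "L2_tendsto M G k"
      by (auto simp: op_closure_def)
    have L: "F n \<in> L2 M" "G n \<in> L2 M" for n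
      using assms[OF FG[of n]] by auto
    have "(\<lambda>n. L2_inner M (G n) g) \<longlonglongrightarrow> L2_inner M k g" "(\<lambda>n. L2_inner M (F n) h) \<longlonglongrightarrow> L2_inner M f h"
      by (intro L2_inner_tendsto L f k g h lim)+
    then show ?thesis
      using T[OF FG] by (simp add: LIMSEQ_unique)
  qed
  then show "p \<in> op_adjoint M (op_closure M T)"
    using g h by (auto simp: op_adjoint_def p)
qed

text \<open>If \<open>(f, h) \<in> T\<^sup>*\<close> and \<open>(-q, p)\<close> is its component orthogonal to the graph of \<open>T\<close>, then
  both \<open>(-q, p)\<close> and \<open>(p, q)\<close> lie in \<open>T\<^sup>*\<close>, so that the symmetry of \<open>T\<^sup>*\<close> gives
  \<open>\<parallel>p\<parallel>\<^sup>2 = -\<parallel>q\<parallel>\<^sup>2\<close>.\<close>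

lemma op_closure_eq_adjoint:
  assumes T: "\<And>u w. (u, w) \<in> T \<Longrightarrow> u \<in> L2 M \<and> w \<in> L2 M"
    and T0: "T \<noteq> {}"
    and add: "\<And>u w u' w'. (u, w) \<in> T \<Longrightarrow> (u', w') \<in> T \<Longrightarrow> ((\<lambda>t. u t + u' t), (\<lambda>t. w t + w' t)) \<in> T"
    and mult: "\<And>c u w. (u, w) \<in> T \<Longrightarrow> ((\<lambda>t. c * u t), (\<lambda>t. c * w t)) \<in> T"
    and sub: "T \<subseteq> op_adjoint M T"
    and sym: "\<And>f h g k. (f, h) \<in> op_adjoint M T \<Longrightarrow> (g, k) \<in> op_adjoint M T \<Longrightarrow>
      L2_inner M h g = L2_inner M f k"
  shows "op_closure M T = op_adjoint M T"
proof (intro equalityI subrelI)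
  fix f h assume fh: "(f, h) \<in> op_closure M T"
  have "L2_inner M w f = L2_inner M u h" if "(u, w) \<in> T" for u w
  proof -
    have "(u, w) \<in> op_adjoint M (op_closure M T)"
      using sub that op_adjoint_closure[OF T] by auto
    then have "L2_inner M h u = L2_inner M f w"
      using fh by (auto simp: op_adjoint_def)
    then show ?thesis
      by (metis L2_inner_commute)
  qed
  then show "(f, h) \<in> op_adjoint M T"
    using fh by (auto simp: op_adjoint_def op_closure_def)
next
  fix f h assume fh: "(f, h) \<in> op_adjoint M T"
  then have f: "f \<in> L2 M" and h: "h \<in> L2 M"
    and fhT: "\<And>u w. (u, w) \<in> T \<Longrightarrow> L2_inner M w f = L2_inner M u h"
    by (auto simp: op_adjoint_def)
  obtain f0 h0 where cl: "(f0, h0) \<in> op_closure M T"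
    and orth: "\<And>u w. (u, w) \<in> T \<Longrightarrow> L2_inner M u (\<lambda>t. f t - f0 t) + L2_inner M w (\<lambda>t. h t - h0 t) = 0"
    using graph_projection[OF T T0 add mult f h] by blast
  from cl obtain F G where f0: "f0 \<in> L2 M" and h0: "h0 \<in> L2 M" and FG: "\<And>n::nat. (F n, G n) \<in> T"
    and lim: "L2_tendsto M F f0" "L2_tendsto M G h0"
    by (auto simp: op_closure_def)
  have FGL: "F n \<in> L2 M" "G n \<in> L2 M" for n
    using T[OF FG[of n]] by auto
  define p q where "p t = h t - h0 t" and "q t = - (f t - f0 t)" for t
  have pL: "p \<in> L2 M" and qL: "q \<in> L2 M"
    unfolding p_def[abs_def] q_def[abs_def] by (intro L2_diff L2_uminus f h f0 h0)+
  \<comment> \<open>Orthogonality of \<open>(f - f0, h - h0)\<close> to the graph becomes, after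
    exchanging the components and one sign, the defining identity of the adjoint for
    \<open>(p, q)\<close>.\<close>
  have pq: "(p, q) \<in> op_adjoint M T"
  proof -
    have "L2_inner M w p = L2_inner M u q" if "(u, w) \<in> T" for u w
      using orth[OF that] unfolding p_def[abs_def] q_def[abs_def] L2_inner_uminus_right
      by (simp add: eq_neg_iff_add_eq_0 add.commute)
    then show ?thesis
      using pL qL by (auto simp: op_adjoint_def)
  qed
  have f0h0: "L2_inner M w f0 = L2_inner M u h0" if uw: "(u, w) \<in> T" for u w
  proof -
    have "(u, w) \<in> op_adjoint M (op_closure M T)"
      using sub that op_adjoint_closure[OF T] by auto
    then have "L2_inner M h0 u = L2_inner M f0 w"
      using cl by (auto simp: op_adjoint_def)
    then show ?thesis
      by (metis L2_inner_commute)
  qed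
  have "L2_inner M w (\<lambda>t. f t - f0 t) = L2_inner M u (\<lambda>t. h t - h0 t)" if "(u, w) \<in> T" for u w
    using f0h0[OF that] fhT[OF that] T[OF that] f h f0 h0 by (simp add: L2_inner_diff_right)
  then have "((\<lambda>t. f t - f0 t), p) \<in> op_adjoint M T"
    using L2_diff[OF f f0] pL by (auto simp: op_adjoint_def p_def[abs_def])
  from sym[OF pq this] have "L2_inner M q (\<lambda>t. - q t) = L2_inner M p p"
    by (simp add: q_def[abs_def])
  then have "- L2_sq M q = L2_sq M p"
    by (simp add: L2_inner_uminus_right L2_inner_self flip: of_real_minus)
  then have "L2_sq M p = 0" "L2_sq M q = 0"
    using L2_sq_nonneg[of M p] L2_sq_nonneg[of M q] by linarith+
  then have "AE t in M. p t = 0" "AE t in M. q t = 0"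
    using pL qL by (simp_all add: L2_sq_eq_0_iff)
  \<comment> \<open>Equality holds almost everywhere only; as the closure is saturated, the sequence
    approximating \<open>(f0, h0)\<close> serves for \<open>(f, h)\<close> as well.\<close>
  then have "AE t in M. h0 t = h t" "AE t in M. f0 t = f t"
    by (auto simp: p_def q_def elim: eventually_mono)
  then have "L2_tendsto M F f" "L2_tendsto M G h"
    using L2_tendsto_AE_cong[OF lim(1) _ f0 f] L2_tendsto_AE_cong[OF lim(2) _ h0 h] FGL by auto
  then show "(f, h) \<in> op_closure M T"
    using f h FG by (auto simp: op_closure_def)
qed

section \<open>Absolutely continuous functions and indefinite integrals\<close>

text \<open>A gauge argument: tags outside the exceptional null set are controlled by the derivative, and
  the intervals with tags in it lie in an open set of small measure, where absolute continuity
  applies.\<close>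

lemma abs_cont_on_has_integral:
  fixes F :: "real \<Rightarrow> complex"
  assumes cd: "c \<le> d" and AC: "abs_cont_on c d F"
    and deriv: "AE t in lebesgue. t \<in> {c..d} \<longrightarrow> (F has_vector_derivative g t) (at t)"
  shows "(g has_integral F d - F c) {c..d}"
proof -
  define N where "N = {t \<in> {c..d}. \<not> (F has_vector_derivative g t) (at t)}"
  have negN: "negligible N"
  proof -
    obtain N' where "N' \<in> null_sets lebesgue"
      "{t \<in> space lebesgue. \<not> (t \<in> {c..d} \<longrightarrow> (F has_vector_derivative g t) (at t))} \<subseteq> N'"
      using deriv unfolding eventually_ae_filter by blast
    moreover have "N \<subseteq> {t \<in> space lebesgue. \<not> (t \<in> {c..d} \<longrightarrow> (F has_vector_derivative g t) (at t))}"
      by (auto simp: N_def)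
    ultimately show ?thesis
      by (metis negligible_iff_null_sets negligible_subset subset_trans)
  qed
  \<comment> \<open>Nothing is known about \<open>g\<close> on \<open>N\<close>; its values there
    are set to zero, which is undone at the end by changing the integrand on a negligible
    set.\<close>
  define g' where "g' t = (if t \<in> N then 0 else g t)" for t
  have "(g' has_integral F d - F c) {c..d}"
    unfolding has_integral_real
  proof (intro allI impI)
    fix e :: real assume e: "e > 0"
    \<comment> \<open>Half of \<open>e\<close> is spent on tags outside \<open>N\<close>, where the
      total error is at most \<open>e1 * (d - c)\<close>, the other half on tags in
      \<open>N\<close>. The summand 1 covers \<open>c = d\<close>.\<close>
    define e1 where "e1 = e / (2 * (d - c + 1))"
    have e1: "e1 > 0" using e cd by (simp add: e1_def)
    obtain \<delta> where \<delta>: "\<delta> > 0"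
      and AC\<delta>: "\<forall>(n::nat) u v. (\<forall>i<n. c \<le> u i \<and> u i \<le> v i \<and> v i \<le> d) \<longrightarrow>
        disjoint_family_on (\<lambda>i. {u i<..<v i}) {..<n} \<longrightarrow> (\<Sum>i<n. v i - u i) < \<delta> \<longrightarrow>
        (\<Sum>i<n. cmod (F (v i) - F (u i))) < e / 2"
      using AC[unfolded abs_cont_on_def, rule_format, OF half_gt_zero[OF e]] by blast
    have N_null: "N \<in> null_sets lebesgue"
      using negN by (simp add: negligible_iff_null_sets)
    then have "N \<in> sets lebesgue" by auto
    from sets_lebesgue_outer_open[OF this \<delta>] obtain U where U: "open U" "N \<subseteq> U" "U - N \<in> lmeasurable"
      "emeasure lebesgue (U - N) < ennreal \<delta>" .
    have Ul: "U \<in> sets lebesgue" using U(1) by auto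
    have Um: "emeasure lebesgue U < ennreal \<delta>"
      using U(4) emeasure_Diff_null_set[OF N_null Ul] by simp
    have "\<exists>r>0. (t \<in> N \<longrightarrow> ball t r \<subseteq> U) \<and> (t \<in> {c..d} - N \<longrightarrow>
        (\<forall>y. \<bar>y - t\<bar> < r \<longrightarrow> cmod (F y - F t - (y - t) *\<^sub>R g t) \<le> e1 * \<bar>y - t\<bar>))" for t
    proof (cases "t \<in> N")
      case True
      then show ?thesis using U(1,2) open_contains_ball by blast
    next
      case False
      show ?thesis
      proof (cases "t \<in> {c..d}")
        case True
        with False have "(F has_vector_derivative g t) (at t)" by (auto simp: N_def)
        then show ?thesis
          using e1 False unfolding has_vector_derivative_def has_derivative_at_alt
          by (auto simp: real_norm_def)
      qed (use False in \<open>auto intro: exI[of _ 1]\<close>)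
    qed
    then obtain r where r: "\<And>t. r t > 0" "\<And>t. t \<in> N \<Longrightarrow> ball t (r t) \<subseteq> U"
      "\<And>t y. t \<in> {c..d} - N \<Longrightarrow> \<bar>y - t\<bar> < r t \<Longrightarrow> cmod (F y - F t - (y - t) *\<^sub>R g t) \<le> e1 * \<bar>y - t\<bar>"
      by metis
    define \<gamma> where "\<gamma> t = ball t (r t)" for t
    have gauge: "gauge \<gamma>" unfolding \<gamma>_def by (intro gauge_ball_dependent) (use r(1) in auto)
    have main: "norm ((\<Sum>(x,k)\<in>D. measure lborel k *\<^sub>R g' x) - (F d - F c)) < e"
      if D: "D tagged_division_of {c..d}" and fine: "\<gamma> fine D" for D
    proof -
      have fin: "finite D" using D by blast
      have Dk: "x \<in> k" "k \<subseteq> {c..d}" "x \<in> {c..d}" "k \<subseteq> \<gamma> x"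
        "Inf k \<in> k" "Sup k \<in> k" "Inf k \<le> x" "x \<le> Sup k" "interior k = {Inf k<..<Sup k}"
        "c \<le> Inf k" "Sup k \<le> d" "measure lborel k = Sup k - Inf k"
        if xk: "(x, k) \<in> D" for x k
      proof -
        show 1: "x \<in> k" "k \<subseteq> {c..d}" using D xk by blast+
        then show "x \<in> {c..d}" by blast
        show "k \<subseteq> \<gamma> x" using fine xk by (auto simp: fine_def)
        obtain a b where k: "k = {a..b}" using D xk by (metis tagged_division_ofD(4) box_real(2))
        with 1 have "a \<le> b" by auto
        with k show "Inf k \<in> k" "Sup k \<in> k" "interior k = {Inf k<..<Sup k}" "measure lborel k = Sup k - Inf k" by auto
        show "Inf k \<le> x" "x \<le> Sup k" using k 1(1) \<open>a \<le> b\<close> by auto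
        show "c \<le> Inf k" "Sup k \<le> d" using k \<open>a \<le> b\<close> 1(2) by auto
      qed
      define E where "E = {p\<in>D. fst p \<in> N}"
      have finE: "finite E" using fin by (simp add: E_def)
      define \<phi> where "\<phi> p = (case p of (x::real, k) \<Rightarrow> F (Sup k) - F (Inf k))" for p
      have tele: "F d - F c = (\<Sum>p\<in>D. \<phi> p)"
        unfolding \<phi>_def using additive_tagged_division_1[OF cd D, of F] by simp
      have len: "(\<Sum>(x,k)\<in>D. measure lborel k) = d - c"
        using additive_content_tagged_division[of D c d] D cd by simp
      have A: "norm (\<Sum>p\<in>D - E. (case p of (x, k) \<Rightarrow> measure lborel k *\<^sub>R g' x) - \<phi> p) \<le> e1 * (d - c)"
      proof -
        have "norm (\<Sum>p\<in>D - E. (case p of (x, k) \<Rightarrow> measure lborel k *\<^sub>R g' x) - \<phi> p)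
            \<le> (\<Sum>p\<in>D - E. e1 * (case p of (x, k) \<Rightarrow> measure lborel k))"
        proof (rule sum_norm_le, clarify)
          fix x k assume xk: "(x, k) \<in> D" "(x, k) \<notin> E"
          note K = Dk[OF xk(1)]
          have xN: "x \<notin> N" using xk by (auto simp: E_def)
          have *: "\<bar>Inf k - x\<bar> < r x" "\<bar>Sup k - x\<bar> < r x"
            using K(4,5,6) by (auto simp: \<gamma>_def dist_real_def abs_minus_commute)
          \<comment> \<open>The tag lies between the endpoints, so the derivative is used from
            \<open>x\<close> to each endpoint separately, and the two errors add up to
            \<open>e1\<close> times the length.\<close>
          have "measure lborel k *\<^sub>R g x - (F (Sup k) - F (Inf k)) =
            (F (Inf k) - F x - (Inf k - x) *\<^sub>R g x) - (F (Sup k) - F x - (Sup k - x) *\<^sub>R g x)"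
            unfolding K(12) by (simp add: algebra_simps)
          also have "norm \<dots> \<le> e1 * \<bar>Inf k - x\<bar> + e1 * \<bar>Sup k - x\<bar>"
            using K(3) xN * by (intro order_trans[OF norm_triangle_ineq4] add_mono r(3)) auto
          also have "\<dots> = e1 * measure lborel k"
            using K(7,8) unfolding K(12) by (simp add: algebra_simps)
          finally show "norm (measure lborel k *\<^sub>R g' x - \<phi> (x, k)) \<le> e1 * measure lborel k"
            using xN by (simp add: g'_def \<phi>_def)
        qed
        also have "\<dots> \<le> (\<Sum>p\<in>D. e1 * (case p of (x, k) \<Rightarrow> measure lborel k))"
          using fin e1 by (intro sum_mono2) (auto simp: measure_nonneg)
        also have "\<dots> = e1 * (d - c)"
          using len by (simp add: sum_distrib_left[symmetric])
        finally show ?thesis .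
      qed
      have B: "norm (\<Sum>p\<in>E. (case p of (x, k) \<Rightarrow> measure lborel k *\<^sub>R g' x) - \<phi> p) < e / 2"
      proof -
        have dis: "{Inf (snd p)<..<Sup (snd p)} \<inter> {Inf (snd q)<..<Sup (snd q)} = {}"
          if "p \<in> E" "q \<in> E" "p \<noteq> q" for p q
        proof -
          have "interior (snd p) \<inter> interior (snd q) = {}"
            using that D tagged_division_ofD(5)[OF D, of "fst p" "snd p" "fst q" "snd q"]
            by (auto simp: E_def)
          moreover have "interior (snd p) = {Inf (snd p)<..<Sup (snd p)}" if "p \<in> E" for p
            using Dk(9)[of "fst p" "snd p"] that by (auto simp: E_def)
          ultimately show ?thesis using that by auto
        qed
        \<comment> \<open>\<open>abs_cont_on\<close> speaks of intervals numbered by naturals, hence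
          the enumeration of the finite set \<open>E\<close>.\<close>
        obtain h where h: "bij_betw h {..<card E} E"
          using finE ex_bij_betw_nat_finite lessThan_atLeast0 by metis
        have hE: "h i \<in> E" if "i < card E" for i
          using h that by (auto simp: bij_betw_def)
        define u v where "u i = Inf (snd (h i))" and "v i = Sup (snd (h i))" for i
        have uv: "\<forall>i<card E. c \<le> u i \<and> u i \<le> v i \<and> v i \<le> d"
        proof (intro allI impI)
          fix i assume "i < card E"
          then have "(fst (h i), snd (h i)) \<in> D" using hE by (auto simp: E_def)
          from Dk(7,8,10,11)[OF this] show "c \<le> u i \<and> u i \<le> v i \<and> v i \<le> d"
            by (simp add: u_def v_def)
        qed
        have disj: "disjoint_family_on (\<lambda>i. {u i<..<v i}) {..<card E}"
          unfolding disjoint_family_on_def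
        proof (intro ballI impI)
          fix i j assume "i \<in> {..<card E}" "j \<in> {..<card E}" "i \<noteq> j"
          then have "h i \<noteq> h j" "h i \<in> E" "h j \<in> E"
            using h hE by (auto simp: bij_betw_def inj_on_def)
          then show "{u i<..<v i} \<inter> {u j<..<v j} = {}"
            unfolding u_def v_def by (intro dis)
        qed
        have "ennreal (\<Sum>i<card E. v i - u i) = (\<Sum>i<card E. emeasure lebesgue {u i<..<v i})"
          using uv by (subst sum_ennreal[symmetric]) auto
        also have "\<dots> = emeasure lebesgue (\<Union>i<card E. {u i<..<v i})"
          by (rule sum_emeasure) (use disj in auto)
        also have "\<dots> \<le> emeasure lebesgue U"
        proof (rule emeasure_mono[OF UN_least Ul])
          fix i assume "i \<in> {..<card E}"
          then have "h i \<in> E" using hE by auto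
          then have x: "(fst (h i), snd (h i)) \<in> D" "fst (h i) \<in> N" by (auto simp: E_def)
          have "{u i<..<v i} \<subseteq> snd (h i)"
            using Dk(9)[OF x(1)] interior_subset[of "snd (h i)"] by (simp add: u_def v_def)
          also have "\<dots> \<subseteq> \<gamma> (fst (h i))" by (rule Dk(4)[OF x(1)])
          also have "\<dots> \<subseteq> U" unfolding \<gamma>_def by (rule r(2)[OF x(2)])
          finally show "{u i<..<v i} \<subseteq> U" .
        qed
        also have "\<dots> < ennreal \<delta>" by (rule Um)
        finally have "ennreal (\<Sum>i<card E. v i - u i) < ennreal \<delta>" .
        moreover have "0 \<le> (\<Sum>i<card E. v i - u i)"
          by (intro sum_nonneg) (use uv in auto)
        ultimately have small: "(\<Sum>i<card E. v i - u i) < \<delta>"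
          by (simp add: ennreal_less_iff)
        \<comment> \<open>At tags in \<open>N\<close> the modified integrand is zero, so only the
          increments of \<open>F\<close> remain.\<close>
        have "norm (\<Sum>p\<in>E. (case p of (x, k) \<Rightarrow> measure lborel k *\<^sub>R g' x) - \<phi> p) = norm (\<Sum>p\<in>E. \<phi> p)"
        proof -
          have "(\<Sum>p\<in>E. (case p of (x, k) \<Rightarrow> measure lborel k *\<^sub>R g' x) - \<phi> p) = (\<Sum>p\<in>E. - \<phi> p)"
            by (rule sum.cong) (auto simp: E_def g'_def)
          then show ?thesis by (simp add: sum_negf)
        qed
        also have "\<dots> \<le> (\<Sum>p\<in>E. norm (\<phi> p))" by (rule norm_sum)
        also have "\<dots> = (\<Sum>i<card E. norm (\<phi> (h i)))"
          using h by (intro sum.reindex_bij_betw[symmetric])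
        also have "\<dots> = (\<Sum>i<card E. cmod (F (v i) - F (u i)))"
          by (simp add: \<phi>_def u_def v_def case_prod_beta)
        also have "\<dots> < e / 2" by (rule AC\<delta>[rule_format, OF uv[rule_format] disj small])
        finally show ?thesis .
      qed
      have "(\<Sum>(x,k)\<in>D. measure lborel k *\<^sub>R g' x) - (F d - F c) =
          (\<Sum>p\<in>D. (case p of (x, k) \<Rightarrow> measure lborel k *\<^sub>R g' x) - \<phi> p)"
        by (simp add: tele sum_subtractf)
      also have "\<dots> = (\<Sum>p\<in>D - E. (case p of (x, k) \<Rightarrow> measure lborel k *\<^sub>R g' x) - \<phi> p)
          + (\<Sum>p\<in>E. (case p of (x, k) \<Rightarrow> measure lborel k *\<^sub>R g' x) - \<phi> p)"
        using fin by (intro sum.subset_diff) (auto simp: E_def)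
      also have "norm \<dots> < e1 * (d - c) + e / 2"
        using A B by (intro order_le_less_trans[OF norm_triangle_ineq] add_le_less_mono)
      also have "e1 * (d - c) \<le> e / 2"
        using cd e by (simp add: e1_def field_simps)
      finally show ?thesis by simp
    qed
    show "\<exists>\<gamma>. gauge \<gamma> \<and> (\<forall>D. D tagged_division_of {c..d} \<and> \<gamma> fine D \<longrightarrow>
        norm ((\<Sum>(x,k)\<in>D. measure lborel k *\<^sub>R g' x) - (F d - F c)) < e)"
      using gauge by (intro exI[of _ \<gamma>] conjI allI impI main) auto
  qed
  then show ?thesis
    by (rule has_integral_spike[OF negN, rotated]) (auto simp: g'_def)
qed

text \<open>Density uniqueness and Fubini are applied to \<open>lebesgue\<close> itself, since
  elements of \<open>L2 M\<close> are only Lebesgue measurable.\<close>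

lemma sigma_finite_lebesgue: "sigma_finite_measure (lebesgue :: 'a::euclidean_space measure)"
proof
  show "\<exists>A::'a set set. countable A \<and> A \<subseteq> sets lebesgue \<and> \<Union>A = space lebesgue \<and> (\<forall>a\<in>A. emeasure lebesgue a \<noteq> \<infinity>)"
  proof (intro exI conjI)
    show "countable (range (\<lambda>n::nat. cball (0::'a) (real n)))" by simp
    show "\<Union>(range (\<lambda>n::nat. cball (0::'a) (real n))) = space lebesgue"
      by (auto simp: real_arch_simple)
    show "\<forall>a\<in>range (\<lambda>n::nat. cball (0::'a) (real n)). emeasure lebesgue a \<noteq> \<infinity>"
      using fmeasurableD2[OF lmeasurable_cball] by auto
  qed auto
qed

text \<open>The sets over which the extension of \<open>h\<close> by zero has integral zero form a
  Dynkin system containing the half-lines, an intersection-stable generator of the Borel sets. Null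
  sets extend this to all Lebesgue sets, and a density with vanishing set integrals is zero almost
  everywhere.\<close>

lemma AE_eq_0_if_integrals_eq_0:
  fixes h :: "real \<Rightarrow> complex"
  assumes h: "h absolutely_integrable_on {0..T}"
    and zero: "\<And>t. 0 \<le> t \<Longrightarrow> t \<le> T \<Longrightarrow> integral {0..t} h = 0"
  shows "AE t in lebesgue. t \<in> {0..T} \<longrightarrow> h t = 0"
proof -
  define f where "f t = indicator {0..T} t *\<^sub>R h t" for t
  have f: "integrable lebesgue f"
    using h by (simp add: set_integrable_def f_def[abs_def])
  have fA: "set_integrable lebesgue A f" if "A \<in> sets lebesgue" for A
    unfolding set_integrable_def using f that by (rule integrable_mult_indicator[rotated])
  have basic: "set_lebesgue_integral lebesgue {..a} f = 0" for a
  proof -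
    have "set_lebesgue_integral lebesgue {..a} f = set_lebesgue_integral lebesgue {0..min a T} h"
      unfolding set_lebesgue_integral_def f_def
      by (intro Bochner_Integration.integral_cong) (auto simp: indicator_def)
    also have "\<dots> = integral {0..min a T} h"
      by (rule set_lebesgue_integral_eq_integral, rule absolutely_integrable_on_subinterval[OF h]) auto
    also have "\<dots> = 0"
      by (cases "0 \<le> min a T") (auto intro: zero)
    finally show ?thesis .
  qed
  have all: "set_lebesgue_integral lebesgue UNIV f = 0"
  proof -
    have "set_lebesgue_integral lebesgue UNIV f = set_lebesgue_integral lebesgue {..T} f"
      unfolding set_lebesgue_integral_def f_def
      by (intro Bochner_Integration.integral_cong) (auto simp: indicator_def)
    then show ?thesis using basic by simp
  qed
  have borel: "set_lebesgue_integral lebesgue A f = 0" if "A \<in> sets borel" for A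
  proof -
    have "Int_stable (range (\<lambda>a::real. {..a}))"
      by (auto simp: Int_stable_def)
    moreover have "range (\<lambda>a::real. {..a}) \<subseteq> Pow UNIV" by auto
    moreover have S: "sigma_sets UNIV (range (\<lambda>a::real. {..a})) = sets borel"
      by (subst borel_eq_atMost) simp
    then have "A \<in> sigma_sets UNIV (range (\<lambda>a::real. {..a}))"
      using that by simp
    ultimately show ?thesis
    proof (induction A rule: sigma_sets_induct_disjoint)
      case (basic A)
      then show ?case using \<open>\<And>a. set_lebesgue_integral lebesgue {..a} f = 0\<close> by auto
    next
      case empty
      then show ?case by (simp add: set_lebesgue_integral_def)
    next
      case (compl A)
      then have A: "A \<in> sets lebesgue" using S by auto
      have "set_lebesgue_integral lebesgue (A \<union> (UNIV - A)) f =
          set_lebesgue_integral lebesgue A f + set_lebesgue_integral lebesgue (UNIV - A) f"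
        using sets.compl_sets[OF A] by (intro set_integral_Un fA A) auto
      moreover have "A \<union> (UNIV - A) = UNIV" by auto
      ultimately show ?case using compl all by simp
    next
      case (union A)
      have Al: "A i \<in> sets lebesgue" for i using union(2) S by auto
      have "set_lebesgue_integral lebesgue (\<Union>i. A i) f = (\<Sum>i. set_lebesgue_integral lebesgue (A i) f)"
        by (rule lebesgue_integral_countable_add)
           (use Al union(1) in \<open>auto simp: disjoint_family_on_def intro: fA\<close>)
      then show ?case using union(3) by simp
    qed
  qed
  have "AE t in lebesgue. f t = 0"
  proof (rule sigma_finite_measure.density_zero[OF sigma_finite_lebesgue f])
    fix A :: "real set" assume A: "A \<in> sets lebesgue"
    have B: "main_part lborel A \<in> sets borel"
      using main_part_sets[OF A] by simp
    then have B': "main_part lborel A \<in> sets lebesgue" by auto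
    \<comment> \<open>A Lebesgue set exceeds its Borel main part by a subset of a null set only,
      which does not affect the integral.\<close>
    have "A = main_part lborel A \<union> null_part lborel A"
      using main_part_null_part_Un[OF A] by simp
    moreover obtain N where "N \<in> null_sets lborel" "null_part lborel A \<subseteq> N"
      using null_part[OF A] by blast
    then have "AE t in lebesgue. t \<notin> null_part lborel A"
      by (intro AE_completion) (auto intro: AE_not_in[THEN eventually_mono])
    ultimately have "AE t in lebesgue. indicator A t *\<^sub>R f t = indicator (main_part lborel A) t *\<^sub>R f t"
      by (elim eventually_mono) (auto simp: indicator_def)
    then have "set_lebesgue_integral lebesgue A f = set_lebesgue_integral lebesgue (main_part lborel A) f"
      unfolding set_lebesgue_integral_def
      by (intro integral_cong_AE) (use A B' f in \<open>auto intro!: borel_measurable_scaleR borel_measurable_indicator\<close>)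
    then show "set_lebesgue_integral lebesgue A f = 0" using borel[OF B] by simp
  qed
  then show ?thesis
    by (elim eventually_mono) (auto simp: f_def)
qed

text \<open>Fubini's theorem on the two triangles of
  the square \<open>[0,t]\<^sup>2\<close>.\<close>

lemma integral_mult_indefinite:
  fixes p q :: "real \<Rightarrow> complex"
  assumes t: "0 \<le> t" and p: "p absolutely_integrable_on {0..t}" and q: "q absolutely_integrable_on {0..t}"
  shows "(\<lambda>s. p s * integral {0..s} q) absolutely_integrable_on {0..t}"
    and "(\<lambda>s. q s * integral {0..s} p) absolutely_integrable_on {0..t}"
    and "integral {0..t} p * integral {0..t} q =
      integral {0..t} (\<lambda>s. p s * integral {0..s} q) + integral {0..t} (\<lambda>s. q s * integral {0..s} p)"
proof -
  let ?L = "lebesgue :: real measure"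
  interpret L: sigma_finite_measure ?L by (rule sigma_finite_lebesgue)
  interpret LL: pair_sigma_finite ?L ?L ..
  define P Q where "P s = indicator {0..t} s *\<^sub>R p s" and "Q s = indicator {0..t} s *\<^sub>R q s" for s
  have P: "integrable ?L P" and Q: "integrable ?L Q"
    using p q by (simp_all add: set_integrable_def P_def[abs_def] Q_def[abs_def])
  have [measurable]: "P \<in> borel_measurable ?L" "Q \<in> borel_measurable ?L"
    using P Q by auto
  have [measurable]: "fst \<in> borel_measurable (?L \<Otimes>\<^sub>M ?L)" "snd \<in> borel_measurable (?L \<Otimes>\<^sub>M ?L)"
    by (rule measurable_compose[OF measurable_fst measurable_completion], simp)
       (rule measurable_compose[OF measurable_snd measurable_completion], simp)
  have R: "integrable (?L \<Otimes>\<^sub>M ?L) (\<lambda>(s, r). P s * Q r)"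
  proof (rule LL.Fubini_integrable)
    show "integrable ?L (\<lambda>s. LINT r|?L. norm (case (s, r) of (s, r) \<Rightarrow> P s * Q r))"
      using P by (simp add: norm_mult)
    show "AE s in ?L. integrable ?L (\<lambda>r. case (s, r) of (s, r) \<Rightarrow> P s * Q r)"
      using Q by simp
  qed measurable
  define f1 f2 where "f1 s r = (if r \<le> s then P s * Q r else 0)"
    and "f2 s r = (if r \<le> s then 0 else P s * Q r)" for s r
  have f1: "integrable (?L \<Otimes>\<^sub>M ?L) (case_prod f1)"
  proof (rule Bochner_Integration.integrable_bound[OF R])
    have "(\<lambda>z. if snd z \<le> fst z then P (fst z) * Q (snd z) else 0) \<in> borel_measurable (?L \<Otimes>\<^sub>M ?L)"
      by measurable
    then show "case_prod f1 \<in> borel_measurable (?L \<Otimes>\<^sub>M ?L)"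
      by (simp add: f1_def[abs_def] case_prod_beta')
  qed (auto simp: f1_def)
  have f2: "integrable (?L \<Otimes>\<^sub>M ?L) (case_prod f2)"
  proof (rule Bochner_Integration.integrable_bound[OF R])
    have "(\<lambda>z. if snd z \<le> fst z then 0 else P (fst z) * Q (snd z)) \<in> borel_measurable (?L \<Otimes>\<^sub>M ?L)"
      by measurable
    then show "case_prod f2 \<in> borel_measurable (?L \<Otimes>\<^sub>M ?L)"
      by (simp add: f2_def[abs_def] case_prod_beta')
  qed (auto simp: f2_def)
  have in1: "(LINT r|?L. f1 s r) = indicator {0..t} s *\<^sub>R (p s * integral {0..s} q)" for s
  proof (cases "s \<in> {0..t}")
    case True
    have "(LINT r|?L. f1 s r) = (LINT r|?L. p s * (indicator {0..s} r *\<^sub>R q r))"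
      using True by (intro Bochner_Integration.integral_cong) (auto simp: f1_def P_def Q_def indicator_def)
    also have "\<dots> = p s * set_lebesgue_integral ?L {0..s} q"
      by (simp only: set_lebesgue_integral_def Bochner_Integration.integral_mult_right_zero)
    also have "set_lebesgue_integral ?L {0..s} q = integral {0..s} q"
      by (rule set_lebesgue_integral_eq_integral, rule absolutely_integrable_on_subinterval[OF q]) (use True in auto)
    finally show ?thesis using True by simp
  next
    case False
    then have "f1 s = (\<lambda>r. 0)" by (auto simp: f1_def P_def)
    then show ?thesis using False by simp
  qed
  have in2: "(LINT s|?L. f2 s r) = indicator {0..t} r *\<^sub>R (q r * integral {0..r} p)" for r
  proof (cases "r \<in> {0..t}")
    case True
    have "(LINT s|?L. f2 s r) = (LINT s|?L. q r * (indicator {0..r} s *\<^sub>R p s))"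
    proof (rule integral_cong_AE)
      show "AE s in ?L. f2 s r = q r * (indicator {0..r} s *\<^sub>R p s)"
      proof -
        \<comment> \<open>The triangle of \<open>f2\<close> is open along the diagonal while
          \<open>{0..r}\<close> is closed; the sections differ in one point.\<close>
        have "AE s in ?L. s \<noteq> r"
          by (intro AE_completion AE_lborel_singleton)
        then show ?thesis
          by eventually_elim (use True in \<open>auto simp: f2_def P_def Q_def indicator_def\<close>)
      qed
      show "(\<lambda>s. f2 s r) \<in> borel_measurable ?L"
        using measurable_Pair2'[of r ?L ?L] f2 by (simp add: f2_def[abs_def])
      show "(\<lambda>s. q r * (indicator {0..r} s *\<^sub>R p s)) \<in> borel_measurable ?L"
        using absolutely_integrable_on_subinterval[OF p, of 0 r] True
        by (intro borel_measurable_times borel_measurable_const borel_measurable_integrable)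
           (simp add: set_integrable_def)
    qed
    also have "\<dots> = q r * set_lebesgue_integral ?L {0..r} p"
      by (simp only: set_lebesgue_integral_def Bochner_Integration.integral_mult_right_zero)
    also have "set_lebesgue_integral ?L {0..r} p = integral {0..r} p"
      by (rule set_lebesgue_integral_eq_integral, rule absolutely_integrable_on_subinterval[OF p]) (use True in auto)
    finally show ?thesis using True by simp
  next
    case False
    then have "(\<lambda>s. f2 s r) = (\<lambda>s. 0)" by (auto simp: f2_def Q_def)
    then show ?thesis using False by simp
  qed
  show I1: "(\<lambda>s. p s * integral {0..s} q) absolutely_integrable_on {0..t}"
    using LL.integrable_fst[OF f1] by (simp add: in1 set_integrable_def)
  show I2: "(\<lambda>s. q s * integral {0..s} p) absolutely_integrable_on {0..t}"
    using LL.integrable_snd[OF f2] by (simp add: in2 set_integrable_def)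
  have "integral {0..t} p * integral {0..t} q = integral\<^sup>L ?L P * integral\<^sup>L ?L Q"
    using set_lebesgue_integral_eq_integral(2)[OF p] set_lebesgue_integral_eq_integral(2)[OF q]
    by (simp add: set_lebesgue_integral_def P_def[abs_def] Q_def[abs_def])
  also have "\<dots> = (LINT s|?L. (LINT r|?L. P s * Q r))"
    by simp
  also have "\<dots> = integral\<^sup>L (?L \<Otimes>\<^sub>M ?L) (\<lambda>(s, r). P s * Q r)"
    by (rule LL.integral_fst) (use R in simp)
  also have "\<dots> = integral\<^sup>L (?L \<Otimes>\<^sub>M ?L) (\<lambda>z. case_prod f1 z + case_prod f2 z)"
    by (intro Bochner_Integration.integral_cong) (auto simp: f1_def f2_def)
  also have "\<dots> = integral\<^sup>L (?L \<Otimes>\<^sub>M ?L) (case_prod f1) + integral\<^sup>L (?L \<Otimes>\<^sub>M ?L) (case_prod f2)"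
    by (rule Bochner_Integration.integral_add[OF f1 f2])
  also have "\<dots> = (LINT s|?L. LINT r|?L. f1 s r) + (LINT r|?L. LINT s|?L. f2 s r)"
    by (simp add: LL.integral_fst[OF f1] LL.integral_snd[OF f2])
  also have "\<dots> = set_lebesgue_integral ?L {0..t} (\<lambda>s. p s * integral {0..s} q)
      + set_lebesgue_integral ?L {0..t} (\<lambda>s. q s * integral {0..s} p)"
    by (simp add: in1 in2 set_lebesgue_integral_def)
  also have "\<dots> = integral {0..t} (\<lambda>s. p s * integral {0..s} q) + integral {0..t} (\<lambda>s. q s * integral {0..s} p)"
    using set_lebesgue_integral_eq_integral(2)[OF I1] set_lebesgue_integral_eq_integral(2)[OF I2] by simp
  finally show "integral {0..t} p * integral {0..t} q =
      integral {0..t} (\<lambda>s. p s * integral {0..s} q) + integral {0..t} (\<lambda>s. q s * integral {0..s} p)" .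
qed

lemma absolutely_integrable_mult_continuous:
  fixes f :: "real \<Rightarrow> 'a::{real_normed_field, euclidean_space}"
  assumes f: "f absolutely_integrable_on {a..e}" and g: "continuous_on {a..e} g"
  shows "(\<lambda>s. f s * g s) absolutely_integrable_on {a..e}"
proof -
  have "(\<lambda>s. g s * f s) absolutely_integrable_on {a..e}"
  proof (rule absolutely_integrable_bounded_measurable_product[OF bilinear_times])
    show "g \<in> borel_measurable (lebesgue_on {a..e})"
      using g by (rule continuous_imp_measurable_on_sets_lebesgue) auto
    show "bounded (g ` {a..e})"
      using g compact_continuous_image compact_imp_bounded by blast
  qed (use f in auto)
  then show ?thesis by (simp add: mult.commute)
qed

text \<open>At a maximum point the hypothesis gives \<open>y \<le> C + y / 2\<close>, because the
  kernel has mass at most 1/2. The kernel is only integrable here, as are the products of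
  \<open>L2\<close> functions to which this is applied.\<close>

lemma small_Gronwall:
  fixes y B :: "real \<Rightarrow> real"
  assumes ae: "a \<le> e" and y: "continuous_on {a..e} y" and B: "B absolutely_integrable_on {a..e}"
    and B0: "\<And>t. t \<in> {a..e} \<Longrightarrow> 0 \<le> B t"
    and le: "\<And>t. t \<in> {a..e} \<Longrightarrow> y t \<le> C + integral {a..t} (\<lambda>s. B s * y s)"
    and y0: "\<And>t. t \<in> {a..e} \<Longrightarrow> 0 \<le> y t"
    and small: "integral {a..e} B \<le> 1 / 2"
    and t: "t \<in> {a..e}"
  shows "y t \<le> 2 * C"
proof -
  obtain \<tau> where \<tau>: "\<tau> \<in> {a..e}" "\<And>s. s \<in> {a..e} \<Longrightarrow> y s \<le> y \<tau>"
    using continuous_attains_sup[OF _ _ y] ae by auto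
  have sub: "{a..\<tau>} \<subseteq> {a..e}" using \<tau> by auto
  have "integral {a..\<tau>} (\<lambda>s. B s * y s) \<le> integral {a..\<tau>} (\<lambda>s. B s * y \<tau>)"
  proof (rule integral_le)
    have "(\<lambda>s. B s * y s) absolutely_integrable_on {a..\<tau>}"
      using absolutely_integrable_on_subinterval[OF B sub] continuous_on_subset[OF y sub]
      by (rule absolutely_integrable_mult_continuous)
    then show "(\<lambda>s. B s * y s) integrable_on {a..\<tau>}" by (rule set_lebesgue_integral_eq_integral)
    have "B absolutely_integrable_on {a..\<tau>}" by (rule absolutely_integrable_on_subinterval[OF B sub])
    then show "(\<lambda>s. B s * y \<tau>) integrable_on {a..\<tau>}"
      by (intro integrable_on_mult_left set_lebesgue_integral_eq_integral)
  qed (use sub \<tau> B0 in \<open>auto intro!: mult_left_mono\<close>)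
  also have "\<dots> = integral {a..\<tau>} B * y \<tau>" by simp
  also have "\<dots> \<le> 1 / 2 * y \<tau>"
  proof (rule mult_right_mono)
    have "integral {a..\<tau>} B \<le> integral {a..e} B"
      by (rule integral_subset_le[OF sub])
         (use B absolutely_integrable_on_subinterval[OF B sub] B0 in
           \<open>auto intro: set_lebesgue_integral_eq_integral\<close>)
    then show "integral {a..\<tau>} B \<le> 1 / 2" using small by simp
  qed (use y0 \<tau> in auto)
  finally have "y \<tau> \<le> 2 * C" using le[OF \<tau>(1)] by simp
  then show ?thesis using \<tau>(2)[OF t] by simp
qed

section \<open>Solutions of the interface problem\<close>

locale interface_problem =
  fixes b :: ereal and x \<beta> :: "nat \<Rightarrow> real"
  assumes x_0: "x 0 = 0"
    and strict_mono_x: "strict_mono x"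
    and x_less_b: "ereal (x n) < b"
    and x_tendsto_b: "(\<lambda>n. ereal (x n)) \<longlonglongrightarrow> b"
begin

abbreviation I :: "real set" where "I \<equiv> half_open b"
abbreviation X :: "real set" where "X \<equiv> x ` {1..}"
abbreviation M :: "real measure" where "M \<equiv> lebesgue_on I"

lemma I_iff: "t \<in> I \<longleftrightarrow> 0 \<le> t \<and> ereal t < b"
  by (simp add: half_open_def)

lemma I_down: "t \<in> I \<Longrightarrow> 0 \<le> s \<Longrightarrow> s \<le> t \<Longrightarrow> s \<in> I"
  by (auto simp: I_iff intro: le_less_trans[of "ereal s" "ereal t"])

lemma I_sub: "t \<in> I \<Longrightarrow> {0..t} \<subseteq> I"
  using I_down by auto

lemma x_less_iff [simp]: "x m < x n \<longleftrightarrow> m < n"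
  using strict_mono_x by (rule strict_mono_less)

lemma x_le_iff [simp]: "x m \<le> x n \<longleftrightarrow> m \<le> n"
  using strict_mono_x by (rule strict_mono_less_eq)

lemma x_nonneg: "0 \<le> x n"
  using x_le_iff[of 0 n] by (simp add: x_0 del: x_le_iff)

lemma x_in_I: "x n \<in> I"
  by (simp add: I_iff x_nonneg x_less_b)

lemma zero_in_I: "0 \<in> I"
  using x_in_I[of 0] by (simp add: x_0)

lemma I_sets [measurable]: "I \<in> sets borel"
proof -
  have "I = {t \<in> space borel. 0 \<le> t \<and> ereal t < b}"
    by (auto simp: I_iff)
  also have "\<dots> \<in> sets borel" by measurable
  finally show ?thesis .
qed

lemma I_lebesgue [simp, intro]: "I \<in> sets lebesgue"
  using I_sets by auto

lemma ex_x_greater: "t \<in> I \<Longrightarrow> \<exists>n. t < x n"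
proof -
  assume "t \<in> I"
  then have "\<forall>\<^sub>F n in sequentially. ereal t < ereal (x n)"
    using x_tendsto_b by (intro order_tendstoD) (auto simp: I_iff)
  then obtain n where "ereal t < ereal (x n)"
    using eventually_happens by fastforce
  then show ?thesis by auto
qed

lemma cell:
  assumes "t \<in> I"
  obtains n where "x n \<le> t" "t < x (Suc n)"
proof -
  define m where "m = (LEAST n. t < x n)"
  have m: "t < x m"
    unfolding m_def using ex_x_greater[OF assms] by (rule LeastI_ex)
  then have "m \<noteq> 0"
    using assms by (intro notI) (auto simp: x_0 I_iff)
  then obtain n where n: "m = Suc n"
    by (cases m) auto
  have "\<not> t < x n"
    using not_less_Least[of n "\<lambda>n. t < x n"] n by (simp add: m_def)
  then show ?thesis using that[of n] m n by simp
qed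

lemma cell_in_I: "x n \<le> t \<Longrightarrow> t \<le> x m \<Longrightarrow> t \<in> I"
  using I_down[OF x_in_I[of m], of t] x_nonneg[of n] by simp

lemma open_cell: "{x n<..<x (Suc n)} \<subseteq> I - X"
proof
  fix t assume t: "t \<in> {x n<..<x (Suc n)}"
  then have "t \<in> I" using cell_in_I[of n t "Suc n"] by auto
  moreover have "t \<notin> X"
  proof
    assume "t \<in> X"
    then obtain m where "t = x m" by auto
    with t have "n < m" "m < Suc n" by auto
    then show False by simp
  qed
  ultimately show "t \<in> I - X" by simp
qed

text \<open>The centres start at index 1, so \<open>0 = x 0\<close> is the one left endpoint of a
  cell that lies outside \<open>X\<close>; it is excluded separately.\<close>

lemma cell_off_X: "x n \<le> t \<Longrightarrow> t < x (Suc n) \<Longrightarrow> t \<notin> X \<Longrightarrow> t \<noteq> 0 \<Longrightarrow> x n < t"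
  by (cases n) (auto simp: x_0 less_le)

lemma ex_off_X: "a \<in> I \<Longrightarrow> \<exists>t\<in>I - X. a < t"
proof -
  assume "a \<in> I"
  then obtain n where n: "a < x n" using ex_x_greater by blast
  have mid: "(x n + x (Suc n)) / 2 \<in> {x n<..<x (Suc n)}"
    using x_less_iff[of n "Suc n"] by (simp del: x_less_iff)
  then have "(x n + x (Suc n)) / 2 \<in> I - X"
    using open_cell by blast
  moreover have "a < (x n + x (Suc n)) / 2"
    using n mid by (simp del: x_less_iff)
  ultimately show ?thesis by blast
qed

lemma continuous_on_I:
  assumes "\<And>t. t \<in> I \<Longrightarrow> continuous_on {0..t} f"
  shows "continuous_on I f"
  unfolding continuous_on_eq_continuous_within
proof
  fix s assume s: "s \<in> I"
  then obtain n where n: "s < x n" using ex_x_greater by blast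
  have "continuous (at s within {0..x n}) f"
    using assms[OF x_in_I[of n]] s n by (auto simp: continuous_on_eq_continuous_within I_iff)
  moreover have "at s within I = at s within {0..x n}"
  proof (rule at_within_nhd[of _ "{..<x n}"])
    show "I \<inter> {..<x n} - {s} = {0..x n} \<inter> {..<x n} - {s}"
      using I_sub[OF x_in_I[of n]] by (auto simp: I_iff)
  qed (use n in auto)
  ultimately show "continuous (at s within I) f" by simp
qed

lemma at_right_tendsto: "continuous_on I \<phi> \<Longrightarrow> t \<in> I \<Longrightarrow> (\<phi> \<longlongrightarrow> \<phi> t) (at_right t)"
proof -
  assume c: "continuous_on I \<phi>" and t: "t \<in> I"
  obtain n where n: "t < x n" using ex_x_greater[OF t] by blast
  have "{t<..<x n} \<subseteq> {0..x n}" using t by (auto simp: I_iff)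
  then have "{t<..<x n} \<subseteq> I" using I_sub[OF x_in_I[of n]] by blast
  then have "(\<phi> \<longlongrightarrow> \<phi> t) (at t within {t<..<x n})"
    using c t by (auto simp: continuous_on_def intro: tendsto_within_subset)
  moreover have "at_right t = at t within {t<..<x n}"
    by (rule at_within_nhd[of _ "{..<x n}"]) (use n in auto)
  ultimately show ?thesis by simp
qed

lemma at_left_tendsto: "continuous_on I \<phi> \<Longrightarrow> t \<in> I \<Longrightarrow> 0 < t \<Longrightarrow> (\<phi> \<longlongrightarrow> \<phi> t) (at_left t)"
proof -
  assume c: "continuous_on I \<phi>" and t: "t \<in> I" "0 < t"
  have "{0<..<t} \<subseteq> {0..t}" by auto
  then have "{0<..<t} \<subseteq> I" using I_sub[OF t(1)] by blast
  then have "(\<phi> \<longlongrightarrow> \<phi> t) (at t within {0<..<t})"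
    using c t(1) by (auto simp: continuous_on_def intro: tendsto_within_subset)
  moreover have "at_left t = at t within {0<..<t}"
    by (rule at_within_nhd[of _ "{0<..}"]) (use t in auto)
  ultimately show ?thesis by simp
qed

lemma integrable_M_iff: "integrable M F \<longleftrightarrow> F absolutely_integrable_on I"
  by (simp add: integrable_restrict_space set_integrable_def)

lemma integral_M: "integrable M F \<Longrightarrow> integral\<^sup>L M F = integral I F"
  for F :: "real \<Rightarrow> 'a::euclidean_space"
  by (rule lebesgue_integral_eq_integral) auto

lemma AE_M_iff: "(AE t in M. P t) \<longleftrightarrow> (AE t in lebesgue. t \<in> I \<longrightarrow> P t)"
  by (rule AE_restrict_space_iff) simp

subsection \<open>Locally integrable functions\<close>

text \<open>The space L^1_loc of \<open>[0,b)\<close>: the endpoint \<open>0\<close> is included and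
  only \<open>b\<close> may be singular, which is why intervals starting at \<open>0\<close>
  suffice.\<close>

definition loc :: "(real \<Rightarrow> 'a::euclidean_space) \<Rightarrow> bool" where
  "loc h \<longleftrightarrow> (\<forall>t\<in>I. h absolutely_integrable_on {0..t})"

lemma loc_abs: "loc h \<Longrightarrow> t \<in> I \<Longrightarrow> h absolutely_integrable_on {0..t}"
  by (simp add: loc_def)

lemma loc_integrable_on: "loc h \<Longrightarrow> t \<in> I \<Longrightarrow> h integrable_on {0..t}"
  by (rule set_lebesgue_integral_eq_integral, rule loc_abs)

lemma loc_sub: "loc h \<Longrightarrow> t \<in> I \<Longrightarrow> 0 \<le> s \<Longrightarrow> h absolutely_integrable_on {s..t}"
  by (rule absolutely_integrable_on_subinterval[OF loc_abs[of h t]]) auto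

lemma loc_integrable_sub: "loc h \<Longrightarrow> t \<in> I \<Longrightarrow> 0 \<le> s \<Longrightarrow> h integrable_on {s..t}"
  by (rule set_lebesgue_integral_eq_integral, rule loc_sub)

lemma loc_split: "loc h \<Longrightarrow> t \<in> I \<Longrightarrow> 0 \<le> s \<Longrightarrow> s \<le> t \<Longrightarrow>
    integral {0..t} h = integral {0..s} h + integral {s..t} h"
  by (rule Henstock_Kurzweil_Integration.integral_combine[symmetric]) (auto intro: loc_integrable_on)

lemma loc_continuous: "loc h \<Longrightarrow> continuous_on I (\<lambda>t. integral {0..t} h)"
  by (intro continuous_on_I indefinite_integral_continuous_1 loc_integrable_on)

lemma loc_integrable: "integrable M F \<Longrightarrow> loc F"
  unfolding loc_def integrable_M_iff using I_sub set_integrable_subset[of lebesgue I F] by auto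

lemma loc_L2: "h \<in> L2 M \<Longrightarrow> loc h"
  unfolding loc_def
proof
  fix t assume h: "h \<in> L2 M" and t: "t \<in> I"
  have "(\<lambda>s. (cmod (h s))\<^sup>2) integrable_on {0..t}"
    using loc_integrable_on[OF loc_integrable[OF L2_integrable_sq[OF h]] t] .
  then have "(\<lambda>s. 1 + (cmod (h s))\<^sup>2) integrable_on {0..t}"
    by (intro integrable_add integrable_const_ivl)
  moreover have "h \<in> borel_measurable (lebesgue_on {0..t})"
    using L2_measurable[OF h] I_sub[OF t] by (rule measurable_restrict_mono)
  moreover have "cmod (h s) \<le> 1 + (cmod (h s))\<^sup>2" for s
    using sum_squares_bound[of 1 "cmod (h s)"] by (simp add: power2_eq_square) (smt (verit) norm_ge_zero)
  ultimately show "h absolutely_integrable_on {0..t}"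
    by (intro measurable_bounded_by_integrable_imp_absolutely_integrable) auto
qed

lemma loc_mult_continuous:
  fixes h g :: "real \<Rightarrow> complex"
  shows "loc h \<Longrightarrow> continuous_on I g \<Longrightarrow> loc (\<lambda>s. h s * g s)"
  unfolding loc_def
  by (intro ballI absolutely_integrable_mult_continuous) (auto intro: continuous_on_subset dest: I_sub)

lemma loc_add: "loc h \<Longrightarrow> loc k \<Longrightarrow> loc (\<lambda>s. h s + k s)"
  and loc_diff: "loc h \<Longrightarrow> loc k \<Longrightarrow> loc (\<lambda>s. h s - k s)"
  unfolding loc_def by (auto intro: set_integral_add set_integral_diff)

lemma loc_cmult: "loc h \<Longrightarrow> loc (\<lambda>s. c * h s)" for c :: complex
  unfolding loc_def by (auto intro: set_integrable_mult_right)

lemma loc_norm: "loc h \<Longrightarrow> loc (\<lambda>s. norm (h s))"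
  unfolding loc_def using set_integrable_norm by blast

text \<open>Dominated convergence for the cut-offs at \<open>x n\<close>, which exhaust
  \<open>I\<close>.\<close>

lemma truncated_integral_tendsto_real:
  fixes F :: "real \<Rightarrow> real"
  assumes F: "integrable M F" and F0: "\<And>t. t \<in> I \<Longrightarrow> 0 \<le> F t" and e: "e > 0"
  shows "\<exists>a\<in>I. integral I F - e < integral {0..a} F"
proof -
  have [measurable]: "(\<lambda>t. indicator {..x n} t :: real) \<in> borel_measurable M" for n
    by (intro measurable_restrict_space1 measurable_completion) simp
  have [measurable]: "F \<in> borel_measurable M" using F by auto
  have lim: "(\<lambda>n. LINT t|M. indicator {..x n} t *\<^sub>R F t) \<longlonglongrightarrow> (LINT t|M. F t)"
  proof (rule integral_dominated_convergence[where w="\<lambda>t. \<bar>F t\<bar>"])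
    show "AE t in M. (\<lambda>n. indicator {..x n} t *\<^sub>R F t) \<longlonglongrightarrow> F t"
    proof (rule AE_I2)
      fix t assume "t \<in> space M"
      then have "t \<in> I" by simp
      then obtain n where n: "t < x n" using ex_x_greater by blast
      have "\<forall>\<^sub>F m in sequentially. F t = indicator {..x m} t *\<^sub>R F t"
        using eventually_ge_at_top[of n]
      proof eventually_elim
        case (elim m)
        then have "x n \<le> x m" by simp
        then have "t \<le> x m" using n by linarith
        then show ?case by simp
      qed
      then show "(\<lambda>n. indicator {..x n} t *\<^sub>R F t) \<longlonglongrightarrow> F t"
        by (rule Lim_transform_eventually[OF tendsto_const])
    qed
    show "(\<lambda>t. indicator {..x n} t *\<^sub>R F t) \<in> borel_measurable M" for n
      by measurable
  qed (use F in \<open>auto simp: indicator_def\<close>)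
  have eq: "(LINT t|M. indicator {..x n} t *\<^sub>R F t) = integral {0..x n} F" for n
  proof -
    have "(LINT t|M. indicator {..x n} t *\<^sub>R F t) = set_lebesgue_integral lebesgue {0..x n} F"
      unfolding set_lebesgue_integral_def
      using I_sub[OF x_in_I[of n]]
      by (subst integral_restrict_space) (auto intro!: Bochner_Integration.integral_cong simp: indicator_def I_iff)
    also have "\<dots> = integral {0..x n} F"
      using loc_abs[OF loc_integrable[OF F] x_in_I] by (rule set_lebesgue_integral_eq_integral)
    finally show ?thesis .
  qed
  have "\<forall>\<^sub>F n in sequentially. integral I F - e < integral {0..x n} F"
    using order_tendstoD(1)[OF lim[unfolded eq integral_M[OF F]], of "integral I F - e"] e by simp
  then obtain n where "integral I F - e < integral {0..x n} F"
    using eventually_happens by fastforce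
  then show ?thesis using x_in_I by blast
qed

text \<open>The error at \<open>t\<close> is bounded by the integral of the norm over
  \<open>I - {0..t}\<close>, which decreases in \<open>t\<close>; this gives the estimate for all
  \<open>t \<ge> a\<close> at once.\<close>

lemma truncated_integral_tendsto:
  fixes F :: "real \<Rightarrow> complex"
  assumes F: "integrable M F" and e: "e > 0"
  shows "\<exists>a\<in>I. \<forall>t\<in>I. a \<le> t \<longrightarrow> norm (integral {0..t} F - integral\<^sup>L M F) < e"
proof -
  have nF: "integrable M (\<lambda>t. norm (F t))" using F by simp
  obtain a where a: "a \<in> I" "integral I (\<lambda>t. norm (F t)) - e < integral {0..a} (\<lambda>t. norm (F t))"
    using truncated_integral_tendsto_real[OF nF _ e] by auto
  have "norm (integral {0..t} F - integral\<^sup>L M F) < e" if t: "t \<in> I" "a \<le> t" for t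
  proof -
    have I1: "F absolutely_integrable_on I" using F by (simp add: integrable_M_iff)
    have sets: "I - {0..t} \<in> sets lebesgue" by auto
    have I2: "F absolutely_integrable_on (I - {0..t})"
      by (rule set_integrable_subset[OF I1 sets]) auto
    have diff: "integral (I - {0..t}) G = integral I G - integral {0..t} G"
      if "G absolutely_integrable_on I" for G :: "real \<Rightarrow> 'b::euclidean_space"
      using that I_sub[OF t(1)] set_integrable_subset[OF that, of "{0..t}"]
      by (intro integral_setdiff) (auto intro: set_lebesgue_integral_eq_integral)
    have "norm (integral {0..t} F - integral\<^sup>L M F) = norm (integral (I - {0..t}) F)"
      using diff[OF I1] by (simp add: integral_M[OF F] norm_minus_commute)
    also have "\<dots> \<le> integral (I - {0..t}) (\<lambda>t. norm (F t))"
      using I2 by (intro integral_norm_bound_integral) (auto simp: absolutely_integrable_on_def)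
    also have "\<dots> = integral I (\<lambda>t. norm (F t)) - integral {0..t} (\<lambda>t. norm (F t))"
      using nF by (intro diff) (simp add: integrable_M_iff)
    also have "\<dots> \<le> integral I (\<lambda>t. norm (F t)) - integral {0..a} (\<lambda>t. norm (F t))"
      using t a(1) by (intro diff_left_mono integral_subset_le)
        (auto intro: loc_integrable_on[OF loc_integrable[OF nF]] simp: I_iff)
    also have "\<dots> < e" using a(2) by simp
    finally show ?thesis .
  qed
  then show ?thesis using a(1) by blast
qed

subsection \<open>The homogeneous solution with derivative one\<close>

text \<open>Meaningless for \<open>t \<ge> b\<close>, where the index set is infinite and the sum is \<open>0\<close>.\<close>

definition v :: "real \<Rightarrow> real" where
  "v t = t + (\<Sum>i\<in>{i. 1 \<le> i \<and> x i \<le> t}. \<beta> i)"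

lemma v_cell: "x n \<le> t \<Longrightarrow> t < x (Suc n) \<Longrightarrow> v t = t + (\<Sum>i=1..n. \<beta> i)"
proof -
  assume t: "x n \<le> t" "t < x (Suc n)"
  have "{i. 1 \<le> i \<and> x i \<le> t} = {1..n}"
  proof (intro equalityI subsetI)
    fix i assume "i \<in> {i. 1 \<le> i \<and> x i \<le> t}"
    then have "x i \<le> t" "1 \<le> i" by auto
    with t have "x i < x (Suc n)" by linarith
    with \<open>1 \<le> i\<close> show "i \<in> {1..n}" by auto
  next
    fix i assume "i \<in> {1..n}"
    then have "x i \<le> x n" "1 \<le> i" by auto
    with t(1) have "x i \<le> t" by linarith
    with \<open>1 \<le> i\<close> show "i \<in> {i. 1 \<le> i \<and> x i \<le> t}" by auto
  qed
  then show ?thesis by (simp add: v_def)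
qed

lemma finite_jumps: "t \<in> I \<Longrightarrow> finite {i. 1 \<le> i \<and> x i \<le> t}"
proof -
  assume "t \<in> I"
  then obtain n where n: "t < x n" using ex_x_greater by blast
  have "{i. 1 \<le> i \<and> x i \<le> t} \<subseteq> {..n}"
  proof clarify
    fix i assume "x i \<le> t"
    then have "x i < x n" using n by linarith
    then show "i \<le> n" by simp
  qed
  then show ?thesis using finite_subset by blast
qed

lemma v_bounded:
  assumes t: "t \<in> I"
  obtains C where "C \<ge> 0" "\<And>s. s \<in> {0..t} \<Longrightarrow> \<bar>v s\<bar> \<le> C"
proof -
  let ?C = "t + (\<Sum>i\<in>{i. 1 \<le> i \<and> x i \<le> t}. \<bar>\<beta> i\<bar>)"
  have "\<bar>v s\<bar> \<le> ?C" if s: "s \<in> {0..t}" for s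
  proof -
    have "\<bar>\<Sum>i\<in>{i. 1 \<le> i \<and> x i \<le> s}. \<beta> i\<bar> \<le> (\<Sum>i\<in>{i. 1 \<le> i \<and> x i \<le> s}. \<bar>\<beta> i\<bar>)"
      by (rule sum_abs)
    also have "\<dots> \<le> (\<Sum>i\<in>{i. 1 \<le> i \<and> x i \<le> t}. \<bar>\<beta> i\<bar>)"
      using s by (intro sum_mono2 finite_jumps[OF t]) auto
    finally show ?thesis using s by (auto simp: v_def)
  qed
  moreover have "?C \<ge> 0" using t by (auto simp: I_iff intro!: add_nonneg_nonneg sum_nonneg)
  ultimately show ?thesis by (rule that[rotated])
qed

text \<open>At each point of \<open>I\<close> the function \<open>v\<close> agrees with all
  sufficiently long finite sums of multiples of indicators, and these are Borel functions.\<close>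

lemma v_measurable [measurable]: "v \<in> borel_measurable M"
proof (rule borel_measurable_LIMSEQ_real)
  fix t assume "t \<in> space M"
  then have t: "t \<in> I" by simp
  obtain n where n: "x n \<le> t" "t < x (Suc n)" using cell[OF t] .
  have "\<forall>\<^sub>F N in sequentially. v t = t + (\<Sum>i=1..N. \<beta> i * indicator {x i..} t)"
    using eventually_ge_at_top[of n]
  proof eventually_elim
    case (elim N)
    have "(\<Sum>i=1..N. \<beta> i * indicator {x i..} t) = (\<Sum>i=1..n. \<beta> i)"
    proof (rule sum.mono_neutral_cong_right)
      show "\<forall>i\<in>{1..N} - {1..n}. \<beta> i * indicator {x i..} t = 0"
      proof
        fix i assume "i \<in> {1..N} - {1..n}"
        then have "x (Suc n) \<le> x i" by auto
        then have "t < x i" using n by linarith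
        then show "\<beta> i * indicator {x i..} t = 0" by simp
      qed
      show "\<beta> i * indicator {x i..} t = \<beta> i" if "i \<in> {1..n}" for i
      proof -
        have "x i \<le> x n" using that by simp
        then have "x i \<le> t" using n by linarith
        then show ?thesis by simp
      qed
    qed (use elim in auto)
    then show ?case using v_cell[OF n] by simp
  qed
  then show "(\<lambda>N. t + (\<Sum>i=1..N. \<beta> i * indicator {x i..} t)) \<longlonglongrightarrow> v t"
    by (rule Lim_transform_eventually[OF tendsto_const])
next
  fix N
  have "(\<lambda>t. t + (\<Sum>i=1..N. \<beta> i * indicator {x i..} t)) \<in> borel_measurable borel"
    by measurable
  then show "(\<lambda>t. t + (\<Sum>i=1..N. \<beta> i * indicator {x i..} t)) \<in> borel_measurable M"
    by (intro measurable_restrict_space1 measurable_completion) simp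
qed

lemma loc_v: "loc h \<Longrightarrow> loc (\<lambda>s. of_real (v s) * h s)" for h :: "real \<Rightarrow> complex"
  unfolding loc_def
proof
  fix t assume h: "\<forall>t\<in>I. h absolutely_integrable_on {0..t}" and t: "t \<in> I"
  show "(\<lambda>s. of_real (v s) * h s) absolutely_integrable_on {0..t}"
  proof (rule absolutely_integrable_bounded_measurable_product[OF bilinear_times])
    show "(\<lambda>s. complex_of_real (v s)) \<in> borel_measurable (lebesgue_on {0..t})"
      using measurable_restrict_mono[OF v_measurable I_sub[OF t]] by measurable
    obtain C where "\<And>s. s \<in> {0..t} \<Longrightarrow> \<bar>v s\<bar> \<le> C" using v_bounded[OF t] by metis
    then show "bounded ((\<lambda>s. complex_of_real (v s)) ` {0..t})"
      by (auto simp: bounded_iff intro!: exI[of _ C])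
  qed (use h t in auto)
qed

subsection \<open>Variation of constants\<close>

definition der :: "(real \<Rightarrow> complex) \<Rightarrow> real \<Rightarrow> complex" where
  "der h t = - integral {0..t} h"

text \<open>The combination \<open>u - v * u'\<close>. At \<open>x n\<close> the jump of
  \<open>u\<close> is \<open>\<beta> n * u'\<close>, exactly that of \<open>v * u'\<close>, so the
  difference is continuous; formally its derivative is \<open>- v * u'' = v * h\<close>.\<close>

definition amp :: "complex \<Rightarrow> (real \<Rightarrow> complex) \<Rightarrow> real \<Rightarrow> complex" where
  "amp c h t = c + integral {0..t} (\<lambda>s. of_real (v s) * h s)"

text \<open>The solution of \<open>- u'' = h\<close> with \<open>u(0) = c\<close>, \<open>u'(0) = 0\<close> and the interface conditions, written
  as \<open>amp \<cdot> 1 + der \<cdot> v\<close>; its derivative is \<open>der h\<close>.\<close>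

definition sol :: "complex \<Rightarrow> (real \<Rightarrow> complex) \<Rightarrow> real \<Rightarrow> complex" where
  "sol c h t = amp c h t + of_real (v t) * der h t"

lemma der_continuous: "loc h \<Longrightarrow> continuous_on I (der h)"
  unfolding der_def[abs_def] by (intro continuous_intros loc_continuous)

lemma amp_continuous: "loc h \<Longrightarrow> continuous_on I (amp c h)"
  unfolding amp_def[abs_def] by (intro continuous_intros loc_continuous loc_v)

lemma der_0 [simp]: "der h 0 = 0"
  and amp_0 [simp]: "amp c h 0 = c"
  by (simp_all add: der_def amp_def)

lemma continuous_M_measurable: "continuous_on I f \<Longrightarrow> f \<in> borel_measurable M"
  for f :: "real \<Rightarrow> complex"
  by (rule continuous_imp_measurable_on_sets_lebesgue) auto

lemma sol_measurable: "loc h \<Longrightarrow> sol c h \<in> borel_measurable M"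
proof -
  assume "loc h"
  note [measurable] = continuous_M_measurable[OF der_continuous[OF this]]
    continuous_M_measurable[OF amp_continuous[OF this, of c]]
  show ?thesis unfolding sol_def[abs_def] by measurable
qed

lemma sol_cmult: "loc h \<Longrightarrow> t \<in> I \<Longrightarrow> sol (z * c) (\<lambda>s. z * h s) t = z * sol c h t"
proof -
  assume h: "loc h" and t: "t \<in> I"
  have "integral {0..t} (\<lambda>s. of_real (v s) * (z * h s)) = z * integral {0..t} (\<lambda>s. of_real (v s) * h s)"
    by (subst Henstock_Kurzweil_Integration.integral_mult_right[symmetric]) (simp add: mult.left_commute)
  then show ?thesis
    by (simp add: sol_def amp_def der_def algebra_simps)
qed

lemma sol_diff: "loc h \<Longrightarrow> loc k \<Longrightarrow> t \<in> I \<Longrightarrow>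
    sol (c - d) (\<lambda>s. h s - k s) t = sol c h t - sol d k t"
proof -
  assume h: "loc h" and k: "loc k" and t: "t \<in> I"
  have eq1: "integral {0..t} (\<lambda>s. of_real (v s) * (h s - k s)) =
      integral {0..t} (\<lambda>s. of_real (v s) * h s) - integral {0..t} (\<lambda>s. of_real (v s) * k s)"
    using loc_integrable_on[OF loc_v[OF h] t] loc_integrable_on[OF loc_v[OF k] t]
    by (simp add: right_diff_distrib Henstock_Kurzweil_Integration.integral_diff)
  have eq2: "integral {0..t} (\<lambda>s. h s - k s) = integral {0..t} h - integral {0..t} k"
    using loc_integrable_on[OF h t] loc_integrable_on[OF k t]
    by (rule Henstock_Kurzweil_Integration.integral_diff)
  show ?thesis
    unfolding sol_def amp_def der_def eq1 eq2 by (simp add: algebra_simps)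
qed

lemma amp_cnj: "amp (cnj c) (\<lambda>s. cnj (h s)) t = cnj (amp c h t)"
  unfolding amp_def complex_cnj_add Henstock_Kurzweil_Integration.integral_cnj
    complex_cnj_mult complex_cnj_complex_of_real ..

lemma der_cnj: "der (\<lambda>s. cnj (h s)) t = cnj (der h t)"
  unfolding der_def complex_cnj_minus Henstock_Kurzweil_Integration.integral_cnj ..

lemma sol_cnj: "sol (cnj c) (\<lambda>s. cnj (h s)) t = cnj (sol c h t)"
  by (simp add: sol_def amp_cnj der_cnj)

lemma sol_const: "sol (c + d) h t = c + sol d h t"
  by (simp add: sol_def amp_def)

lemma integral_AE_cong_I:
  fixes f g :: "real \<Rightarrow> 'a::euclidean_space"
  assumes "AE t in M. f t = g t" and t: "t \<in> I"
  shows "integral {0..t} f = integral {0..t} g"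
proof -
  obtain N where N: "N \<in> null_sets lebesgue" "{s \<in> space lebesgue. \<not> (s \<in> I \<longrightarrow> f s = g s)} \<subseteq> N"
    using assms(1)[unfolded AE_M_iff, unfolded eventually_ae_filter] by blast
  have "g s = f s" if "s \<in> {0..t} - N" for s
  proof -
    have "s \<in> I" using that I_sub[OF t] by blast
    then show ?thesis using that N(2) by auto
  qed
  then show ?thesis
    using N(1) by (intro integral_spike[of N]) (auto simp: negligible_iff_null_sets)
qed

text \<open>The interface conditions do not contribute to the Wronskian, because it only involves the
  amplitudes and derivatives, which are continuous.\<close>

lemma Lagrange_identity:
  assumes h: "loc h" and k: "loc k" and t: "t \<in> I"
  shows "loc (\<lambda>s. h s * sol d k s - k s * sol c h s)"
    and "amp c h t * der k t - der h t * amp d k t =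
      integral {0..t} (\<lambda>s. h s * sol d k s - k s * sol c h s)"
proof -
  define vh vk where "vh s = of_real (v s) * h s" and "vk s = of_real (v s) * k s" for s
  have vh: "loc vh" and vk: "loc vk"
    unfolding vh_def[abs_def] vk_def[abs_def] by (intro loc_v h k)+
  \<comment> \<open>The integrand with \<open>sol\<close> written out. Apart from two constant
    multiples, each term is a density times an indefinite integral; they group into the pairs
    \<open>h, vk\<close> and \<open>vh, k\<close>, to which \<open>integral_mult_indefinite\<close>
    applies.\<close>
  define f where "f s = d * h s + h s * integral {0..s} vk - vh s * integral {0..s} k
    - c * k s - k s * integral {0..s} vh + vk s * integral {0..s} h" for s
  have amp: "amp c h s = c + integral {0..s} vh" "amp d k s = d + integral {0..s} vk" for s
    by (simp_all add: amp_def vh_def[abs_def] vk_def[abs_def])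
  have f: "(\<lambda>s. h s * sol d k s - k s * sol c h s) = f"
    by (rule ext) (simp add: f_def sol_def amp der_def vh_def vk_def algebra_simps)
  show "loc (\<lambda>s. h s * sol d k s - k s * sol c h s)"
    unfolding f unfolding f_def[abs_def]
    by (intro loc_add loc_diff loc_cmult loc_mult_continuous loc_continuous h k vh vk)
  have t0: "0 \<le> t" using t by (simp add: I_iff)
  note H = loc_abs[OF h t] and K = loc_abs[OF k t] and VH = loc_abs[OF vh t] and VK = loc_abs[OF vk t]
  note ii = set_lebesgue_integral_eq_integral(1)
  note int = ii[OF H] ii[OF K] ii[OF integral_mult_indefinite(1)[OF t0 H VK]]
    ii[OF integral_mult_indefinite(2)[OF t0 H VK]] ii[OF integral_mult_indefinite(1)[OF t0 VH K]]
    ii[OF integral_mult_indefinite(2)[OF t0 VH K]]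
  have "integral {0..t} f = d * integral {0..t} h + integral {0..t} (\<lambda>s. h s * integral {0..s} vk)
    - integral {0..t} (\<lambda>s. vh s * integral {0..s} k) - c * integral {0..t} k
    - integral {0..t} (\<lambda>s. k s * integral {0..s} vh) + integral {0..t} (\<lambda>s. vk s * integral {0..s} h)"
    unfolding f_def[abs_def] using int
    by (simp add: Henstock_Kurzweil_Integration.integral_add Henstock_Kurzweil_Integration.integral_diff
        integrable_add integrable_diff integrable_on_mult_right)
  also have "\<dots> = d * integral {0..t} h - c * integral {0..t} k
      + integral {0..t} h * integral {0..t} vk - integral {0..t} vh * integral {0..t} k"
    unfolding integral_mult_indefinite(3)[OF t0 H VK] integral_mult_indefinite(3)[OF t0 VH K]
    by (simp add: algebra_simps)
  also have "\<dots> = amp c h t * der k t - der h t * amp d k t"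
    by (simp add: amp der_def algebra_simps)
  finally show "amp c h t * der k t - der h t * amp d k t =
      integral {0..t} (\<lambda>s. h s * sol d k s - k s * sol c h s)"
    by (simp add: f)
qed

end

lemma lipschitz_abs_cont_on:
  assumes "\<And>s t. c \<le> s \<Longrightarrow> s \<le> t \<Longrightarrow> t \<le> d \<Longrightarrow> cmod (f t - f s) \<le> L * (t - s)"
  shows "abs_cont_on c d f"
  unfolding abs_cont_on_def
proof (intro allI impI)
  fix e :: real assume e: "e > 0"
  define K where "K = \<bar>L\<bar> + 1"
  have K: "K > 0" "L \<le> K" by (auto simp: K_def)
  show "\<exists>\<delta>>0. \<forall>(n::nat) u v. (\<forall>i<n. c \<le> u i \<and> u i \<le> v i \<and> v i \<le> d) \<longrightarrow>
      disjoint_family_on (\<lambda>i. {u i<..<v i}) {..<n} \<longrightarrow> (\<Sum>i<n. v i - u i) < \<delta> \<longrightarrow>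
      (\<Sum>i<n. cmod (f (v i) - f (u i))) < e"
  proof (intro exI[of _ "e / K"] conjI allI impI)
    show "e / K > 0" using e K by simp
    fix n :: nat and u v :: "nat \<Rightarrow> real"
    assume uv: "\<forall>i<n. c \<le> u i \<and> u i \<le> v i \<and> v i \<le> d" and small: "(\<Sum>i<n. v i - u i) < e / K"
    have "(\<Sum>i<n. cmod (f (v i) - f (u i))) \<le> (\<Sum>i<n. K * (v i - u i))"
    proof (rule sum_mono)
      fix i assume "i \<in> {..<n}"
      then have i: "c \<le> u i" "u i \<le> v i" "v i \<le> d" using uv by auto
      have "cmod (f (v i) - f (u i)) \<le> L * (v i - u i)" using i by (rule assms)
      also have "\<dots> \<le> K * (v i - u i)" using K i by (intro mult_right_mono) auto
      finally show "cmod (f (v i) - f (u i)) \<le> K * (v i - u i)" .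
    qed
    also have "\<dots> = K * (\<Sum>i<n. v i - u i)" by (simp add: sum_distrib_left)
    also have "\<dots> < K * (e / K)" using K small by (intro mult_strict_left_mono) auto
    also have "\<dots> = e" using K by simp
    finally show "(\<Sum>i<n. cmod (f (v i) - f (u i))) < e" .
  qed
qed

section \<open>Differentiability of solutions on the cells and one-sided limits at the
  centres\<close>

context interface_problem
begin

text \<open>Inside a cell \<open>v\<close> has slope one, so the quantity on the left is the Taylor
  remainder, minus the integral of \<open>(t - r) * h r\<close> over \<open>{s..t}\<close>. The
  bound uses increments of the integral of \<open>norm (h r)\<close> from \<open>0\<close>, whose
  continuity makes it o(t - s).\<close>

lemma sol_increment:
  assumes h: "loc h" and s: "x n \<le> s" and st: "s \<le> t" and t: "t < x (Suc n)"
  shows "norm (sol c h t - sol c h s - of_real (t - s) * der h s)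
    \<le> (t - s) * (integral {0..t} (\<lambda>r. norm (h r)) - integral {0..s} (\<lambda>r. norm (h r)))"
proof -
  define B where "B = (\<Sum>i=1..n. \<beta> i)"
  have vr: "v r = r + B" if "r \<in> {s..t}" for r
    unfolding B_def using that s t by (intro v_cell) auto
  have s0: "0 \<le> s" using s x_nonneg[of n] by linarith
  have tI: "t \<in> I" using cell_in_I[of n t "Suc n"] s st t by auto
  define vh where "vh r = of_real (v r) * h r" for r
  have vh: "loc vh" unfolding vh_def[abs_def] by (rule loc_v[OF h])
  have ih: "h integrable_on {s..t}" and ivh: "vh integrable_on {s..t}"
    using loc_integrable_sub[OF h tI s0] loc_integrable_sub[OF vh tI s0] by auto
  have amp: "amp c h t = amp c h s + integral {s..t} vh"
    using loc_split[OF vh tI s0 st] by (simp add: amp_def vh_def[abs_def])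
  have der: "der h t = der h s - integral {s..t} h"
    using loc_split[OF h tI s0 st] by (simp add: der_def)
  have iw: "(\<lambda>r. of_real (t + B) * h r - vh r) integrable_on {s..t}"
    by (intro integrable_diff integrable_on_mult_right ih ivh)
  have "integral {s..t} (\<lambda>r. of_real (t + B) * h r - vh r) = of_real (t + B) * integral {s..t} h - integral {s..t} vh"
    using ih ivh by (simp add: Henstock_Kurzweil_Integration.integral_diff integrable_on_mult_right)
  then have "sol c h t - sol c h s - of_real (t - s) * der h s = - integral {s..t} (\<lambda>r. of_real (t + B) * h r - vh r)"
    using vr[of t] vr[of s] st by (simp add: sol_def amp der algebra_simps)
  then have "norm (sol c h t - sol c h s - of_real (t - s) * der h s)
      = norm (integral {s..t} (\<lambda>r. of_real (t + B) * h r - vh r))"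
    by simp
  also have "\<dots> \<le> integral {s..t} (\<lambda>r. (t - s) * norm (h r))"
  proof (rule integral_norm_bound_integral[OF iw])
    show "(\<lambda>r. (t - s) * norm (h r)) integrable_on {s..t}"
      by (intro integrable_on_mult_right loc_integrable_sub[OF loc_norm[OF h] tI s0])
    fix r assume r: "r \<in> {s..t}"
    have "of_real (t + B) * h r - vh r = of_real (t - r) * h r"
      using vr[OF r] by (simp add: vh_def algebra_simps)
    then show "norm (of_real (t + B) * h r - vh r) \<le> (t - s) * norm (h r)"
      using r by (simp add: norm_mult del: of_real_diff) (intro mult_right_mono; simp)
  qed
  also have "\<dots> = (t - s) * (integral {0..t} (\<lambda>r. norm (h r)) - integral {0..s} (\<lambda>r. norm (h r)))"
    using loc_split[OF loc_norm[OF h] tI s0 st] by simp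
  finally show ?thesis .
qed

lemma der_increment:
  assumes h: "loc h" and t: "t \<in> I" and s: "0 \<le> s" "s \<le> t"
  shows "norm (der h t - der h s) \<le> integral {0..t} (\<lambda>r. norm (h r)) - integral {0..s} (\<lambda>r. norm (h r))"
proof -
  have "norm (der h t - der h s) = norm (integral {s..t} h)"
    using loc_split[OF h t s] by (simp add: der_def)
  also have "\<dots> \<le> integral {s..t} (\<lambda>r. norm (h r))"
    using loc_integrable_sub[OF h t s(1)] loc_integrable_sub[OF loc_norm[OF h] t s(1)]
    by (intro integral_norm_bound_integral) auto
  also have "\<dots> = integral {0..t} (\<lambda>r. norm (h r)) - integral {0..s} (\<lambda>r. norm (h r))"
    using loc_split[OF loc_norm[OF h] t s] by simp
  finally show ?thesis .
qed

text \<open>The two-sided form. For \<open>t < s\<close> the remainder is expanded at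
  \<open>t\<close>; moving the base point to \<open>s\<close> costs \<open>s - t\<close> times the
  increment of \<open>der h\<close>, a term of the same size, hence the factor 2.\<close>

lemma sol_estimate:
  assumes h: "loc h" and s: "x n \<le> s" "s < x (Suc n)" and t: "x n \<le> t" "t < x (Suc n)"
  shows "norm (sol c h t - sol c h s - of_real (t - s) * der h s)
    \<le> 2 * \<bar>t - s\<bar> * \<bar>integral {0..t} (\<lambda>r. norm (h r)) - integral {0..s} (\<lambda>r. norm (h r))\<bar>"
proof -
  define N where "N t = integral {0..t} (\<lambda>r. norm (h r))" for t
  have "norm (sol c h t - sol c h s - of_real (t - s) * der h s) \<le> 2 * \<bar>t - s\<bar> * \<bar>N t - N s\<bar>"
  proof (cases "s \<le> t")
    case True
    have "norm (sol c h t - sol c h s - of_real (t - s) * der h s) \<le> (t - s) * (N t - N s)"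
      unfolding N_def using sol_increment[OF h s(1) True t(2)] .
    also have "\<dots> \<le> \<bar>t - s\<bar> * \<bar>N t - N s\<bar>"
      by (metis abs_ge_self abs_mult)
    finally have "norm (sol c h t - sol c h s - of_real (t - s) * der h s) \<le> \<bar>t - s\<bar> * \<bar>N t - N s\<bar>" .
    moreover have "0 \<le> \<bar>t - s\<bar> * \<bar>N t - N s\<bar>" by simp
    ultimately show ?thesis unfolding mult.assoc by linarith
  next
    case False
    then have ts: "t \<le> s" by simp
    have sI: "s \<in> I" using cell_in_I[of n s "Suc n"] s by auto
    have t0: "0 \<le> t" using t x_nonneg[of n] by linarith
    have 1: "norm (sol c h s - sol c h t - of_real (s - t) * der h t) \<le> (s - t) * (N s - N t)"
      unfolding N_def using sol_increment[OF h t(1) ts s(2)] .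
    have 2: "norm (der h s - der h t) \<le> N s - N t"
      unfolding N_def by (rule der_increment[OF h sI t0 ts])
    have "sol c h t - sol c h s - of_real (t - s) * der h s =
        - (sol c h s - sol c h t - of_real (s - t) * der h t) + of_real (s - t) * (der h s - der h t)"
      by (simp add: algebra_simps)
    also have "norm \<dots> \<le> (s - t) * (N s - N t) + (s - t) * (N s - N t)"
    proof (rule norm_triangle_mono)
      show "norm (- (sol c h s - sol c h t - of_real (s - t) * der h t)) \<le> (s - t) * (N s - N t)"
        using 1 by (simp only: norm_minus_cancel)
      show "norm (complex_of_real (s - t) * (der h s - der h t)) \<le> (s - t) * (N s - N t)"
        unfolding norm_mult norm_of_real using ts 2 by (intro mult_mono) auto
    qed
    also have "\<dots> = 2 * \<bar>t - s\<bar> * (N s - N t)" using ts by (simp add: algebra_simps)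
    also have "\<dots> \<le> 2 * \<bar>t - s\<bar> * \<bar>N t - N s\<bar>"
      by (intro mult_left_mono) auto
    finally show ?thesis .
  qed
  then show ?thesis by (simp add: N_def)
qed

text \<open>The cell is closed on the left, so the right derivative at \<open>x n\<close> is
  included; at \<open>0\<close> this is the derivative that \<open>W22\<close> asks for.\<close>

lemma sol_has_derivative_within:
  assumes h: "loc h" and s: "x n \<le> s" "s < x (Suc n)"
  shows "(sol c h has_vector_derivative der h s) (at s within {x n..<x (Suc n)})"
  unfolding has_vector_derivative_def has_derivative_within_alt
proof (intro conjI allI impI)
  show "bounded_linear (\<lambda>r. r *\<^sub>R der h s)" by (rule bounded_linear_scaleR_left)
  fix e :: real assume e: "e > 0"
  define N where "N t = integral {0..t} (\<lambda>r. norm (h r))" for t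
  have sI: "s \<in> I" using cell_in_I[of n s "Suc n"] s by auto
  have "continuous_on I N"
    unfolding N_def[abs_def] by (rule loc_continuous[OF loc_norm[OF h]])
  then obtain d where d: "d > 0" "\<And>t. t \<in> I \<Longrightarrow> dist t s < d \<Longrightarrow> dist (N t) (N s) < e / 2"
    using sI e unfolding continuous_on_iff by (metis half_gt_zero)
  show "\<exists>d>0. \<forall>y\<in>{x n..<x (Suc n)}. norm (y - s) < d \<longrightarrow>
      norm (sol c h y - sol c h s - (y - s) *\<^sub>R der h s) \<le> e * norm (y - s)"
  proof (intro exI[of _ d] conjI ballI impI)
    fix y assume y: "y \<in> {x n..<x (Suc n)}" "norm (y - s) < d"
    then have "y \<in> I" using cell_in_I[of n y "Suc n"] by auto
    then have N: "\<bar>N y - N s\<bar> \<le> e / 2" using d(2)[of y] y by (simp add: dist_real_def)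
    have "norm (sol c h y - sol c h s - of_real (y - s) * der h s) \<le> 2 * \<bar>y - s\<bar> * \<bar>N y - N s\<bar>"
      unfolding N_def using y by (intro sol_estimate[OF h s]) auto
    also have "\<dots> \<le> 2 * \<bar>y - s\<bar> * (e / 2)"
      using N by (intro mult_left_mono) auto
    finally show "norm (sol c h y - sol c h s - (y - s) *\<^sub>R der h s) \<le> e * norm (y - s)"
      by (simp add: scaleR_conv_of_real mult.commute)
  qed (rule d(1))
qed

lemma sol_has_derivative_at:
  assumes h: "loc h" and s: "x n < s" "s < x (Suc n)"
  shows "(sol c h has_vector_derivative der h s) (at s)"
proof -
  have "(sol c h has_vector_derivative der h s) (at s within {x n<..<x (Suc n)})"
    by (rule has_vector_derivative_within_subset[OF sol_has_derivative_within[OF h less_imp_le[OF s(1)] s(2)]]) auto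
  moreover have "at s within {x n<..<x (Suc n)} = at s"
    by (rule at_within_open) (use s in auto)
  ultimately show ?thesis by simp
qed

lemma eventually_at_right_cell: "(\<And>t. x n < t \<Longrightarrow> t < x (Suc n) \<Longrightarrow> P t) \<Longrightarrow> eventually P (at_right (x n))"
  unfolding eventually_at_right_field by (intro exI[of _ "x (Suc n)"]) auto

lemma eventually_at_left_cell: "(\<And>t. x n < t \<Longrightarrow> t < x (Suc n) \<Longrightarrow> P t) \<Longrightarrow> eventually P (at_left (x (Suc n)))"
  unfolding eventually_at_left_field by (intro exI[of _ "x n"]) auto

lemma sol_at_right:
  assumes h: "loc h"
  shows "(sol c h \<longlongrightarrow> sol c h (x n)) (at_right (x n))"
proof -
  define B where "B = (\<Sum>i=1..n. \<beta> i)"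
  have vB: "v t = t + B" if "x n < t" "t < x (Suc n)" for t
    unfolding B_def using that by (intro v_cell) auto
  have "((\<lambda>t. amp c h t + of_real (t + B) * der h t) \<longlongrightarrow> amp c h (x n) + of_real (x n + B) * der h (x n)) (at_right (x n))"
    by (intro tendsto_intros at_right_tendsto amp_continuous der_continuous h x_in_I)
  moreover have "v (x n) = x n + B"
    unfolding B_def by (intro v_cell) auto
  ultimately have "((\<lambda>t. amp c h t + of_real (t + B) * der h t) \<longlongrightarrow> sol c h (x n)) (at_right (x n))"
    by (simp add: sol_def)
  moreover have "\<forall>\<^sub>F t in at_right (x n). amp c h t + of_real (t + B) * der h t = sol c h t"
    by (rule eventually_at_right_cell) (use vB in \<open>auto simp: sol_def\<close>)
  ultimately show ?thesis by (rule Lim_transform_eventually)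
qed

text \<open>To the left of \<open>x (Suc n)\<close> the function \<open>v\<close> is affine, and the
  value of this affine function at \<open>x (Suc n)\<close> lacks the summand
  \<open>\<beta> (Suc n)\<close>. This missing summand is the interface jump.\<close>

lemma sol_at_left:
  assumes h: "loc h"
  shows "(sol c h \<longlongrightarrow> sol c h (x (Suc n)) - of_real (\<beta> (Suc n)) * der h (x (Suc n))) (at_left (x (Suc n)))"
proof -
  define B where "B = (\<Sum>i=1..n. \<beta> i)"
  let ?y = "x (Suc n)"
  have vB: "v t = t + B" if "x n < t" "t < ?y" for t
    unfolding B_def using that by (intro v_cell) auto
  have "((\<lambda>t. amp c h t + of_real (t + B) * der h t) \<longlongrightarrow> amp c h ?y + of_real (?y + B) * der h ?y) (at_left ?y)"
    using x_less_iff[of 0 "Suc n"]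
    by (intro tendsto_intros at_left_tendsto amp_continuous der_continuous h x_in_I) (simp_all add: x_0 del: x_less_iff)
  moreover have "v ?y = ?y + B + \<beta> (Suc n)"
    using v_cell[of "Suc n" ?y] by (simp add: B_def)
  ultimately have "((\<lambda>t. amp c h t + of_real (t + B) * der h t) \<longlongrightarrow> sol c h ?y - of_real (\<beta> (Suc n)) * der h ?y) (at_left ?y)"
    by (simp add: sol_def algebra_simps)
  moreover have "\<forall>\<^sub>F t in at_left ?y. amp c h t + of_real (t + B) * der h t = sol c h t"
    by (rule eventually_at_left_cell) (use vB in \<open>auto simp: sol_def\<close>)
  ultimately show ?thesis by (rule Lim_transform_eventually)
qed

subsection \<open>The elements of the minimal operator\<close>

lemma at_within_I_off_X: "x n < t \<Longrightarrow> t < x (Suc n) \<Longrightarrow> at t within (I - X) = at t"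
  using open_cell[of n] at_within_open_subset[of t "{x n<..<x (Suc n)}" "I - X"] by auto

lemma W22_second_derivative_loc:
  assumes "W22 b X f f' f''"
  shows "loc (\<lambda>t. - f'' t)"
  using assms L2_uminus loc_L2 unfolding W22_def by blast

lemma W22_derivative_increment:
  assumes W: "W22 b X f f' f''" and r: "x n < r" "r \<le> s" "s < x (Suc n)"
  shows "f' s - f' r = der (\<lambda>t. - f'' t) s - der (\<lambda>t. - f'' t) r"
proof -
  have "{r..s} \<subseteq> {x n<..<x (Suc n)}" using r by auto
  then have sub: "{r..s} \<subseteq> I - X" using open_cell[of n] by blast
  then have AC: "abs_cont_on r s f'" using W r(2) unfolding W22_def AC_loc_def by blast
  have "AE t in M. (f' has_vector_derivative f'' t) (at t)" using W by (simp add: W22_def)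
  then have "AE t in lebesgue. t \<in> I \<longrightarrow> (f' has_vector_derivative f'' t) (at t)"
    by (simp only: AE_M_iff)
  then have "AE t in lebesgue. t \<in> {r..s} \<longrightarrow> (f' has_vector_derivative f'' t) (at t)"
    by (rule eventually_mono) (use sub in blast)
  from abs_cont_on_has_integral[OF r(2) AC this] have "integral {r..s} f'' = f' s - f' r"
    by (rule integral_unique)
  moreover have "s \<in> I" "0 \<le> r" using cell_in_I[of n s "Suc n"] r x_nonneg[of n] by auto
  ultimately show ?thesis
    using loc_split[OF W22_second_derivative_loc[OF W], of s r] r(2) by (simp add: der_def)
qed

text \<open>On every cell the difference of the two sides is a constant. The boundary condition
  makes the first constant zero, and the matching one-sided limits of \<open>f'\<close> at the
  centres pass this on to the next cell.\<close>

lemma H_min_derivative: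
  assumes W: "W22 b X f f' f''" and 0: "(f' \<longlongrightarrow> 0) (at_right 0)"
    and n: "\<And>n. n \<ge> 1 \<Longrightarrow> \<exists>d. (f' \<longlongrightarrow> d) (at_right (x n)) \<and> (f' \<longlongrightarrow> d) (at_left (x n))"
    and t: "x m < t" "t < x (Suc m)"
  shows "f' t = der (\<lambda>t. - f'' t) t"
proof -
  define k where "k t = - f'' t" for t
  have k: "loc k" unfolding k_def[abs_def] by (rule W22_second_derivative_loc[OF W])
  define e where "e n = f' ((x n + x (Suc n)) / 2) - der k ((x n + x (Suc n)) / 2)" for n
  have e: "f' t = e n + der k t" if "x n < t" "t < x (Suc n)" for n t
  proof -
    have mid: "x n < (x n + x (Suc n)) / 2" "(x n + x (Suc n)) / 2 < x (Suc n)"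
      using x_less_iff[of n "Suc n"] by (simp_all del: x_less_iff)
    show ?thesis
      using W22_derivative_increment[OF W that(1) _ mid(2)] W22_derivative_increment[OF W mid(1) _ that(2)]
      by (cases "t \<le> (x n + x (Suc n)) / 2") (auto simp: e_def k_def[abs_def] algebra_simps)
  qed
  have right: "(f' \<longlongrightarrow> e n + der k (x n)) (at_right (x n))" for n
  proof (rule Lim_transform_eventually)
    show "((\<lambda>t. e n + der k t) \<longlongrightarrow> e n + der k (x n)) (at_right (x n))"
      by (intro tendsto_intros at_right_tendsto der_continuous k x_in_I)
    show "\<forall>\<^sub>F t in at_right (x n). e n + der k t = f' t"
      by (rule eventually_at_right_cell) (use e in auto)
  qed
  have left: "(f' \<longlongrightarrow> e n + der k (x (Suc n))) (at_left (x (Suc n)))" for n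
  proof (rule Lim_transform_eventually)
    show "((\<lambda>t. e n + der k t) \<longlongrightarrow> e n + der k (x (Suc n))) (at_left (x (Suc n)))"
      using x_less_iff[of 0 "Suc n"]
      by (intro tendsto_intros at_left_tendsto der_continuous k x_in_I) (simp add: x_0 del: x_less_iff)
    show "\<forall>\<^sub>F t in at_left (x (Suc n)). e n + der k t = f' t"
      by (rule eventually_at_left_cell) (use e in auto)
  qed
  have "e n = 0" for n
  proof (induction n)
    case 0
    show ?case using tendsto_unique[OF _ right[of 0]] \<open>(f' \<longlongrightarrow> 0) (at_right 0)\<close> by (auto simp: x_0)
  next
    case (Suc n)
    obtain d where d: "(f' \<longlongrightarrow> d) (at_right (x (Suc n)))" "(f' \<longlongrightarrow> d) (at_left (x (Suc n)))"
      using n[of "Suc n"] by auto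
    have "d = e (Suc n) + der k (x (Suc n))"
      using tendsto_unique[OF _ d(1) right] by auto
    moreover have "d = e n + der k (x (Suc n))"
      using tendsto_unique[OF _ d(2) left] by auto
    ultimately show ?case using Suc by simp
  qed
  then show ?thesis using e[OF t] by (simp add: k_def[abs_def])
qed

text \<open>The gluing of \<open>H_min_derivative\<close> one order lower:
  \<open>f - sol 0 k\<close> is constant on each cell, and the jump required of \<open>f\<close> is
  the one built into \<open>sol\<close>, so the constants agree. Compact support makes
  \<open>sol c k\<close> vanish on open sets near \<open>b\<close>, hence also its derivative, and
  then the amplitude. Points of \<open>X\<close> are left out because \<open>f\<close> is not
  controlled there.\<close>

lemma H_min_form:
  assumes fk: "(f, k) \<in> H_delta'_min b x \<beta>"
  shows "f \<in> L2 M" "k \<in> L2 M"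
    and "\<exists>c. (\<forall>t\<in>I - X. 0 < t \<longrightarrow> f t = sol c k t) \<and>
      (\<exists>a\<in>I. \<forall>t\<in>I - X. a < t \<longrightarrow> amp c k t = 0 \<and> der k t = 0)"
proof -
  obtain f' f'' where W: "W22 b X f f' f''" and comp: "comp_support b X f" and 0: "(f' \<longlongrightarrow> 0) (at_right 0)"
    and jump: "\<And>n. n \<ge> 1 \<Longrightarrow> \<exists>f'x f_right f_left.
        (f' \<longlongrightarrow> f'x) (at_right (x n)) \<and> (f' \<longlongrightarrow> f'x) (at_left (x n)) \<and>
        (f \<longlongrightarrow> f_right) (at_right (x n)) \<and> (f \<longlongrightarrow> f_left) (at_left (x n)) \<and>
        f_right - f_left = complex_of_real (\<beta> n) * f'x"
    and k: "k = (\<lambda>t. - f'' t)"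
    using fk unfolding H_delta'_min_def by blast
  show fL: "f \<in> L2 M" and kL: "k \<in> L2 M"
    using W L2_uminus[of f'' M] unfolding W22_def k by auto
  have lk: "loc k" using loc_L2[OF kL] .
  have "\<exists>d. (f' \<longlongrightarrow> d) (at_right (x n)) \<and> (f' \<longlongrightarrow> d) (at_left (x n))" if "n \<ge> 1" for n
    using jump[OF that] by blast
  then have f': "f' t = der k t" if "x m < t" "t < x (Suc m)" for m t
    unfolding k using that by (intro H_min_derivative[OF W 0]) auto
  have "\<exists>c. \<forall>t\<in>{x n<..<x (Suc n)}. f t - sol 0 k t = c" for n
  proof (rule has_vector_derivative_zero_constant)
    fix t assume t: "t \<in> {x n<..<x (Suc n)}"
    then have "t \<in> I - X" using open_cell by blast
    then have "(f has_vector_derivative f' t) (at t within (I - X))"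
      using W by (simp add: W22_def)
    then have "(f has_vector_derivative der k t) (at t)"
      using t at_within_I_off_X[of n t] f'[of n t] by simp
    moreover have "(sol 0 k has_vector_derivative der k t) (at t)"
      using t by (intro sol_has_derivative_at[OF lk]) auto
    ultimately have "((\<lambda>t. f t - sol 0 k t) has_vector_derivative der k t - der k t) (at t)"
      by (rule has_vector_derivative_diff)
    then show "((\<lambda>t. f t - sol 0 k t) has_vector_derivative 0) (at t within {x n<..<x (Suc n)})"
      by (simp add: has_vector_derivative_at_within)
  qed auto
  then obtain c where c: "\<And>n t. x n < t \<Longrightarrow> t < x (Suc n) \<Longrightarrow> f t = c n + sol 0 k t"
    by (metis (no_types, lifting) add.commute diff_add_cancel greaterThanLessThan_iff)
  have right: "(f \<longlongrightarrow> c n + sol 0 k (x n)) (at_right (x n))" for n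
  proof (rule Lim_transform_eventually)
    show "((\<lambda>t. c n + sol 0 k t) \<longlongrightarrow> c n + sol 0 k (x n)) (at_right (x n))"
      by (intro tendsto_intros sol_at_right lk)
    show "\<forall>\<^sub>F t in at_right (x n). c n + sol 0 k t = f t"
      by (rule eventually_at_right_cell) (use c in auto)
  qed
  have left: "(f \<longlongrightarrow> c n + (sol 0 k (x (Suc n)) - of_real (\<beta> (Suc n)) * der k (x (Suc n)))) (at_left (x (Suc n)))" for n
  proof (rule Lim_transform_eventually)
    show "((\<lambda>t. c n + sol 0 k t) \<longlongrightarrow> c n + (sol 0 k (x (Suc n)) - of_real (\<beta> (Suc n)) * der k (x (Suc n)))) (at_left (x (Suc n)))"
      by (intro tendsto_intros sol_at_left lk)
    show "\<forall>\<^sub>F t in at_left (x (Suc n)). c n + sol 0 k t = f t"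
      by (rule eventually_at_left_cell) (use c in auto)
  qed
  have der_right: "(f' \<longlongrightarrow> der k (x n)) (at_right (x n))" for n
  proof (rule Lim_transform_eventually)
    show "(der k \<longlongrightarrow> der k (x n)) (at_right (x n))"
      by (intro at_right_tendsto der_continuous lk x_in_I)
    show "\<forall>\<^sub>F t in at_right (x n). der k t = f' t"
      by (rule eventually_at_right_cell) (use f' in auto)
  qed
  have c0: "c n = c 0" for n
  proof (induction n)
    case (Suc n)
    obtain d fr fl where lims: "(f' \<longlongrightarrow> d) (at_right (x (Suc n)))" "(f \<longlongrightarrow> fr) (at_right (x (Suc n)))"
      "(f \<longlongrightarrow> fl) (at_left (x (Suc n)))" and j: "fr - fl = of_real (\<beta> (Suc n)) * d"
      using jump[of "Suc n"] by auto
    have "d = der k (x (Suc n))" "fr = c (Suc n) + sol 0 k (x (Suc n))"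
      "fl = c n + (sol 0 k (x (Suc n)) - of_real (\<beta> (Suc n)) * der k (x (Suc n)))"
      using tendsto_unique[OF _ lims(1) der_right] tendsto_unique[OF _ lims(2) right]
        tendsto_unique[OF _ lims(3) left] by auto
    then show ?case using Suc j by (simp add: algebra_simps)
  qed simp
  have f: "f t = sol (c 0) k t" if t: "t \<in> I - X" "0 < t" for t
  proof -
    obtain n where n: "x n \<le> t" "t < x (Suc n)" using cell[of t] t by auto
    then have "x n < t" using cell_off_X[OF n] t by auto
    then have "f t = c 0 + sol 0 k t" using c[OF _ n(2)] c0 by auto
    then show ?thesis using sol_const[of "c 0" 0] by simp
  qed
  have "\<exists>a\<in>I. \<forall>t\<in>I - X. a < t \<longrightarrow> f t = 0"
  proof -
    define K where "K = closure {t \<in> I - X. f t \<noteq> 0}"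
    have K: "compact K" "K \<subseteq> I" using comp by (auto simp: comp_support_def K_def)
    show ?thesis
    proof (cases "K = {}")
      case True
      then have "\<forall>t\<in>I - X. f t = 0" using closure_subset[of "{t \<in> I - X. f t \<noteq> 0}"] unfolding K_def by blast
      then show ?thesis using zero_in_I by blast
    next
      case False
      then obtain a where a: "a \<in> K" "\<And>t. t \<in> K \<Longrightarrow> t \<le> a"
        using compact_attains_sup[OF K(1)] by blast
      have "f t = 0" if "t \<in> I - X" "a < t" for t
        using a(2)[of t] that closure_subset[of "{t \<in> I - X. f t \<noteq> 0}"] unfolding K_def by fastforce
      then show ?thesis using a(1) K(2) by blast
    qed
  qed
  then obtain a where a: "a \<in> I" "\<And>t. t \<in> I - X \<Longrightarrow> a < t \<Longrightarrow> f t = 0" by blast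
  have "amp (c 0) k t = 0 \<and> der k t = 0" if t: "t \<in> I - X" "a < t" for t
  proof -
    have t0: "0 < t" using t a(1) by (auto simp: I_iff)
    obtain n where n: "x n \<le> t" "t < x (Suc n)" using cell[of t] t by auto
    then have n': "x n < t" using cell_off_X[OF n] t t0 by auto
    let ?U = "{max a (x n)<..<x (Suc n)}"
    have s0: "sol (c 0) k s = 0" if "s \<in> ?U" for s
    proof -
      have "s \<in> I - X" using open_cell[of n] that by auto
      moreover have "0 < s" using that x_nonneg[of n] by auto
      ultimately show ?thesis using a(2)[of s] f[of s] that by auto
    qed
    have "((\<lambda>_. 0) has_vector_derivative der k t) (at t)"
      by (rule has_vector_derivative_transform_within_open[OF sol_has_derivative_at[OF lk n' n(2), of "c 0"], of ?U])
         (use t n n' s0 in auto)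
    then have "der k t = 0"
      using vector_derivative_unique_at has_vector_derivative_const by blast
    moreover have "sol (c 0) k t = 0" using s0[of t] t n' n by auto
    ultimately show ?thesis by (simp add: sol_def)
  qed
  then show "\<exists>c. (\<forall>t\<in>I - X. 0 < t \<longrightarrow> f t = sol c k t) \<and>
      (\<exists>a\<in>I. \<forall>t\<in>I - X. a < t \<longrightarrow> amp c k t = 0 \<and> der k t = 0)"
    using f a(1) by blast
qed

section \<open>The maximal operator and Green's formula\<close>

lemma AE_off_X: "AE t in M. t \<in> I - X \<and> 0 < t"
proof -
  have "countable ({0} \<union> X)" by auto
  then have "AE t in lebesgue. t \<notin> {0} \<union> X"
    by (intro AE_completion) (use countable_imp_null_set_lborel AE_not_in in blast)
  then show ?thesis
    unfolding AE_M_iff by (rule eventually_mono) (auto simp: I_iff)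
qed

text \<open>The boundary condition at \<open>0\<close> and the interface conditions are built into
  \<open>sol\<close>, nothing is imposed at \<open>b\<close>, and \<open>c\<close> is the free value
  at \<open>0\<close>. Equality almost everywhere makes the graph saturated, like the adjoint it
  will turn out to be.\<close>

definition T_max :: "real op_graph" where
  "T_max = {(f, h). f \<in> L2 M \<and> h \<in> L2 M \<and> (\<exists>c. AE t in M. f t = sol c h t)}"

text \<open>By the Lagrange identity the Wronskian at \<open>t\<close> is the truncated integral of
  an integrable function, so it converges at \<open>b\<close>. The form is bilinear; inner products
  are reached by conjugating one of the two pairs.\<close>

lemma Green_limit:
  assumes f: "f \<in> L2 M" "h \<in> L2 M" "AE t in M. f t = sol c h t"
    and g: "g \<in> L2 M" "k \<in> L2 M" "AE t in M. g t = sol d k t" and e: "e > 0"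
  shows "\<exists>a\<in>I. \<forall>t\<in>I. a \<le> t \<longrightarrow>
    norm ((amp c h t * der k t - der h t * amp d k t) - (LINT t|M. h t * g t - k t * f t)) < e"
proof -
  let ?F = "\<lambda>t. h t * g t - k t * f t"
  have "integrable M ?F"
    using f g by (intro Bochner_Integration.integrable_diff integrable_mult_L2)
  from truncated_integral_tendsto[OF this e] obtain a where a: "a \<in> I"
    "\<And>t. t \<in> I \<Longrightarrow> a \<le> t \<Longrightarrow> norm (integral {0..t} ?F - integral\<^sup>L M ?F) < e" by blast
  have "AE t in M. ?F t = h t * sol d k t - k t * sol c h t"
    using f(3) g(3) by eventually_elim simp
  then have "integral {0..t} ?F = amp c h t * der k t - der h t * amp d k t" if "t \<in> I" for t
    using integral_AE_cong_I[OF _ that] Lagrange_identity(2)[OF loc_L2[OF f(2)] loc_L2[OF g(2)] that]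
    by simp
  then show ?thesis using a by (intro bexI[of _ a]) auto
qed

lemma H_min_subset_T_max: "H_delta'_min b x \<beta> \<subseteq> T_max"
proof (rule subrelI)
  fix f k assume fk: "(f, k) \<in> H_delta'_min b x \<beta>"
  obtain c where "\<forall>t\<in>I - X. 0 < t \<longrightarrow> f t = sol c k t" using H_min_form(3)[OF fk] by blast
  then have "AE t in M. f t = sol c k t"
    using AE_off_X by (auto elim: eventually_mono)
  then show "(f, k) \<in> T_max"
    using H_min_form(1,2)[OF fk] by (auto simp: T_max_def)
qed

lemma T_max_cnj: "(f, h) \<in> T_max \<Longrightarrow> ((\<lambda>t. cnj (f t)), (\<lambda>t. cnj (h t))) \<in> T_max"
proof -
  assume "(f, h) \<in> T_max"
  then obtain c where "f \<in> L2 M" "h \<in> L2 M" and c: "AE t in M. f t = sol c h t"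
    by (auto simp: T_max_def)
  moreover have "AE t in M. cnj (f t) = sol (cnj c) (\<lambda>t. cnj (h t)) t"
    using c by eventually_elim (simp add: sol_cnj)
  ultimately show ?thesis by (auto simp: T_max_def intro: L2_cnj)
qed

text \<open>Amplitude and derivative of an element of the minimal operator vanish near
  \<open>b\<close>, so the Wronskian in \<open>Green_limit\<close> tends to zero.\<close>

lemma T_max_subset_adjoint: "T_max \<subseteq> op_adjoint M (H_delta'_min b x \<beta>)"
proof (rule subrelI)
  fix g h assume gh: "(g, h) \<in> T_max"
  then have g: "g \<in> L2 M" and h: "h \<in> L2 M" by (auto simp: T_max_def)
  obtain d where d: "AE t in M. cnj (g t) = sol d (\<lambda>t. cnj (h t)) t"
    using T_max_cnj[OF gh] by (auto simp: T_max_def)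
  have "L2_inner M k g = L2_inner M f h" if fk: "(f, k) \<in> H_delta'_min b x \<beta>" for f k
  proof -
    note fL = H_min_form(1)[OF fk] and kL = H_min_form(2)[OF fk]
    obtain c a where c: "\<forall>t\<in>I - X. 0 < t \<longrightarrow> f t = sol c k t" and a: "a \<in> I"
      and zero: "\<forall>t\<in>I - X. a < t \<longrightarrow> amp c k t = 0 \<and> der k t = 0"
      using H_min_form(3)[OF fk] by blast
    have f: "AE t in M. f t = sol c k t"
      using AE_off_X c by (auto elim: eventually_mono)
    let ?J = "LINT t|M. k t * cnj (g t) - cnj (h t) * f t"
    have "norm ?J \<le> e" if e: "e > 0" for e
    proof -
      obtain a' where a': "a' \<in> I" "\<And>t. t \<in> I \<Longrightarrow> a' \<le> t \<Longrightarrow>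
          norm ((amp c k t * der (\<lambda>t. cnj (h t)) t - der k t * amp d (\<lambda>t. cnj (h t)) t) - ?J) < e"
        using Green_limit[OF fL kL f L2_cnj[OF g] L2_cnj[OF h] d e] by blast
      have "max a a' \<in> I" using a a'(1) by (simp add: max_def)
      \<comment> \<open>The vanishing is known off \<open>X\<close> only, hence the choice of a
        point outside \<open>X\<close>.\<close>
      then obtain t where t: "t \<in> I - X" "max a a' < t" using ex_off_X by blast
      then show ?thesis using a'(2)[of t] zero by auto
    qed
    then have "?J = 0" using field_le_epsilon[of "norm ?J" 0] by simp
    moreover have "?J = L2_inner M k g - L2_inner M f h"
      using integrable_L2_inner[OF kL g] integrable_L2_inner[OF fL h]
      by (simp add: L2_inner_def mult.commute)
    ultimately show ?thesis by simp
  qed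
  then show "(g, h) \<in> op_adjoint M (H_delta'_min b x \<beta>)"
    using g h by (auto simp: op_adjoint_def)
qed

subsection \<open>The adjoint of the minimal operator\<close>

lemma integrable_indicator_M: "m \<in> I \<Longrightarrow> integrable M (indicator {0..m} :: real \<Rightarrow> real)"
proof -
  assume m: "m \<in> I"
  have "integrable lebesgue (indicator {0..m} :: real \<Rightarrow> real)"
    by (rule integrable_real_indicator) (auto simp: emeasure_lborel_Icc_eq)
  moreover have "(\<lambda>t. indicator I t *\<^sub>R (indicator {0..m} t :: real)) = indicator {0..m}"
    using I_sub[OF m] by (auto simp: fun_eq_iff indicator_def)
  ultimately show ?thesis
    by (simp add: integrable_restrict_space)
qed

lemma L2_bounded_support:
  assumes f: "f \<in> borel_measurable M" and m: "m \<in> I"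
    and C: "\<And>t. t \<in> {0..m} \<Longrightarrow> cmod (f t) \<le> C" and z: "\<And>t. t \<in> I \<Longrightarrow> m < t \<Longrightarrow> f t = 0"
  shows "f \<in> L2 M"
proof -
  have "integrable M (\<lambda>t. (cmod (f t))\<^sup>2)"
  proof (rule Bochner_Integration.integrable_bound)
    show "integrable M (\<lambda>t. C\<^sup>2 * indicator {0..m} t)"
      using integrable_indicator_M[OF m] by (rule integrable_mult_right)
    show "AE t in M. norm ((cmod (f t))\<^sup>2) \<le> norm (C\<^sup>2 * indicator {0..m} t)"
    proof (rule AE_I2)
      fix t assume "t \<in> space M"
      then have t: "t \<in> I" by simp
      show "norm ((cmod (f t))\<^sup>2) \<le> norm (C\<^sup>2 * indicator {0..m} t)"
      proof (cases "t \<le> m")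
        case True
        then have "t \<in> {0..m}" using t by (simp add: I_iff)
        then show ?thesis using C[of t] by (simp add: power_mono)
      next
        case False
        then show ?thesis using z[OF t] by simp
      qed
    qed
    show "(\<lambda>t. (cmod (f t))\<^sup>2) \<in> borel_measurable M" using f by measurable
  qed
  then show ?thesis using f by (simp add: L2_def)
qed

lemma continuous_loc: "continuous_on I f \<Longrightarrow> loc f" for f :: "real \<Rightarrow> complex"
  unfolding loc_def
  by (auto intro!: absolutely_integrable_continuous_real intro: continuous_on_subset dest: I_sub)

lemma integral_if_subset:
  fixes f :: "real \<Rightarrow> complex"
  assumes "S \<subseteq> T"
  shows "integral T (\<lambda>t. if t \<in> S then f t else 0) = integral S f"
    and "(\<lambda>t. if t \<in> S then f t else 0) integrable_on T \<longleftrightarrow> f integrable_on S"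
  unfolding integral_def integrable_on_def by (simp_all add: has_integral_restrict[OF assms])

lemma sol_loc: "loc h \<Longrightarrow> loc (sol c h)"
  unfolding sol_def[abs_def]
  by (intro loc_add continuous_loc[OF amp_continuous] loc_v[OF continuous_loc[OF der_continuous]])

lemma continuous_bounded_Icc:
  fixes f :: "real \<Rightarrow> complex"
  assumes "continuous_on I f" "m \<in> I"
  obtains C where "\<And>t. t \<in> {0..m} \<Longrightarrow> cmod (f t) \<le> C"
proof -
  have "compact (f ` {0..m})"
    using assms I_sub by (intro compact_continuous_image) (auto intro: continuous_on_subset)
  then have "bounded (f ` {0..m})" by (rule compact_imp_bounded)
  then obtain C where "\<forall>y\<in>f ` {0..m}. cmod y \<le> C" unfolding bounded_iff by blast
  then show ?thesis by (intro that[of C]) auto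
qed

lemma sol_bounded:
  assumes h: "loc h" and m: "m \<in> I"
  obtains C where "\<And>t. t \<in> {0..m} \<Longrightarrow> cmod (sol c h t) \<le> C"
proof -
  obtain A where A: "\<And>t. t \<in> {0..m} \<Longrightarrow> cmod (amp c h t) \<le> A"
    using continuous_bounded_Icc[OF amp_continuous[OF h] m, of c] by blast
  obtain D where D: "\<And>t. t \<in> {0..m} \<Longrightarrow> cmod (der h t) \<le> D"
    using continuous_bounded_Icc[OF der_continuous[OF h] m] by blast
  obtain V where V: "V \<ge> 0" "\<And>t. t \<in> {0..m} \<Longrightarrow> \<bar>v t\<bar> \<le> V" using v_bounded[OF m] by blast
  have "cmod (sol c h t) \<le> A + V * D" if t: "t \<in> {0..m}" for t
  proof -
    have "cmod (of_real (v t) * der h t) \<le> V * D"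
      unfolding norm_mult norm_of_real using V D[OF t] t by (intro mult_mono) auto
    then show ?thesis using A[OF t] unfolding sol_def by (intro norm_triangle_mono)
  qed
  then show ?thesis by (rule that)
qed

lemma norm_integral_increment_le:
  assumes k: "loc k" and L: "\<And>t. cmod (k t) \<le> L" and t: "t \<in> I" and s: "0 \<le> s" "s \<le> t"
  shows "integral {0..t} (\<lambda>r. cmod (k r)) - integral {0..s} (\<lambda>r. cmod (k r)) \<le> L * (t - s)"
proof -
  have "integral {0..t} (\<lambda>r. cmod (k r)) - integral {0..s} (\<lambda>r. cmod (k r)) = integral {s..t} (\<lambda>r. cmod (k r))"
    using loc_split[OF loc_norm[OF k] t s] by simp
  also have "\<dots> \<le> integral {s..t} (\<lambda>r. L)"
    using L loc_integrable_sub[OF loc_norm[OF k] t s(1)] by (intro integral_le) auto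
  also have "\<dots> = L * (t - s)" using s by simp
  finally show ?thesis .
qed

text \<open>For bounded \<open>k\<close> both \<open>der k\<close> and \<open>sol c k\<close> are
  Lipschitz on compact intervals off \<open>X\<close>, which gives absolute continuity; vanishing
  amplitude and derivative from \<open>m\<close> on give compact support.\<close>

lemma H_min_intro:
  assumes k: "k \<in> L2 M" and L: "\<And>t. cmod (k t) \<le> L" and m: "m \<in> I"
    and zero: "\<And>t. t \<in> I \<Longrightarrow> m \<le> t \<Longrightarrow> amp c k t = 0 \<and> der k t = 0"
    and deriv: "AE t in M. (der k has_vector_derivative - k t) (at t)"
  shows "(sol c k, k) \<in> H_delta'_min b x \<beta>"
proof -
  note lk = loc_L2[OF k]
  have L0: "L \<ge> 0" using L[of 0] norm_ge_zero order_trans by blast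
  have sol0: "sol c k t = 0" if "t \<in> I" "m \<le> t" for t
    using zero[OF that] by (simp add: sol_def)
  have der_lip: "cmod (der k t - der k s) \<le> L * (t - s)" if "t \<in> I" "0 \<le> s" "s \<le> t" for s t
    using der_increment[OF lk that] norm_integral_increment_le[OF lk L that] by linarith
  have "W22 b X (sol c k) (der k) (\<lambda>t. - k t)"
    unfolding W22_def
  proof (intro conjI ballI)
    obtain C where "\<And>t. t \<in> {0..m} \<Longrightarrow> cmod (sol c k t) \<le> C"
      using sol_bounded[OF lk m] by blast
    then show "sol c k \<in> L2 M"
      using sol0 by (intro L2_bounded_support[OF sol_measurable[OF lk] m]) auto
    show "AC_loc (I - X) (sol c k)"
      unfolding AC_loc_def
    proof (intro allI impI)
      fix c' d assume cd: "c' \<le> d \<and> {c'..d} \<subseteq> I - X"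
      then have cI: "c' \<in> I - X" and dI: "d \<in> I" by auto
      obtain n where n: "x n \<le> c'" "c' < x (Suc n)" using cell[of c'] cI by auto
      \<comment> \<open>An interval inside \<open>I - X\<close> cannot contain the next centre, so
        it stays within one cell.\<close>
      have d: "d < x (Suc n)"
      proof (rule ccontr)
        assume "\<not> d < x (Suc n)"
        then have "x (Suc n) \<in> {c'..d}" using n by auto
        then have "x (Suc n) \<notin> X" using cd by blast
        then show False by auto
      qed
      show "abs_cont_on c' d (sol c k)"
      proof (rule lipschitz_abs_cont_on)
        fix s t assume st: "c' \<le> s" "s \<le> t" "t \<le> d"
        have s0: "0 \<le> s" using st n x_nonneg[of n] by linarith
        have tI: "t \<in> I" using I_down[OF dI] st s0 by auto
        have sI: "s \<in> I" using I_down[OF tI] st s0 by auto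
        have "cmod (der k s) \<le> L * s"
          using der_lip[OF sI _ s0] by simp
        also have "\<dots> \<le> L * d" using L0 st by (intro mult_left_mono) auto
        finally have 1: "(t - s) * cmod (der k s) \<le> (t - s) * (L * d)"
          using st by (intro mult_left_mono) auto
        have "integral {0..t} (\<lambda>r. cmod (k r)) - integral {0..s} (\<lambda>r. cmod (k r)) \<le> L * (t - s)"
          by (rule norm_integral_increment_le[OF lk L tI s0 st(2)])
        also have "\<dots> \<le> L * d" using L0 st s0 by (intro mult_left_mono) auto
        finally have 2: "(t - s) * (integral {0..t} (\<lambda>r. cmod (k r)) - integral {0..s} (\<lambda>r. cmod (k r))) \<le> (t - s) * (L * d)"
          using st by (intro mult_left_mono) auto
        have "cmod (sol c k t - sol c k s - of_real (t - s) * der k s) \<le> (t - s) * (L * d)"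
          using sol_increment[OF lk, of n s t c] 2 n st d by auto
        moreover have "cmod (of_real (t - s) * der k s) \<le> (t - s) * (L * d)"
          unfolding norm_mult norm_of_real using 1 st by simp
        moreover have "cmod (sol c k t - sol c k s) \<le>
            cmod (sol c k t - sol c k s - of_real (t - s) * der k s) + cmod (of_real (t - s) * der k s)"
          using norm_triangle_ineq[of "sol c k t - sol c k s - of_real (t - s) * der k s" "of_real (t - s) * der k s"]
          by simp
        ultimately show "cmod (sol c k t - sol c k s) \<le> 2 * (L * d) * (t - s)"
          by (simp add: algebra_simps)
      qed
    qed
    show "(sol c k has_vector_derivative der k t) (at t within (I - X))" if t: "t \<in> I - X" for t
    proof -
      obtain n where n: "x n \<le> t" "t < x (Suc n)" using cell[of t] t by auto
      have "(sol c k has_vector_derivative der k t) (at t within {x n..<x (Suc n)})"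
        by (rule sol_has_derivative_within[OF lk n])
      moreover have "at t within (I - X) = at t within {x n..<x (Suc n)}"
      proof (cases "x n < t")
        case True
        then have "at t within (I - X) = at t" using n by (intro at_within_I_off_X)
        moreover have "at t within {x n..<x (Suc n)} = at t"
          by (rule at_within_interior) (use True n in auto)
        ultimately show ?thesis by simp
      next
        case False
        \<comment> \<open>The only point of \<open>I - X\<close> that is not interior to a cell is
          \<open>0\<close>, where both filters are one-sided.\<close>
        then have "t = 0" using cell_off_X[OF n] t by auto
        then have "n = 0" using n(1) x_le_iff[of n 0] by (simp add: x_0 del: x_le_iff)
        have "y \<in> I - X \<longleftrightarrow> 0 \<le> y" if "y < x 1" "y \<noteq> 0" for y
        proof
          assume "0 \<le> y"
          then have "y \<in> {x 0<..<x (Suc 0)}" using that by (simp add: x_0)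
          then show "y \<in> I - X" using open_cell by blast
        qed (auto simp: I_iff)
        then have "(I - X) \<inter> {..<x 1} - {0} = {x n..<x (Suc n)} \<inter> {..<x 1} - {0}"
          unfolding \<open>n = 0\<close> by (intro set_eqI) (simp add: x_0, blast)
        then show ?thesis
          using \<open>t = 0\<close> n \<open>n = 0\<close> by (intro at_within_nhd[of _ "{..<x 1}"]) auto
      qed
      ultimately show ?thesis by simp
    qed
    show "AC_loc (I - X) (der k)"
      unfolding AC_loc_def
    proof (intro allI impI)
      fix c' d assume cd: "c' \<le> d \<and> {c'..d} \<subseteq> I - X"
      then have cI: "c' \<in> I" and dI: "d \<in> I" by auto
      show "abs_cont_on c' d (der k)"
      proof (rule lipschitz_abs_cont_on)
        fix s t assume st: "c' \<le> s" "s \<le> t" "t \<le> d"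
        then have "0 \<le> s" using cI by (simp add: I_iff)
        then show "cmod (der k t - der k s) \<le> L * (t - s)"
          using st I_down[OF dI, of t] by (intro der_lip) auto
      qed
    qed
    show "AE t in M. (der k has_vector_derivative - k t) (at t)" by (rule deriv)
    show "(\<lambda>t. - k t) \<in> L2 M" by (rule L2_uminus[OF k])
  qed
  moreover have "comp_support b X (sol c k)"
  proof -
    have sub: "{t \<in> I - X. sol c k t \<noteq> 0} \<subseteq> {0..m}"
      using sol0 by (force simp: I_iff)
    then have "closure {t \<in> I - X. sol c k t \<noteq> 0} \<subseteq> {0..m}"
      by (rule closure_minimal) simp
    moreover have "compact (closure {t \<in> I - X. sol c k t \<noteq> 0})"
      unfolding compact_closure by (rule bounded_subset[OF _ sub]) simp
    ultimately show ?thesis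
      using I_sub[OF m] unfolding comp_support_def by blast
  qed
  moreover have "(der k \<longlongrightarrow> 0) (at_right 0)"
    using at_right_tendsto[OF der_continuous[OF lk] zero_in_I] by simp
  moreover have "\<exists>f'x f_right f_left.
        (der k \<longlongrightarrow> f'x) (at_right (x n)) \<and> (der k \<longlongrightarrow> f'x) (at_left (x n)) \<and>
        (sol c k \<longlongrightarrow> f_right) (at_right (x n)) \<and> (sol c k \<longlongrightarrow> f_left) (at_left (x n)) \<and>
        f_right - f_left = complex_of_real (\<beta> n) * f'x" if n: "n \<ge> 1" for n
  proof -
    obtain j where j: "n = Suc j" using n by (cases n) auto
    have "0 < x (Suc j)" using x_less_iff[of 0 "Suc j"] by (simp add: x_0 del: x_less_iff)
    then show ?thesis
      unfolding j using at_right_tendsto[OF der_continuous[OF lk] x_in_I, of "Suc j"]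
        at_left_tendsto[OF der_continuous[OF lk] x_in_I, of "Suc j"]
        sol_at_right[OF lk, of c "Suc j"] sol_at_left[OF lk, of c j]
      by (intro exI[of _ "der k (x (Suc j))"] exI[of _ "sol c k (x (Suc j))"]
          exI[of _ "sol c k (x (Suc j)) - of_real (\<beta> (Suc j)) * der k (x (Suc j))"]) simp
  qed
  moreover have "k = (\<lambda>t. - (\<lambda>t. - k t) t)" by simp
  ultimately show ?thesis
    unfolding H_delta'_min_def by blast
qed

text \<open>If a function \<open>D\<close> is orthogonal to all of these, then \<open>(1/p) \<integral>\<^sub>0\<^sup>p D\<close> does not depend
  on \<open>p\<close>, hence \<open>D\<close> is constant.\<close>

definition step_test :: "real \<Rightarrow> real \<Rightarrow> real \<Rightarrow> complex" where
  "step_test p q t = of_real (q * indicator {0..p} t - p * indicator {0..q} t)"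

lemma step_test_bound: "0 < p \<Longrightarrow> 0 < q \<Longrightarrow> cmod (step_test p q t) \<le> p + q"
  unfolding step_test_def norm_of_real by (auto simp: indicator_def)

lemma step_test_eq_0: "max p q < t \<Longrightarrow> step_test p q t = 0"
  by (simp add: step_test_def)

lemma step_test_L2:
  assumes "0 < p" "0 < q" "p \<in> I" "q \<in> I"
  shows "step_test p q \<in> L2 M"
proof (rule L2_bounded_support)
  have "(\<lambda>t. q * indicator {0..p} t - p * indicator {0..q} t) \<in> borel_measurable borel"
    by measurable
  then have "(\<lambda>t. complex_of_real (q * indicator {0..p} t - p * indicator {0..q} t)) \<in> borel_measurable borel"
    by measurable
  then show "step_test p q \<in> borel_measurable M"
    unfolding step_test_def[abs_def] by (intro measurable_restrict_space1 measurable_completion) simp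
  show "max p q \<in> I" using assms by (simp add: max_def)
qed (use step_test_bound step_test_eq_0 assms in auto)

lemma integral_indicator_Icc:
  fixes D :: "real \<Rightarrow> complex"
  assumes "0 \<le> p" "0 \<le> t"
  shows "integral {0..t} (\<lambda>s. of_real (indicator {0..p} s) * D s) = integral {0..min t p} D"
proof -
  have "integral {0..t} (\<lambda>s. of_real (indicator {0..p} s) * D s) =
      integral {0..t} (\<lambda>s. if s \<in> {0..min t p} then D s else 0)"
    by (intro Henstock_Kurzweil_Integration.integral_cong) (auto simp: indicator_def)
  also have "\<dots> = integral {0..min t p} D"
    by (rule integral_if_subset) auto
  finally show ?thesis .
qed

lemma step_test_integral:
  assumes pq: "0 < p" "0 < q" "p \<in> I" "q \<in> I" and t: "t \<in> I" and D: "loc D"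
  shows "integral {0..t} (\<lambda>s. step_test p q s * D s) =
    of_real q * integral {0..min t p} D - of_real p * integral {0..min t q} D"
proof -
  have int: "(\<lambda>s. of_real (indicator {0..r} s) * D s) integrable_on {0..t}" if "r > 0" for r
  proof -
    have "D integrable_on {0..min t r}"
      using loc_integrable_on[OF D] I_down[OF t, of "min t r"] that t by (auto simp: I_iff)
    then have "(\<lambda>s. if s \<in> {0..min t r} then D s else 0) integrable_on {0..t}"
      by (subst integral_if_subset(2)) auto
    then show ?thesis
      by (rule integrable_eq) (auto simp: indicator_def)
  qed
  have "integral {0..t} (\<lambda>s. step_test p q s * D s) =
      integral {0..t} (\<lambda>s. of_real q * (of_real (indicator {0..p} s) * D s) - of_real p * (of_real (indicator {0..q} s) * D s))"
    by (intro Henstock_Kurzweil_Integration.integral_cong) (simp add: step_test_def algebra_simps)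
  also have "\<dots> = of_real q * integral {0..t} (\<lambda>s. of_real (indicator {0..p} s) * D s)
      - of_real p * integral {0..t} (\<lambda>s. of_real (indicator {0..q} s) * D s)"
    using int pq by (simp add: Henstock_Kurzweil_Integration.integral_diff integrable_on_mult_right)
  also have "\<dots> = of_real q * integral {0..min t p} D - of_real p * integral {0..min t q} D"
    using pq t by (simp add: integral_indicator_Icc I_iff del: of_real_indicator)
  finally show ?thesis .
qed

text \<open>Beyond \<open>p\<close> and \<open>q\<close> this piecewise linear function equals
  \<open>p * q - q * p = 0\<close>, which is the reason for the cross weights in
  \<open>step_test\<close>.\<close>

lemma der_step_test:
  assumes pq: "0 < p" "0 < q" "p \<in> I" "q \<in> I" and t: "t \<in> I"
  shows "der (step_test p q) t = of_real (p * min t q - q * min t p)"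
proof -
  have "loc (\<lambda>t. 1 :: complex)" by (intro continuous_loc continuous_intros)
  from step_test_integral[OF pq t this] show ?thesis
    using pq t by (simp add: der_def I_iff scaleR_conv_of_real mult.commute)
qed

lemma min_has_real_derivative:
  fixes t p :: real
  assumes "t \<noteq> p"
  shows "((\<lambda>t. min t p) has_real_derivative (if t < p then 1 else 0)) (at t)"
proof (cases "t < p")
  case True
  have "((\<lambda>t. t) has_real_derivative 1) (at t)" by (rule DERIV_ident)
  then have "((\<lambda>t. min t p) has_real_derivative 1) (at t)"
    by (rule has_field_derivative_transform_within_open[of _ _ _ "{..<p}"]) (use True in auto)
  then show ?thesis using True by simp
next
  case False
  have "((\<lambda>t. p) has_real_derivative 0) (at t)" by (rule DERIV_const)
  then have "((\<lambda>t. min t p) has_real_derivative 0) (at t)"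
    by (rule has_field_derivative_transform_within_open[of _ _ _ "{p<..}"]) (use False assms in auto)
  then show ?thesis using False by simp
qed

lemma step_test_derivative:
  assumes pq: "0 < p" "0 < q" "p \<in> I" "q \<in> I" and t: "t \<in> I" "t \<notin> {0, p, q}"
  shows "(der (step_test p q) has_vector_derivative - step_test p q t) (at t)"
proof -
  have t0: "0 < t" using t by (auto simp: I_iff)
  obtain n where n: "t < x n" using ex_x_greater[OF t(1)] by blast
  have "((\<lambda>t. p * min t q - q * min t p) has_real_derivative
      p * (if t < q then 1 else 0) - q * (if t < p then 1 else 0)) (at t)"
    using t by (intro DERIV_diff DERIV_cmult min_has_real_derivative) auto
  then have "((\<lambda>t. complex_of_real (p * min t q - q * min t p)) has_vector_derivative
      of_real (p * (if t < q then 1 else 0) - q * (if t < p then 1 else 0))) (at t)"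
    by (rule has_vector_derivative_of_real)
  moreover have "of_real (p * (if t < q then 1 else 0) - q * (if t < p then 1 else 0)) = - step_test p q t"
    using t t0 by (auto simp: step_test_def indicator_def)
  ultimately have "((\<lambda>t. complex_of_real (p * min t q - q * min t p)) has_vector_derivative - step_test p q t) (at t)"
    by simp
  from this show ?thesis
  proof (rule has_vector_derivative_transform_within_open)
    show "open {0<..<x n}" by simp
    fix s assume "s \<in> {0<..<x n}"
    then have "s \<in> I" using I_down[OF x_in_I[of n]] by auto
    then show "complex_of_real (p * min s q - q * min s p) = der (step_test p q) s"
      using der_step_test[OF pq] by simp
  qed (use t0 n in auto)
qed

text \<open>From \<open>max p q\<close> on the derivative is zero by the choice of the weights; the
  free constant \<open>c\<close> is spent on cancelling the amplitude.\<close>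

lemma step_test_in_H_min:
  assumes pq: "0 < p" "0 < q" "p \<in> I" "q \<in> I"
  obtains c where "(sol c (step_test p q), step_test p q) \<in> H_delta'_min b x \<beta>"
    "\<And>t. t \<in> I \<Longrightarrow> max p q \<le> t \<Longrightarrow> amp c (step_test p q) t = 0 \<and> der (step_test p q) t = 0"
proof -
  let ?k = "step_test p q"
  have m: "max p q \<in> I" using pq by (simp add: max_def)
  note k = step_test_L2[OF pq]
  have "AE t in lebesgue. t \<notin> {0, p, q}"
    by (intro AE_completion) (use countable_imp_null_set_lborel[of "{0, p, q}"] AE_not_in in blast)
  then have deriv: "AE t in M. (der ?k has_vector_derivative - ?k t) (at t)"
    unfolding AE_M_iff by (rule eventually_mono) (use step_test_derivative[OF pq] in blast)
  define c where "c = - integral {0..max p q} (\<lambda>s. of_real (v s) * ?k s)"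
  have zero: "amp c ?k t = 0 \<and> der ?k t = 0" if t: "t \<in> I" "max p q \<le> t" for t
  proof
    \<comment> \<open>\<open>step_test\<close> is built from closed intervals, so the point
      \<open>max p q\<close> itself has to be discarded.\<close>
    have "integral {max p q..t} (\<lambda>s. of_real (v s) * ?k s) = integral {max p q..t} (\<lambda>s. 0)"
    proof (rule integral_spike[of "{max p q}"])
      fix s assume "s \<in> {max p q..t} - {max p q}"
      then have "max p q < s" by auto
      then show "0 = of_real (v s) * ?k s" using step_test_eq_0 by simp
    qed simp
    then show "amp c ?k t = 0"
      using loc_split[OF loc_v[OF loc_L2[OF k]] t(1), of "max p q"] t pq by (simp add: amp_def c_def)
    show "der ?k t = 0"
      using t by (subst der_step_test[OF pq t(1)]) (simp add: min_def)
  qed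
  have "(sol c ?k, ?k) \<in> H_delta'_min b x \<beta>"
    by (rule H_min_intro[OF k step_test_bound[OF pq(1,2)] m zero deriv])
  then show ?thesis using zero by (rule that)
qed

lemma integral_M_support:
  fixes F :: "real \<Rightarrow> complex"
  assumes F: "integrable M F" and m: "m \<in> I" and z: "\<And>t. t \<in> I \<Longrightarrow> m < t \<Longrightarrow> F t = 0"
  shows "integral\<^sup>L M F = integral {0..m} F"
proof -
  have "integral\<^sup>L M F = integral I F" by (rule integral_M[OF F])
  also have "\<dots> = integral I (\<lambda>t. if t \<in> {0..m} then F t else 0)"
    using z by (intro Henstock_Kurzweil_Integration.integral_cong) (force simp: I_iff)
  also have "\<dots> = integral {0..m} F"
    using I_sub[OF m] by (rule integral_if_subset)
  finally show ?thesis .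
qed

lemma AE_M_eq_0_if_integrals_eq_0:
  assumes h: "loc h" and zero: "\<And>t. t \<in> I \<Longrightarrow> integral {0..t} h = 0"
  shows "AE t in M. h t = (0::complex)"
proof -
  have "AE t in lebesgue. t \<in> {0..x n} \<longrightarrow> h t = 0" for n
    by (rule AE_eq_0_if_integrals_eq_0[OF loc_abs[OF h x_in_I]]) (rule zero[OF I_down[OF x_in_I]])
  then have "AE t in lebesgue. \<forall>n. t \<in> {0..x n} \<longrightarrow> h t = 0"
    by (subst AE_all_countable) blast
  then show ?thesis
    unfolding AE_M_iff
  proof (rule eventually_mono, intro impI)
    fix t assume a: "\<forall>n. t \<in> {0..x n} \<longrightarrow> h t = 0" and t: "t \<in> I"
    obtain n where "t < x n" using ex_x_greater[OF t] by blast
    then have "t \<in> {0..x n}" using t by (simp add: I_iff)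
    then show "h t = 0" using a[rule_format, of n] by simp
  qed
qed

text \<open>The Lagrange identity shows that the difference \<open>D\<close> between the conjugate
  of \<open>g\<close> and the particular solution \<open>sol 0 hc\<close> is orthogonal to every
  \<open>step_test p q\<close>. Hence its integral over \<open>{0..p}\<close> is proportional to
  \<open>p\<close>, so \<open>D\<close> is a constant, namely the missing value at \<open>0\<close>.
  Conjugates appear because that identity is bilinear.\<close>

lemma adjoint_subset_T_max: "op_adjoint M (H_delta'_min b x \<beta>) \<subseteq> T_max"
proof (rule subrelI)
  fix g h assume gh: "(g, h) \<in> op_adjoint M (H_delta'_min b x \<beta>)"
  then have g: "g \<in> L2 M" and h: "h \<in> L2 M"
    and adj: "\<And>f k. (f, k) \<in> H_delta'_min b x \<beta> \<Longrightarrow> L2_inner M k g = L2_inner M f h"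
    by (auto simp: op_adjoint_def)
  define gc hc where "gc t = cnj (g t)" and "hc t = cnj (h t)" for t
  have gc: "gc \<in> L2 M" and hc: "hc \<in> L2 M"
    unfolding gc_def[abs_def] hc_def[abs_def] by (intro L2_cnj g h)+
  define D where "D t = gc t - sol 0 hc t" for t
  have lD: "loc D" unfolding D_def[abs_def] by (intro loc_diff sol_loc loc_L2 gc hc)
  have lin: "of_real q * integral {0..p} D = of_real p * integral {0..q} D"
    if pq: "0 < p" "0 < q" "p \<in> I" "q \<in> I" for p q
  proof -
    let ?k = "step_test p q" and ?m = "max p q"
    have m: "?m \<in> I" using pq by (simp add: max_def)
    obtain c where c: "(sol c ?k, ?k) \<in> H_delta'_min b x \<beta>"
      and zero: "\<And>t. t \<in> I \<Longrightarrow> ?m \<le> t \<Longrightarrow> amp c ?k t = 0 \<and> der ?k t = 0"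
      using step_test_in_H_min[OF pq] by blast
    note k = step_test_L2[OF pq] and f = H_min_form(1)[OF c]
    have lk: "loc ?k" by (rule loc_L2[OF k])
    have i1: "integral\<^sup>L M (\<lambda>t. ?k t * gc t) = integral {0..?m} (\<lambda>t. ?k t * gc t)"
      by (rule integral_M_support[OF integrable_mult_L2[OF k gc] m]) (simp add: step_test_eq_0)
    have i2: "integral\<^sup>L M (\<lambda>t. sol c ?k t * hc t) = integral {0..?m} (\<lambda>t. sol c ?k t * hc t)"
      by (rule integral_M_support[OF integrable_mult_L2[OF f hc] m]) (use zero in \<open>simp add: sol_def\<close>)
    have "integral {0..?m} (\<lambda>t. ?k t * gc t) = integral {0..?m} (\<lambda>t. sol c ?k t * hc t)"
      using adj[OF c] i1 i2 by (simp add: L2_inner_def gc_def hc_def)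
    \<comment> \<open>At \<open>?m\<close> amplitude and derivative of the test function vanish, so
      the Wronskian side of the Lagrange identity is zero.\<close>
    moreover have "integral {0..?m} (\<lambda>s. ?k s * sol 0 hc s - hc s * sol c ?k s) = 0"
      using Lagrange_identity(2)[OF lk loc_L2[OF hc] m, of c 0] zero[OF m] by simp
    moreover have int: "(\<lambda>t. ?k t * gc t) integrable_on {0..?m}" "(\<lambda>t. sol c ?k t * hc t) integrable_on {0..?m}"
      by (intro loc_integrable_on[OF loc_integrable m] integrable_mult_L2 k gc f hc)+
    moreover have int2: "(\<lambda>s. ?k s * sol 0 hc s - hc s * sol c ?k s) integrable_on {0..?m}"
      using loc_integrable_on[OF Lagrange_identity(1)[OF lk loc_L2[OF hc] m] m] .
    moreover have "integral {0..?m} (\<lambda>t. ?k t * gc t - sol c ?k t * hc t - (?k t * sol 0 hc t - hc t * sol c ?k t)) =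
        integral {0..?m} (\<lambda>t. ?k t * gc t) - integral {0..?m} (\<lambda>t. sol c ?k t * hc t) -
        integral {0..?m} (\<lambda>t. ?k t * sol 0 hc t - hc t * sol c ?k t)"
      by (subst Henstock_Kurzweil_Integration.integral_diff[OF integrable_diff[OF int] int2],
          subst Henstock_Kurzweil_Integration.integral_diff[OF int]) (rule refl)
    ultimately have "integral {0..?m} (\<lambda>t. ?k t * gc t - sol c ?k t * hc t - (?k t * sol 0 hc t - hc t * sol c ?k t)) = 0"
      by simp
    moreover have "(\<lambda>t. ?k t * gc t - sol c ?k t * hc t - (?k t * sol 0 hc t - hc t * sol c ?k t)) = (\<lambda>t. ?k t * D t)"
      by (simp add: D_def algebra_simps)
    ultimately have "integral {0..?m} (\<lambda>t. ?k t * D t) = 0" by simp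
    then show ?thesis
      using step_test_integral[OF pq m lD] by simp
  qed
  \<comment> \<open>A fixed positive reference point in \<open>I\<close>; comparing every
    \<open>p\<close> with it determines the constant \<open>C\<close>.\<close>
  define q where "q = x 1"
  have q: "0 < q" "q \<in> I" using x_less_iff[of 0 1] by (auto simp: q_def x_0 x_in_I simp del: x_less_iff)
  define C where "C = integral {0..q} D / of_real q"
  have zero: "integral {0..p} (\<lambda>t. D t - C) = 0" if p: "p \<in> I" for p
  proof (cases "p = 0")
    case False
    then have "0 < p" using p by (simp add: I_iff)
    then have "integral {0..p} D = of_real p * C"
      using lin[OF _ q(1) p q(2)] q by (simp add: C_def field_simps)
    moreover have "integral {0..p} (\<lambda>t. D t - C) = integral {0..p} D - integral {0..p} (\<lambda>t. C)"
      using loc_integrable_on[OF lD p] by (intro Henstock_Kurzweil_Integration.integral_diff) auto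
    ultimately show ?thesis using \<open>0 < p\<close> by (simp add: scaleR_conv_of_real)
  qed simp
  have "loc (\<lambda>t. D t - C)" by (intro loc_diff lD continuous_loc continuous_intros)
  then have "AE t in M. D t - C = 0" using zero by (rule AE_M_eq_0_if_integrals_eq_0)
  then have "AE t in M. g t = sol (cnj C) h t"
  proof (rule eventually_mono)
    fix t assume "D t - C = 0"
    then have "D t = C" by simp
    then have "gc t = C + sol 0 hc t" by (simp only: D_def diff_eq_eq)
    then have "gc t = sol C hc t" using sol_const[of C 0 hc t] by simp
    then have "cnj (gc t) = cnj (sol C hc t)" by simp
    also have "\<dots> = sol (cnj C) (\<lambda>s. cnj (hc s)) t" by (rule sol_cnj[symmetric])
    finally show "g t = sol (cnj C) h t" by (simp only: gc_def hc_def complex_cnj_cnj)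
  qed
  then show "(g, h) \<in> T_max" using g h by (auto simp: T_max_def)
qed

end

section \<open>Deficiency indices and self-adjointness\<close>

subsection \<open>Linearity of the minimal operator\<close>

lemma abs_cont_on_add:
  assumes f: "abs_cont_on c d f" and g: "abs_cont_on c d g"
  shows "abs_cont_on c d (\<lambda>t. f t + g t)"
  unfolding abs_cont_on_def
proof (intro allI impI)
  fix e :: real assume e: "e > 0"
  obtain \<delta>1 where \<delta>1: "\<delta>1 > 0" "\<forall>(n::nat) u v. (\<forall>i<n. c \<le> u i \<and> u i \<le> v i \<and> v i \<le> d) \<longrightarrow>
      disjoint_family_on (\<lambda>i. {u i<..<v i}) {..<n} \<longrightarrow> (\<Sum>i<n. v i - u i) < \<delta>1 \<longrightarrow>
      (\<Sum>i<n. cmod (f (v i) - f (u i))) < e / 2"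
    using f[unfolded abs_cont_on_def, rule_format, OF half_gt_zero[OF e]] by blast
  obtain \<delta>2 where \<delta>2: "\<delta>2 > 0" "\<forall>(n::nat) u v. (\<forall>i<n. c \<le> u i \<and> u i \<le> v i \<and> v i \<le> d) \<longrightarrow>
      disjoint_family_on (\<lambda>i. {u i<..<v i}) {..<n} \<longrightarrow> (\<Sum>i<n. v i - u i) < \<delta>2 \<longrightarrow>
      (\<Sum>i<n. cmod (g (v i) - g (u i))) < e / 2"
    using g[unfolded abs_cont_on_def, rule_format, OF half_gt_zero[OF e]] by blast
  show "\<exists>\<delta>>0. \<forall>(n::nat) u v. (\<forall>i<n. c \<le> u i \<and> u i \<le> v i \<and> v i \<le> d) \<longrightarrow>
      disjoint_family_on (\<lambda>i. {u i<..<v i}) {..<n} \<longrightarrow> (\<Sum>i<n. v i - u i) < \<delta> \<longrightarrow>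
      (\<Sum>i<n. cmod (f (v i) + g (v i) - (f (u i) + g (u i)))) < e"
  proof (intro exI[of _ "min \<delta>1 \<delta>2"] conjI allI impI)
    show "min \<delta>1 \<delta>2 > 0" using \<delta>1(1) \<delta>2(1) by simp
    fix n :: nat and u v :: "nat \<Rightarrow> real"
    assume uv: "\<forall>i<n. c \<le> u i \<and> u i \<le> v i \<and> v i \<le> d" "disjoint_family_on (\<lambda>i. {u i<..<v i}) {..<n}"
      and small: "(\<Sum>i<n. v i - u i) < min \<delta>1 \<delta>2"
    have "(\<Sum>i<n. cmod (f (v i) + g (v i) - (f (u i) + g (u i)))) \<le>
        (\<Sum>i<n. cmod (f (v i) - f (u i)) + cmod (g (v i) - g (u i)))"
      by (intro sum_mono) (metis add_diff_add norm_triangle_ineq)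
    also have "\<dots> = (\<Sum>i<n. cmod (f (v i) - f (u i))) + (\<Sum>i<n. cmod (g (v i) - g (u i)))"
      by (rule sum.distrib)
    also have "(\<Sum>i<n. cmod (f (v i) - f (u i))) < e / 2"
      using small by (intro \<delta>1(2)[rule_format] uv) (use uv(1) in auto)
    also have "(\<Sum>i<n. cmod (g (v i) - g (u i))) < e / 2"
      using small by (intro \<delta>2(2)[rule_format] uv) (use uv(1) in auto)
    finally show "(\<Sum>i<n. cmod (f (v i) + g (v i) - (f (u i) + g (u i)))) < e"
      by simp
  qed
qed

lemma abs_cont_on_cmult:
  assumes f: "abs_cont_on c d f"
  shows "abs_cont_on c d (\<lambda>t. z * f t)"
  unfolding abs_cont_on_def
proof (intro allI impI)
  fix e :: real assume e: "e > 0"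
  have "e / (cmod z + 1) > 0" using e by (simp add: add_nonneg_pos)
  then obtain \<delta> where \<delta>: "\<delta> > 0" "\<forall>(n::nat) u v. (\<forall>i<n. c \<le> u i \<and> u i \<le> v i \<and> v i \<le> d) \<longrightarrow>
      disjoint_family_on (\<lambda>i. {u i<..<v i}) {..<n} \<longrightarrow> (\<Sum>i<n. v i - u i) < \<delta> \<longrightarrow>
      (\<Sum>i<n. cmod (f (v i) - f (u i))) < e / (cmod z + 1)"
    using f[unfolded abs_cont_on_def, rule_format] by blast
  show "\<exists>\<delta>>0. \<forall>(n::nat) u v. (\<forall>i<n. c \<le> u i \<and> u i \<le> v i \<and> v i \<le> d) \<longrightarrow>
      disjoint_family_on (\<lambda>i. {u i<..<v i}) {..<n} \<longrightarrow> (\<Sum>i<n. v i - u i) < \<delta> \<longrightarrow>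
      (\<Sum>i<n. cmod (z * f (v i) - z * f (u i))) < e"
  proof (intro exI[of _ \<delta>] conjI allI impI)
    fix n :: nat and u v :: "nat \<Rightarrow> real"
    assume uv: "\<forall>i<n. c \<le> u i \<and> u i \<le> v i \<and> v i \<le> d" "disjoint_family_on (\<lambda>i. {u i<..<v i}) {..<n}"
      and small: "(\<Sum>i<n. v i - u i) < \<delta>"
    have "(\<Sum>i<n. cmod (f (v i) - f (u i))) < e / (cmod z + 1)"
      using small by (intro \<delta>(2)[rule_format] uv) (use uv(1) in auto)
    moreover have "(\<Sum>i<n. cmod (z * f (v i) - z * f (u i))) = cmod z * (\<Sum>i<n. cmod (f (v i) - f (u i)))"
      by (simp add: sum_distrib_left norm_mult[symmetric] right_diff_distrib)
    moreover have "\<dots> \<le> (cmod z + 1) * (\<Sum>i<n. cmod (f (v i) - f (u i)))"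
      by (intro mult_right_mono sum_nonneg) auto
    ultimately show "(\<Sum>i<n. cmod (z * f (v i) - z * f (u i))) < e"
      by (smt (verit, best) add_nonneg_pos e mult.commute norm_ge_zero pos_less_divide_eq)
  qed (rule \<delta>(1))
qed

lemma W22_add:
  assumes "W22 b X f f' f''" "W22 b X g g' g''"
  shows "W22 b X (\<lambda>t. f t + g t) (\<lambda>t. f' t + g' t) (\<lambda>t. f'' t + g'' t)"
  unfolding W22_def AC_loc_def
proof (intro conjI ballI allI impI)
  have "AE t in lebesgue_on (half_open b). (f' has_vector_derivative f'' t) (at t)"
    "AE t in lebesgue_on (half_open b). (g' has_vector_derivative g'' t) (at t)"
    using assms by (auto simp: W22_def)
  then show "AE t in lebesgue_on (half_open b). ((\<lambda>t. f' t + g' t) has_vector_derivative f'' t + g'' t) (at t)"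
    by eventually_elim (rule has_vector_derivative_add)
qed (use assms in \<open>auto simp: W22_def AC_loc_def intro!: L2_add abs_cont_on_add has_vector_derivative_add\<close>)

lemma W22_cmult:
  assumes "W22 b X f f' f''"
  shows "W22 b X (\<lambda>t. z * f t) (\<lambda>t. z * f' t) (\<lambda>t. z * f'' t)"
  unfolding W22_def AC_loc_def
proof (intro conjI ballI allI impI)
  have "AE t in lebesgue_on (half_open b). (f' has_vector_derivative f'' t) (at t)"
    using assms by (auto simp: W22_def)
  then show "AE t in lebesgue_on (half_open b). ((\<lambda>t. z * f' t) has_vector_derivative z * f'' t) (at t)"
    by eventually_elim (rule has_vector_derivative_mult_right)
qed (use assms in \<open>auto simp: W22_def AC_loc_def intro!: L2_cmult abs_cont_on_cmult has_vector_derivative_mult_right\<close>)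

lemma comp_support_subset:
  assumes "comp_support b X f" "comp_support b X g" "\<And>t. h t \<noteq> 0 \<Longrightarrow> f t \<noteq> 0 \<or> g t \<noteq> 0"
  shows "comp_support b X h"
proof -
  let ?S = "\<lambda>f. closure {t \<in> half_open b - X. f t \<noteq> (0::complex)}"
  have "{t \<in> half_open b - X. h t \<noteq> 0} \<subseteq> {t \<in> half_open b - X. f t \<noteq> 0} \<union> {t \<in> half_open b - X. g t \<noteq> 0}"
    using assms(3) by auto
  then have sub: "?S h \<subseteq> ?S f \<union> ?S g"
    unfolding closure_Un[symmetric] by (rule closure_mono)
  have "compact (?S f \<union> ?S g)" "?S f \<union> ?S g \<subseteq> half_open b"
    using assms(1,2) unfolding comp_support_def by (auto intro: compact_Un)
  moreover from this(1) have "compact (?S h)"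
    using compact_Int_closed[OF _ closed_closure, of "?S f \<union> ?S g" "{t \<in> half_open b - X. h t \<noteq> 0}"]
    by (simp only: Int_absorb1[OF sub])
  ultimately show ?thesis
    using sub unfolding comp_support_def by blast
qed

lemma H_min_add:
  assumes "(f, k) \<in> H_delta'_min b x \<beta>" "(g, l) \<in> H_delta'_min b x \<beta>"
  shows "((\<lambda>t. f t + g t), (\<lambda>t. k t + l t)) \<in> H_delta'_min b x \<beta>"
proof -
  obtain f' f'' where f: "W22 b (x ` {1..}) f f' f''" "comp_support b (x ` {1..}) f" "(f' \<longlongrightarrow> 0) (at_right 0)"
    "k = (\<lambda>t. - f'' t)"
    and fj: "\<And>n. n \<ge> 1 \<Longrightarrow> \<exists>f'x f_right f_left.
        (f' \<longlongrightarrow> f'x) (at_right (x n)) \<and> (f' \<longlongrightarrow> f'x) (at_left (x n)) \<and>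
        (f \<longlongrightarrow> f_right) (at_right (x n)) \<and> (f \<longlongrightarrow> f_left) (at_left (x n)) \<and>
        f_right - f_left = complex_of_real (\<beta> n) * f'x"
    using assms(1) unfolding H_delta'_min_def by blast
  obtain g' g'' where g: "W22 b (x ` {1..}) g g' g''" "comp_support b (x ` {1..}) g" "(g' \<longlongrightarrow> 0) (at_right 0)"
    "l = (\<lambda>t. - g'' t)"
    and gj: "\<And>n. n \<ge> 1 \<Longrightarrow> \<exists>f'x f_right f_left.
        (g' \<longlongrightarrow> f'x) (at_right (x n)) \<and> (g' \<longlongrightarrow> f'x) (at_left (x n)) \<and>
        (g \<longlongrightarrow> f_right) (at_right (x n)) \<and> (g \<longlongrightarrow> f_left) (at_left (x n)) \<and>
        f_right - f_left = complex_of_real (\<beta> n) * f'x"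
    using assms(2) unfolding H_delta'_min_def by blast
  let ?F = "\<lambda>t. f t + g t" and ?F' = "\<lambda>t. f' t + g' t" and ?F'' = "\<lambda>t. f'' t + g'' t"
  have W: "W22 b (x ` {1..}) ?F ?F' ?F''"
    by (rule W22_add[OF f(1) g(1)])
  have S: "comp_support b (x ` {1..}) ?F"
    by (rule comp_support_subset[OF f(2) g(2)]) auto
  have Z: "(?F' \<longlongrightarrow> 0) (at_right 0)"
    using tendsto_add[OF f(3) g(3)] by simp
  have J: "\<exists>f'x f_right f_left.
        (?F' \<longlongrightarrow> f'x) (at_right (x n)) \<and> (?F' \<longlongrightarrow> f'x) (at_left (x n)) \<and>
        (?F \<longlongrightarrow> f_right) (at_right (x n)) \<and> (?F \<longlongrightarrow> f_left) (at_left (x n)) \<and>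
        f_right - f_left = complex_of_real (\<beta> n) * f'x" if n: "n \<ge> 1" for n
  proof -
    obtain a r l' where 1: "(f' \<longlongrightarrow> a) (at_right (x n))" "(f' \<longlongrightarrow> a) (at_left (x n))"
        "(f \<longlongrightarrow> r) (at_right (x n))" "(f \<longlongrightarrow> l') (at_left (x n))" "r - l' = of_real (\<beta> n) * a"
      using fj[OF n] by blast
    obtain a2 r2 l2 where 2: "(g' \<longlongrightarrow> a2) (at_right (x n))" "(g' \<longlongrightarrow> a2) (at_left (x n))"
        "(g \<longlongrightarrow> r2) (at_right (x n))" "(g \<longlongrightarrow> l2) (at_left (x n))" "r2 - l2 = of_real (\<beta> n) * a2"
      using gj[OF n] by blast
    have "r + r2 - (l' + l2) = of_real (\<beta> n) * (a + a2)"
      using 1(5) 2(5) by (simp add: algebra_simps)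
    then show ?thesis
      using tendsto_add[OF 1(1) 2(1)] tendsto_add[OF 1(2) 2(2)] tendsto_add[OF 1(3) 2(3)] tendsto_add[OF 1(4) 2(4)]
      by blast
  qed
  have "(\<lambda>t. k t + l t) = (\<lambda>t. - ?F'' t)" using f(4) g(4) by auto
  then show ?thesis
    unfolding H_delta'_min_def using W S Z J by blast
qed

lemma H_min_cmult:
  assumes "(f, k) \<in> H_delta'_min b x \<beta>"
  shows "((\<lambda>t. z * f t), (\<lambda>t. z * k t)) \<in> H_delta'_min b x \<beta>"
proof -
  obtain f' f'' where f: "W22 b (x ` {1..}) f f' f''" "comp_support b (x ` {1..}) f" "(f' \<longlongrightarrow> 0) (at_right 0)"
    "k = (\<lambda>t. - f'' t)"
    and fj: "\<And>n. n \<ge> 1 \<Longrightarrow> \<exists>f'x f_right f_left.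
        (f' \<longlongrightarrow> f'x) (at_right (x n)) \<and> (f' \<longlongrightarrow> f'x) (at_left (x n)) \<and>
        (f \<longlongrightarrow> f_right) (at_right (x n)) \<and> (f \<longlongrightarrow> f_left) (at_left (x n)) \<and>
        f_right - f_left = complex_of_real (\<beta> n) * f'x"
    using assms(1) unfolding H_delta'_min_def by blast
  let ?F = "\<lambda>t. z * f t" and ?F' = "\<lambda>t. z * f' t" and ?F'' = "\<lambda>t. z * f'' t"
  have W: "W22 b (x ` {1..}) ?F ?F' ?F''"
    by (rule W22_cmult[OF f(1)])
  have S: "comp_support b (x ` {1..}) ?F"
    by (rule comp_support_subset[OF f(2) f(2)]) auto
  have Z: "(?F' \<longlongrightarrow> 0) (at_right 0)"
    using tendsto_mult_left[OF f(3), of z] by simp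
  have J: "\<exists>f'x f_right f_left.
        (?F' \<longlongrightarrow> f'x) (at_right (x n)) \<and> (?F' \<longlongrightarrow> f'x) (at_left (x n)) \<and>
        (?F \<longlongrightarrow> f_right) (at_right (x n)) \<and> (?F \<longlongrightarrow> f_left) (at_left (x n)) \<and>
        f_right - f_left = complex_of_real (\<beta> n) * f'x" if n: "n \<ge> 1" for n
  proof -
    obtain a r l where 1: "(f' \<longlongrightarrow> a) (at_right (x n))" "(f' \<longlongrightarrow> a) (at_left (x n))"
        "(f \<longlongrightarrow> r) (at_right (x n))" "(f \<longlongrightarrow> l) (at_left (x n))" "r - l = of_real (\<beta> n) * a"
      using fj[OF n] by blast
    have "z * r - z * l = of_real (\<beta> n) * (z * a)"
      using 1(5) by (simp add: right_diff_distrib[symmetric])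
    then show ?thesis
      using tendsto_mult_left[OF 1(1)] tendsto_mult_left[OF 1(2)] tendsto_mult_left[OF 1(3)] tendsto_mult_left[OF 1(4)]
      by blast
  qed
  have "(\<lambda>t. z * k t) = (\<lambda>t. - ?F'' t)" using f(4) by auto
  then show ?thesis
    unfolding H_delta'_min_def using W S Z J by blast
qed

text \<open>Comparison with the maximum of \<open>y(t) e\<^bsup>- 2 B t\<^esup>\<close>.\<close>

lemma Gronwall_zero:
  fixes y :: "real \<Rightarrow> real"
  assumes y: "continuous_on {0..T} y" and y0: "\<And>t. t \<in> {0..T} \<Longrightarrow> 0 \<le> y t" and B: "B > 0"
    and le: "\<And>t. t \<in> {0..T} \<Longrightarrow> y t \<le> integral {0..t} (\<lambda>s. B * y s)" and t: "t \<in> {0..T}"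
  shows "y t = 0"
proof -
  \<comment> \<open>The rate \<open>2 * B\<close> is chosen because integrating
    \<open>B * exp (2 * B * s)\<close> returns only half of the exponential, so that at the maximum
    \<open>y\<close> is bounded by half of itself.\<close>
  define m where "m t = y t * exp (- 2 * B * t)" for t
  have "continuous_on {0..T} m"
    unfolding m_def[abs_def] by (intro continuous_intros y)
  then obtain \<tau> where \<tau>: "\<tau> \<in> {0..T}" "\<And>s. s \<in> {0..T} \<Longrightarrow> m s \<le> m \<tau>"
    using continuous_attains_sup[of "{0..T}" m] t by auto
  have y_le: "y s \<le> m \<tau> * exp (2 * B * s)" if "s \<in> {0..T}" for s
    using \<tau>(2)[OF that] by (simp add: m_def exp_minus field_simps)
  have m0: "m \<tau> \<ge> 0" using y0[OF \<tau>(1)] by (simp add: m_def)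
  have int: "((\<lambda>s. B * (m \<tau> * exp (2 * B * s))) has_integral
      m \<tau> / 2 * exp (2 * B * \<tau>) - m \<tau> / 2 * exp (2 * B * 0)) {0..\<tau>}"
    using \<tau>(1) B
    by (intro fundamental_theorem_of_calculus)
       (auto intro!: derivative_eq_intros simp: has_real_derivative_iff_has_vector_derivative[symmetric])
  have "y \<tau> \<le> integral {0..\<tau>} (\<lambda>s. B * y s)" by (rule le[OF \<tau>(1)])
  also have "\<dots> \<le> integral {0..\<tau>} (\<lambda>s. B * (m \<tau> * exp (2 * B * s)))"
  proof (rule integral_le)
    show "(\<lambda>s. B * y s) integrable_on {0..\<tau>}"
      using \<tau>(1) by (intro integrable_continuous_real continuous_intros continuous_on_subset[OF y]) auto
    show "B * y s \<le> B * (m \<tau> * exp (2 * B * s))" if "s \<in> {0..\<tau>}" for s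
      using that \<tau>(1) B by (intro mult_left_mono y_le) auto
  qed (use int in \<open>auto simp: has_integral_iff\<close>)
  also have "\<dots> = m \<tau> / 2 * exp (2 * B * \<tau>) - m \<tau> / 2"
    using int by (simp add: has_integral_iff)
  also have "m \<tau> / 2 * exp (2 * B * \<tau>) = y \<tau> / 2"
    by (simp add: m_def exp_minus)
  finally have "y \<tau> \<le> 0" using m0 by simp
  then have "m \<tau> \<le> 0" by (simp add: m_def mult_nonpos_nonneg)
  then have "y t * exp (- 2 * B * t) \<le> 0" using \<tau>(2)[OF t] by (simp add: m_def)
  then show ?thesis using y0[OF t] by (simp add: mult_le_0_iff)
qed

text \<open>\<open>L2_dim\<close> is a supremum over finite independent sets. A relation between two
  distinct members, extended by zero coefficients to the whole set, contradicts independence, so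
  such sets have at most one element.\<close>

lemma L2_dim_le_1:
  assumes "\<And>f g. f \<in> S \<Longrightarrow> g \<in> S \<Longrightarrow> \<exists>c d. (c \<noteq> 0 \<or> d \<noteq> 0) \<and> (AE t in M. c * f t + d * g t = 0)"
  shows "L2_dim M S \<le> 1"
  unfolding L2_dim_def
proof (rule SUP_least)
  fix B assume "B \<in> {B. finite B \<and> B \<subseteq> S \<and> L2_independent M B}"
  then have B: "finite B" "B \<subseteq> S" "L2_independent M B" by auto
  have "f = g" if fg: "f \<in> B" "g \<in> B" for f g
  proof (rule ccontr)
    assume ne: "f \<noteq> g"
    obtain c d where cd: "c \<noteq> 0 \<or> d \<noteq> 0" "AE t in M. c * f t + d * g t = 0"
      using assms[of f g] fg B(2) by auto
    define C where "C h = (if h = f then c else if h = g then d else 0)" for h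
    have "(\<Sum>h\<in>B. C h * h t) = c * f t + d * g t" for t
    proof -
      have "(\<Sum>h\<in>B. C h * h t) = (\<Sum>h\<in>{f, g}. C h * h t)"
        using fg B(1) by (intro sum.mono_neutral_right) (auto simp: C_def)
      then show ?thesis using ne by (simp add: C_def)
    qed
    then have "AE t in M. (\<Sum>h\<in>B. C h * h t) = 0" using cd(2) by simp
    then have "\<forall>h\<in>B. C h = 0" using B(3) unfolding L2_independent_def by blast
    then show False using fg cd(1) ne by (auto simp: C_def split: if_splits)
  qed
  then have "card B \<le> Suc 0" using B(1) by (metis card_le_Suc0_iff_eq)
  then show "enat (card B) \<le> 1" by (simp add: one_enat_def)
qed

text \<open>Conjugation is injective and antilinear, so it carries independent sets to independent
  sets, with conjugated coefficients.\<close>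

lemma L2_dim_cnj_le:
  assumes "\<And>f. f \<in> S \<Longrightarrow> (\<lambda>t. cnj (f t)) \<in> S'"
  shows "L2_dim M S \<le> L2_dim M S'"
  unfolding L2_dim_def
proof (rule SUP_mono)
  fix B assume "B \<in> {B. finite B \<and> B \<subseteq> S \<and> L2_independent M B}"
  then have B: "finite B" "B \<subseteq> S" "L2_independent M B" by auto
  define J where "J f = (\<lambda>t. cnj (f t))" for f :: "'a \<Rightarrow> complex"
  have "inj J" unfolding J_def inj_def fun_eq_iff by simp
  then have inj: "inj_on J B" by (rule inj_on_subset) simp
  have "L2_independent M (J ` B)"
    unfolding L2_independent_def
  proof (intro allI impI ballI)
    fix c g assume ae: "AE t in M. (\<Sum>f\<in>J ` B. c f * f t) = 0" and g: "g \<in> J ` B"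
    have "AE t in M. (\<Sum>f\<in>B. cnj (c (J f)) * f t) = 0"
      using ae
    proof eventually_elim
      case (elim t)
      then have "cnj (\<Sum>f\<in>B. c (J f) * J f t) = 0"
        using inj by (simp add: sum.reindex)
      then show ?case by (simp add: cnj_sum J_def)
    qed
    then have "\<forall>f\<in>B. cnj (c (J f)) = 0"
      using B(3)[unfolded L2_independent_def, rule_format, of "\<lambda>f. cnj (c (J f))"] by blast
    then show "c g = 0" using g by auto
  qed
  moreover have "J ` B \<subseteq> S'" using B(2) assms by (auto simp: J_def)
  moreover have "card (J ` B) = card B" using inj by (rule card_image)
  ultimately show "\<exists>B'\<in>{B. finite B \<and> B \<subseteq> S' \<and> L2_independent M B}. enat (card B) \<le> enat (card B')"
    using B(1) by (intro bexI[of _ "J ` B"]) auto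
qed

context interface_problem
begin

lemma adjoint_H_min: "op_adjoint M (H_delta'_min b x \<beta>) = T_max"
proof (rule subset_antisym)
  show "op_adjoint M (H_delta'_min b x \<beta>) \<subseteq> T_max" by (rule adjoint_subset_T_max)
  show "T_max \<subseteq> op_adjoint M (H_delta'_min b x \<beta>)" by (rule T_max_subset_adjoint)
qed

lemma adjoint_H: "op_adjoint M (H_delta' b x \<beta>) = T_max"
proof -
  have L: "f \<in> L2 M \<and> k \<in> L2 M" if "(f, k) \<in> H_delta'_min b x \<beta>" for f k
    using H_min_form(1,2)[OF that] by (rule conjI)
  have "op_adjoint M (op_closure M (H_delta'_min b x \<beta>)) = op_adjoint M (H_delta'_min b x \<beta>)"
    by (rule op_adjoint_closure) (rule L)
  then show ?thesis
    by (simp only: H_delta'_def adjoint_H_min)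
qed

subsection \<open>Deficiency indices\<close>

text \<open>Both functions are set to zero where the bound fails; this makes it pointwise and
  changes neither integral.\<close>

lemma norm_integral_le_AE:
  fixes h :: "real \<Rightarrow> complex"
  assumes h: "loc h" and t: "t \<in> I" and g: "g integrable_on {0..t}" and le: "AE s in M. s \<in> {0..t} \<longrightarrow> cmod (h s) \<le> g s"
  shows "cmod (integral {0..t} h) \<le> integral {0..t} g"
proof -
  define h' where "h' s = (if cmod (h s) \<le> g s then h s else 0)" for s
  define g' where "g' s = (if cmod (h s) \<le> g s then g s else 0)" for s
  obtain N where N: "N \<in> null_sets lebesgue"
    "{s \<in> space lebesgue. \<not> (s \<in> I \<longrightarrow> s \<in> {0..t} \<longrightarrow> cmod (h s) \<le> g s)} \<subseteq> N"
    using le[unfolded AE_M_iff, unfolded eventually_ae_filter] by blast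
  have good: "cmod (h s) \<le> g s" if "s \<in> {0..t} - N" for s
  proof -
    have "s \<in> I" using that I_sub[OF t] by blast
    then show ?thesis using that N(2) by auto
  qed
  have negN: "negligible N" using N(1) by (simp add: negligible_iff_null_sets)
  have "integral {0..t} h = integral {0..t} h'"
    by (rule integral_spike[OF negN]) (use good in \<open>auto simp: h'_def\<close>)
  moreover have "integral {0..t} g = integral {0..t} g'"
    by (rule integral_spike[OF negN]) (use good in \<open>auto simp: g'_def\<close>)
  moreover have "h' integrable_on {0..t}"
    by (rule integrable_spike[OF loc_integrable_on[OF h t] negN]) (use good in \<open>auto simp: h'_def\<close>)
  moreover have "g' integrable_on {0..t}"
    by (rule integrable_spike[OF g negN]) (use good in \<open>auto simp: g'_def\<close>)
  moreover have "cmod (h' s) \<le> g' s" for s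
    by (auto simp: h'_def g'_def)
  ultimately show ?thesis
    by (metis integral_norm_bound_integral)
qed

text \<open>With initial value zero, \<open>der h\<close> and \<open>amp 0 h\<close> are integrals
  of multiples of \<open>h\<close>, while \<open>h\<close> is in turn bounded by them through
  \<open>f = sol 0 h\<close>. So the sum of their moduli satisfies a homogeneous Gronwall
  inequality.\<close>

lemma eigenfunction_zero:
  assumes f: "f \<in> L2 M" and ae: "AE t in M. f t = sol 0 (\<lambda>s. z * f s) t"
  shows "AE t in M. f t = 0"
proof -
  define h where "h s = z * f s" for s
  have lh: "loc h" unfolding h_def[abs_def] by (intro loc_cmult loc_L2 f)
  have "sol 0 h t = 0" if t: "t \<in> I" for t
  proof -
    obtain C where C: "C \<ge> 0" "\<And>s. s \<in> {0..t} \<Longrightarrow> \<bar>v s\<bar> \<le> C" using v_bounded[OF t] by blast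
    define y where "y s = cmod (der h s) + cmod (amp 0 h s)" for s
    \<comment> \<open>One factor \<open>1 + C\<close> bounds \<open>sol\<close> by \<open>y\<close>,
      the other collects the kernels \<open>1\<close> and \<open>v\<close> of the two integrals;
      \<open>cmod z + 1\<close> keeps \<open>B\<close> positive for \<open>z = 0\<close>.\<close>
    define B where "B = (cmod z + 1) * (1 + C)\<^sup>2"
    have B: "B > 0" using C by (simp add: B_def add_nonneg_pos)
    have yc: "continuous_on I y"
      unfolding y_def[abs_def] by (intro continuous_intros der_continuous amp_continuous lh)
    have y0: "0 \<le> y s" for s by (simp add: y_def)
    have hb: "AE s in M. s \<in> {0..t} \<longrightarrow> cmod (h s) \<le> (cmod z + 1) * (1 + C) * y s"
      using ae
    proof (eventually_elim, intro impI)
      fix s assume fs: "f s = sol 0 (\<lambda>s. z * f s) s" and s: "s \<in> {0..t}"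
      have "cmod (of_real (v s) * der h s) \<le> C * cmod (der h s)"
        unfolding norm_mult norm_of_real using C(2)[OF s] by (intro mult_right_mono) auto
      then have "cmod (sol 0 h s) \<le> cmod (amp 0 h s) + C * cmod (der h s)"
        unfolding sol_def by (intro norm_triangle_mono) auto
      also have "\<dots> \<le> (1 + C) * y s"
        using C(1) by (simp add: y_def algebra_simps)
      finally have "cmod (f s) \<le> (1 + C) * y s" using fs by (simp add: h_def[abs_def])
      then have "cmod z * cmod (f s) \<le> (cmod z + 1) * ((1 + C) * y s)"
        using C(1) y0 by (intro mult_mono) auto
      then show "cmod (h s) \<le> (cmod z + 1) * (1 + C) * y s"
        by (simp add: h_def norm_mult mult.assoc)
    qed
    have "y t = 0"
    proof (rule Gronwall_zero[of t y B])
      show "continuous_on {0..t} y" using yc I_sub[OF t] by (rule continuous_on_subset)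
      show "t \<in> {0..t}" using t by (simp add: I_iff)
      fix s assume s: "s \<in> {0..t}"
      then have sI: "s \<in> I" using I_sub[OF t] by blast
      have yi: "y integrable_on {0..s}"
        using continuous_on_subset[OF yc I_sub[OF sI]] by (rule integrable_continuous_real)
      have "cmod (integral {0..s} h) \<le> integral {0..s} (\<lambda>r. (cmod z + 1) * (1 + C) * y r)"
        using hb s by (intro norm_integral_le_AE[OF lh sI] integrable_on_mult_right yi) (auto elim: eventually_mono)
      moreover have "cmod (integral {0..s} (\<lambda>r. of_real (v r) * h r)) \<le>
          integral {0..s} (\<lambda>r. C * ((cmod z + 1) * (1 + C) * y r))"
      proof (intro norm_integral_le_AE[OF loc_v[OF lh] sI] integrable_on_mult_right yi)
        show "AE r in M. r \<in> {0..s} \<longrightarrow> cmod (of_real (v r) * h r) \<le> C * ((cmod z + 1) * (1 + C) * y r)"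
          using hb
        proof (eventually_elim, intro impI)
          fix r assume a: "r \<in> {0..t} \<longrightarrow> cmod (h r) \<le> (cmod z + 1) * (1 + C) * y r" and r: "r \<in> {0..s}"
          then have rt: "r \<in> {0..t}" using s by auto
          show "cmod (of_real (v r) * h r) \<le> C * ((cmod z + 1) * (1 + C) * y r)"
            unfolding norm_mult norm_of_real using a rt C(1) C(2)[OF rt] by (intro mult_mono) auto
        qed
      qed
      ultimately have "y s \<le> integral {0..s} (\<lambda>r. (cmod z + 1) * (1 + C) * y r) + integral {0..s} (\<lambda>r. C * ((cmod z + 1) * (1 + C) * y r))"
        by (simp add: y_def der_def amp_def)
      also have "\<dots> = integral {0..s} (\<lambda>r. (cmod z + 1) * (1 + C) * y r + C * ((cmod z + 1) * (1 + C) * y r))"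
        by (rule Henstock_Kurzweil_Integration.integral_add[symmetric]; intro integrable_on_mult_right yi)
      also have "\<dots> = integral {0..s} (\<lambda>r. B * y r)"
        by (intro Henstock_Kurzweil_Integration.integral_cong) (simp add: B_def power2_eq_square algebra_simps)
      finally show "y s \<le> integral {0..s} (\<lambda>r. B * y r)" .
    qed (use y0 B in auto)
    then have "der h t = 0" "amp 0 h t = 0"
      by (simp_all add: y_def add_nonneg_eq_0_iff)
    then show ?thesis by (simp add: sol_def)
  qed
  moreover have "AE t in M. t \<in> I" by (rule AE_I2) simp
  ultimately show ?thesis
    using ae by (auto simp: h_def[abs_def] elim: eventually_elim2)
qed

text \<open>An element of the kernel is determined by its value at \<open>0\<close>: the combination
  \<open>d * f - c * g\<close> has the value \<open>d * c - c * d = 0\<close> there, so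
  \<open>eigenfunction_zero\<close> makes it vanish.\<close>

lemma kernel_dim_le_1: "L2_dim M (op_ker_shift M T_max z) \<le> 1"
proof (rule L2_dim_le_1)
  fix f g assume f: "f \<in> op_ker_shift M T_max z" and g: "g \<in> op_ker_shift M T_max z"
  obtain c where fL: "f \<in> L2 M" and c: "AE t in M. f t = sol c (\<lambda>s. z * f s) t"
    using f by (auto simp: op_ker_shift_def T_max_def)
  obtain d where gL: "g \<in> L2 M" and d: "AE t in M. g t = sol d (\<lambda>s. z * g s) t"
    using g by (auto simp: op_ker_shift_def T_max_def)
  show "\<exists>c d. (c \<noteq> 0 \<or> d \<noteq> 0) \<and> (AE t in M. c * f t + d * g t = 0)"
  proof (cases "c = 0")
    case True
    then have "AE t in M. f t = 0" using eigenfunction_zero[OF fL] c by simp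
    then show ?thesis by (intro exI[of _ 1] exI[of _ 0]) simp
  next
    case False
    define u where "u t = d * f t - c * g t" for t
    have uL: "u \<in> L2 M" unfolding u_def[abs_def] by (intro L2_diff L2_cmult fL gL)
    have lf: "loc (\<lambda>s. z * f s)" and lg: "loc (\<lambda>s. z * g s)"
      by (intro loc_cmult loc_L2 fL gL)+
    have "AE t in M. t \<in> I" by (rule AE_I2) simp
    with c d have "AE t in M. u t = sol 0 (\<lambda>s. z * u s) t"
    proof eventually_elim
      case (elim t)
      have "sol (d * c - c * d) (\<lambda>s. d * (z * f s) - c * (z * g s)) t =
          sol (d * c) (\<lambda>s. d * (z * f s)) t - sol (c * d) (\<lambda>s. c * (z * g s)) t"
        using elim by (intro sol_diff loc_cmult lf lg)
      also have "\<dots> = d * f t - c * g t"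
        using elim sol_cmult[OF lf, of t d c] sol_cmult[OF lg, of t c d] by simp
      finally show ?case by (simp add: u_def[abs_def] algebra_simps)
    qed
    then have "AE t in M. u t = 0" by (rule eigenfunction_zero[OF uL])
    then show ?thesis
      using False by (intro exI[of _ d] exI[of _ "- c"]) (simp add: u_def)
  qed
qed

lemma kernel_cnj: "f \<in> op_ker_shift M T_max z \<Longrightarrow> (\<lambda>t. cnj (f t)) \<in> op_ker_shift M T_max (cnj z)"
  using T_max_cnj[of f "\<lambda>t. z * f t"] by (auto simp: op_ker_shift_def intro: L2_cnj)

lemma deficiency_indices:
  "deficiency_plus M (H_delta' b x \<beta>) = deficiency_minus M (H_delta' b x \<beta>)"
  "deficiency_plus M (H_delta' b x \<beta>) \<le> 1"
proof -
  have "L2_dim M (op_ker_shift M T_max z) \<le> L2_dim M (op_ker_shift M T_max (cnj z))" for z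
    by (rule L2_dim_cnj_le) (rule kernel_cnj)
  from this[of \<i>] this[of "- \<i>"]
  show "deficiency_plus M (H_delta' b x \<beta>) = deficiency_minus M (H_delta' b x \<beta>)"
    unfolding deficiency_plus_def deficiency_minus_def adjoint_H by simp
  show "deficiency_plus M (H_delta' b x \<beta>) \<le> 1"
    unfolding deficiency_plus_def adjoint_H by (rule kernel_dim_le_1)
qed

subsection \<open>The limit-point/limit-circle alternative\<close>

text \<open>From some \<open>a'\<close> on the kernel has mass at most 1/2 on every
  \<open>{a'..t}\<close>, so \<open>small_Gronwall\<close> bounds the sum of the moduli by twice its
  value at \<open>a'\<close>, uniformly in \<open>t\<close>. It is applied to the two derivatives
  and, separately, to the two amplitudes.\<close>

lemma bounded_near_b:
  fixes P Q p q :: "real \<Rightarrow> complex" and B :: "real \<Rightarrow> real"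
  assumes p: "loc p" and q: "loc q"
    and P: "\<And>t. t \<in> I \<Longrightarrow> P t = P0 + integral {0..t} p" and Q: "\<And>t. t \<in> I \<Longrightarrow> Q t = Q0 + integral {0..t} q"
    and B: "integrable M B" and B0: "\<And>t. t \<in> I \<Longrightarrow> 0 \<le> B t" and a: "a \<in> I"
    and le: "\<And>s. s \<in> I \<Longrightarrow> a \<le> s \<Longrightarrow> cmod (p s) + cmod (q s) \<le> B s * (cmod (P s) + cmod (Q s))"
  shows "\<exists>a'\<in>I. \<exists>C\<ge>0. \<forall>t\<in>I. a' \<le> t \<longrightarrow> cmod (P t) + cmod (Q t) \<le> C"
proof -
  obtain a1 where a1: "a1 \<in> I" "integral I B - 1 / 2 < integral {0..a1} B"
    using truncated_integral_tendsto_real[OF B B0, of "1/2"] by auto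
  define a' where "a' = max a a1"
  have a': "a' \<in> I" "a \<le> a'" "a1 \<le> a'" using a a1(1) by (auto simp: a'_def max_def)
  have a'0: "0 \<le> a'" using a'(1) by (simp add: I_iff)
  define y where "y t = cmod (P t) + cmod (Q t)" for t
  have "continuous_on I P" "continuous_on I Q"
    using P Q loc_continuous[OF p] loc_continuous[OF q]
    by (auto intro!: continuous_intros simp: continuous_on_cong[OF refl P] continuous_on_cong[OF refl Q])
  then have yc: "continuous_on I y"
    unfolding y_def[abs_def] by (intro continuous_intros)
  note lB = loc_integrable[OF B]
  have BI: "B integrable_on I"
    using B unfolding integrable_M_iff by (rule set_lebesgue_integral_eq_integral)
  have "y t \<le> 2 * y a'" if t: "t \<in> I" "a' \<le> t" for t
  proof (rule small_Gronwall[of a' t y B])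
    have sub: "{a'..t} \<subseteq> I" using I_sub[OF t(1)] a'0 by auto
    show "a' \<le> t" by (rule t(2))
    show "continuous_on {a'..t} y" using yc sub by (rule continuous_on_subset)
    show "B absolutely_integrable_on {a'..t}" using loc_sub[OF lB t(1) a'0] .
    show "0 \<le> B s" if "s \<in> {a'..t}" for s using that sub B0 by blast
    show "0 \<le> y s" for s by (simp add: y_def)
    show "t \<in> {a'..t}" using t(2) by simp
    have "integral {0..t} B \<le> integral I B"
      using I_sub[OF t(1)] loc_integrable_on[OF lB t(1)] BI B0 by (intro integral_subset_le) auto
    moreover have "integral {0..a1} B \<le> integral {0..a'} B"
      using a'(3) I_sub[OF a'(1)] loc_integrable_on[OF lB a1(1)] loc_integrable_on[OF lB a'(1)] B0
      by (intro integral_subset_le) auto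
    ultimately show "integral {a'..t} B \<le> 1 / 2"
      using loc_split[OF lB t(1) a'0 t(2)] a1(2) by simp
    fix s assume s: "s \<in> {a'..t}"
    then have sI: "s \<in> I" and as: "a' \<le> s" using sub by auto
    have sub': "{a'..s} \<subseteq> I" using s sub by auto
    have inc: "cmod (R s) \<le> cmod (R a') + integral {a'..s} (\<lambda>r. cmod (\<rho> r))"
      if R: "\<And>t. t \<in> I \<Longrightarrow> R t = R0 + integral {0..t} \<rho>" and \<rho>: "loc \<rho>" for R \<rho> and R0 :: complex
    proof -
      have "R s = R a' + integral {a'..s} \<rho>"
        using R[OF sI] R[OF a'(1)] loc_split[OF \<rho> sI a'0 as] by simp
      moreover have "cmod (integral {a'..s} \<rho>) \<le> integral {a'..s} (\<lambda>r. cmod (\<rho> r))"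
        using loc_integrable_sub[OF \<rho> sI a'0] loc_integrable_sub[OF loc_norm[OF \<rho>] sI a'0]
        by (intro integral_norm_bound_integral) auto
      ultimately show ?thesis by (simp add: norm_triangle_mono)
    qed
    have ip: "(\<lambda>r. cmod (p r)) integrable_on {a'..s}" "(\<lambda>r. cmod (q r)) integrable_on {a'..s}"
      using loc_integrable_sub[OF loc_norm[OF p] sI a'0] loc_integrable_sub[OF loc_norm[OF q] sI a'0] by auto
    have "y s \<le> y a' + (integral {a'..s} (\<lambda>r. cmod (p r)) + integral {a'..s} (\<lambda>r. cmod (q r)))"
      using inc[OF P p] inc[OF Q q] by (simp add: y_def)
    also have "integral {a'..s} (\<lambda>r. cmod (p r)) + integral {a'..s} (\<lambda>r. cmod (q r))
        = integral {a'..s} (\<lambda>r. cmod (p r) + cmod (q r))"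
      using ip by (rule Henstock_Kurzweil_Integration.integral_add[symmetric])
    also have "\<dots> \<le> integral {a'..s} (\<lambda>r. B r * y r)"
    proof (rule integral_le)
      show "(\<lambda>r. cmod (p r) + cmod (q r)) integrable_on {a'..s}" using ip by (rule integrable_add)
      have "(\<lambda>r. B r * y r) absolutely_integrable_on {a'..s}"
        using loc_sub[OF lB sI a'0] continuous_on_subset[OF yc sub'] by (rule absolutely_integrable_mult_continuous)
      then show "(\<lambda>r. B r * y r) integrable_on {a'..s}" by (rule set_lebesgue_integral_eq_integral)
      fix r assume "r \<in> {a'..s}"
      then show "cmod (p r) + cmod (q r) \<le> B r * y r"
        unfolding y_def using sub' a'(2) by (intro le) auto
    qed
    finally show "y s \<le> y a' + integral {a'..s} (\<lambda>r. B r * y r)" by simp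
  qed
  then show ?thesis
    using a'(1) by (intro bexI[of _ a'] exI[of _ "2 * y a'"]) (auto simp: y_def)
qed

lemma L2_if_bounded_near_b:
  assumes u: "u \<in> borel_measurable M" and F: "F \<in> L2 M" and G: "G \<in> L2 M" and m: "m \<in> I"
    and K: "\<And>t. t \<in> {0..m} \<Longrightarrow> cmod (u t) \<le> K"
    and C: "\<And>t. t \<in> I \<Longrightarrow> m \<le> t \<Longrightarrow> cmod (u t) \<le> C * (cmod (F t) + cmod (G t))"
  shows "u \<in> L2 M"
proof -
  have "integrable M (\<lambda>t. (cmod (u t))\<^sup>2)"
  proof (rule Bochner_Integration.integrable_bound)
    show "integrable M (\<lambda>t. K\<^sup>2 * indicator {0..m} t + 2 * C\<^sup>2 * ((cmod (F t))\<^sup>2 + (cmod (G t))\<^sup>2))"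
      by (intro Bochner_Integration.integrable_add integrable_mult_right integrable_indicator_M[OF m]
          L2_integrable_sq[OF F] L2_integrable_sq[OF G])
    show "(\<lambda>t. (cmod (u t))\<^sup>2) \<in> borel_measurable M" using u by measurable
    show "AE t in M. norm ((cmod (u t))\<^sup>2) \<le>
        norm (K\<^sup>2 * indicator {0..m} t + 2 * C\<^sup>2 * ((cmod (F t))\<^sup>2 + (cmod (G t))\<^sup>2))"
    proof (rule AE_I2)
      fix t assume "t \<in> space M"
      then have t: "t \<in> I" by simp
      have nn: "0 \<le> 2 * C\<^sup>2 * ((cmod (F t))\<^sup>2 + (cmod (G t))\<^sup>2)" by simp
      have "(cmod (u t))\<^sup>2 \<le> K\<^sup>2 * indicator {0..m} t + 2 * C\<^sup>2 * ((cmod (F t))\<^sup>2 + (cmod (G t))\<^sup>2)"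
      proof (cases "t \<le> m")
        case True
        then have tm: "t \<in> {0..m}" using t by (simp add: I_iff)
        have "(cmod (u t))\<^sup>2 \<le> K\<^sup>2" using K[OF tm] by (intro power_mono) auto
        moreover have "indicator {0..m} t = (1::real)" using tm by simp
        ultimately show ?thesis using nn by (simp only: mult_1_right)
      next
        case False
        have "(cmod (u t))\<^sup>2 \<le> (C * (cmod (F t) + cmod (G t)))\<^sup>2"
          using C[OF t] False by (intro power_mono) auto
        also have "\<dots> = C\<^sup>2 * (cmod (F t) + cmod (G t))\<^sup>2" by (rule power_mult_distrib)
        also have "\<dots> \<le> C\<^sup>2 * (2 * ((cmod (F t))\<^sup>2 + (cmod (G t))\<^sup>2))"
          using sum_squares_bound[of "cmod (F t)" "cmod (G t)"] by (intro mult_left_mono) (simp_all add: power2_sum)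
        also have "\<dots> \<le> K\<^sup>2 * indicator {0..m} t + 2 * C\<^sup>2 * ((cmod (F t))\<^sup>2 + (cmod (G t))\<^sup>2)"
          by (simp add: algebra_simps)
        finally show ?thesis .
      qed
      then show "norm ((cmod (u t))\<^sup>2) \<le> norm (K\<^sup>2 * indicator {0..m} t + 2 * C\<^sup>2 * ((cmod (F t))\<^sup>2 + (cmod (G t))\<^sup>2))"
        by simp
    qed
  qed
  then show ?thesis using u by (simp add: L2_def)
qed

lemma of_real_v_measurable: "(\<lambda>t. complex_of_real (v t)) \<in> borel_measurable M"
  by measurable

text \<open>If the Wronskian \<open>W\<close> of \<open>F\<close> and \<open>G\<close> stays away from \<open>0\<close> near \<open>b\<close>, then
  \<open>1 = (F G' - G F') / W\<close> and \<open>v = (amp F \<cdot> G - amp G \<cdot> F) / W\<close>.  Inserting these expressions into the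
  integrals defining \<open>F'\<close>, \<open>G'\<close> and the amplitudes turns them into linear equations with
  integrable kernels, so all four are bounded near \<open>b\<close>.\<close>

lemma limit_circle:
  assumes fh: "(f, h) \<in> T_max" and gk: "(g, k) \<in> T_max"
    and w: "(LINT t|M. h t * g t - k t * f t) \<noteq> 0"
  shows "(\<lambda>t. 1) \<in> L2 M \<and> (\<lambda>t. complex_of_real (v t)) \<in> L2 M"
proof -
  obtain c where f: "f \<in> L2 M" and h: "h \<in> L2 M" and c: "AE t in M. f t = sol c h t"
    using fh by (auto simp: T_max_def)
  obtain d where g: "g \<in> L2 M" and k: "k \<in> L2 M" and d: "AE t in M. g t = sol d k t"
    using gk by (auto simp: T_max_def)
  note lh = loc_L2[OF h] and lk = loc_L2[OF k]
  \<comment> \<open>Exact representatives of \<open>f\<close> and \<open>g\<close>, so that the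
    Wronskian identities hold at every point.\<close>
  define F G where "F = sol c h" and "G = sol d k"
  have FL: "F \<in> L2 M" unfolding F_def using f c sol_measurable[OF lh] by (rule L2_AE_cong)
  have GL: "G \<in> L2 M" unfolding G_def using g d sol_measurable[OF lk] by (rule L2_AE_cong)
  define W where "W t = amp c h t * der k t - der h t * amp d k t" for t
  \<comment> \<open>Half of the modulus of the limit, so that \<open>W\<close> keeps at least the
    distance \<open>\<delta>\<close> from zero near \<open>b\<close>.\<close>
  define \<delta> where "\<delta> = cmod (LINT t|M. h t * g t - k t * f t) / 2"
  have \<delta>: "\<delta> > 0" using w by (simp add: \<delta>_def)
  obtain a where a: "a \<in> I" and aW: "\<forall>t\<in>I. a \<le> t \<longrightarrow> cmod (W t - (LINT t|M. h t * g t - k t * f t)) < \<delta>"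
    using Green_limit[OF f h c g k d \<delta>] unfolding W_def by blast
  have W\<delta>: "\<delta> \<le> cmod (W t)" if "t \<in> I" "a \<le> t" for t
    using aW that norm_triangle_ineq3[of "W t" "LINT t|M. h t * g t - k t * f t"]
    by (fastforce simp: \<delta>_def)
  have id1: "F t * der k t - G t * der h t = W t" for t
    by (simp add: F_def G_def W_def sol_def algebra_simps)
  have id2: "amp c h t * G t - amp d k t * F t = of_real (v t) * W t" for t
    by (simp add: F_def G_def W_def sol_def algebra_simps)
  have two: "cmod (A * \<alpha> - B * \<gamma>) \<le> (cmod A + cmod B) * (cmod \<gamma> + cmod \<alpha>)" for A B \<alpha> \<gamma> :: complex
    using norm_triangle_ineq4[of "A * \<alpha>" "B * \<gamma>"]
    by (simp add: norm_mult algebra_simps) (smt (verit) mult_nonneg_nonneg norm_ge_zero)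
  have one_le: "\<delta> \<le> (cmod (F t) + cmod (G t)) * (cmod (der h t) + cmod (der k t))" if "t \<in> I" "a \<le> t" for t
    using W\<delta>[OF that] two[of "F t" "der k t" "G t" "der h t"] by (simp add: id1)
  have v_le: "\<bar>v t\<bar> * \<delta> \<le> (cmod (F t) + cmod (G t)) * (cmod (amp c h t) + cmod (amp d k t))"
    if "t \<in> I" "a \<le> t" for t
  proof -
    have "\<bar>v t\<bar> * \<delta> \<le> \<bar>v t\<bar> * cmod (W t)" using W\<delta>[OF that] by (intro mult_left_mono) auto
    also have "\<dots> = cmod (G t * amp c h t - F t * amp d k t)"
      using arg_cong[OF id2[of t], of cmod] by (simp add: norm_mult mult.commute)
    also have "\<dots> \<le> (cmod (G t) + cmod (F t)) * (cmod (amp d k t) + cmod (amp c h t))" by (rule two)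
    finally show ?thesis by (simp add: add.commute)
  qed
  \<comment> \<open>Multiplying the densities \<open>h\<close> and \<open>k\<close> by
    \<open>one_le\<close>, or by \<open>v_le\<close> once \<open>v\<close> is included, and dividing
    by \<open>\<delta>\<close> produces the same kernel in both cases. It is integrable as a sum of
    products of \<open>L2\<close> functions.\<close>
  define B where "B t = (cmod (h t) + cmod (k t)) * (cmod (F t) + cmod (G t)) / \<delta>" for t
  have B: "integrable M B"
  proof -
    have "integrable M (\<lambda>t. (cmod (h t * F t) + cmod (h t * G t) + (cmod (k t * F t) + cmod (k t * G t))) / \<delta>)"
      using \<delta> by (intro integrable_divide Bochner_Integration.integrable_add integrable_norm integrable_mult_L2 h k FL GL)
    then show ?thesis
      by (simp add: B_def[abs_def] norm_mult algebra_simps)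
  qed
  have B0: "0 \<le> B t" for t using \<delta> by (simp add: B_def)
  have "\<exists>a'\<in>I. \<exists>C\<ge>0. \<forall>t\<in>I. a' \<le> t \<longrightarrow> cmod (der h t) + cmod (der k t) \<le> C"
  proof (rule bounded_near_b[OF _ _ _ _ B B0 a, of "\<lambda>s. - h s" "\<lambda>s. - k s" _ 0 _ 0])
    show "loc (\<lambda>s. - h s)" "loc (\<lambda>s. - k s)" by (intro loc_L2 L2_uminus h k)+
    show "der h t = 0 + integral {0..t} (\<lambda>s. - h s)" "der k t = 0 + integral {0..t} (\<lambda>s. - k s)" for t
      by (simp_all add: der_def)
    fix s assume s: "s \<in> I" "a \<le> s"
    have "(cmod (h s) + cmod (k s)) * \<delta> \<le>
        (cmod (h s) + cmod (k s)) * ((cmod (F s) + cmod (G s)) * (cmod (der h s) + cmod (der k s)))"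
      using one_le[OF s] by (intro mult_left_mono) auto
    then show "cmod (- h s) + cmod (- k s) \<le> B s * (cmod (der h s) + cmod (der k s))"
      using \<delta> by (simp add: B_def pos_le_divide_eq mult.assoc)
  qed
  then obtain a1 C1 where C1: "a1 \<in> I" "C1 \<ge> 0" "\<forall>t\<in>I. a1 \<le> t \<longrightarrow> cmod (der h t) + cmod (der k t) \<le> C1"
    by blast
  have "\<exists>a'\<in>I. \<exists>C\<ge>0. \<forall>t\<in>I. a' \<le> t \<longrightarrow> cmod (amp c h t) + cmod (amp d k t) \<le> C"
  proof (rule bounded_near_b[OF _ _ _ _ B B0 a, of "\<lambda>s. of_real (v s) * h s" "\<lambda>s. of_real (v s) * k s" _ c _ d])
    show "loc (\<lambda>s. of_real (v s) * h s)" "loc (\<lambda>s. of_real (v s) * k s)" by (intro loc_v lh lk)+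
    show "amp c h t = c + integral {0..t} (\<lambda>s. of_real (v s) * h s)"
      "amp d k t = d + integral {0..t} (\<lambda>s. of_real (v s) * k s)" for t
      by (simp_all add: amp_def)
    fix s assume s: "s \<in> I" "a \<le> s"
    have "(cmod (h s) + cmod (k s)) * (\<bar>v s\<bar> * \<delta>) \<le>
        (cmod (h s) + cmod (k s)) * ((cmod (F s) + cmod (G s)) * (cmod (amp c h s) + cmod (amp d k s)))"
      using v_le[OF s] by (intro mult_left_mono) auto
    then have "\<bar>v s\<bar> * (cmod (h s) + cmod (k s)) * \<delta> \<le>
        (cmod (h s) + cmod (k s)) * (cmod (F s) + cmod (G s)) * (cmod (amp c h s) + cmod (amp d k s))"
      by (simp only: mult_ac)
    then have "\<bar>v s\<bar> * (cmod (h s) + cmod (k s)) \<le> B s * (cmod (amp c h s) + cmod (amp d k s))"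
      using \<delta> by (simp add: B_def pos_le_divide_eq)
    then show "cmod (of_real (v s) * h s) + cmod (of_real (v s) * k s) \<le> B s * (cmod (amp c h s) + cmod (amp d k s))"
      by (simp add: norm_mult distrib_left)
  qed
  then obtain a2 C2 where C2: "a2 \<in> I" "C2 \<ge> 0" "\<forall>t\<in>I. a2 \<le> t \<longrightarrow> cmod (amp c h t) + cmod (amp d k t) \<le> C2"
    by blast
  define m where "m = max a (max a1 a2)"
  have m: "m \<in> I" "a \<le> m" "a1 \<le> m" "a2 \<le> m" using a C1(1) C2(1) by (auto simp: m_def max_def)
  have "(\<lambda>t. 1) \<in> L2 M"
  proof (rule L2_if_bounded_near_b[OF _ FL GL m(1)])
    fix t assume t: "t \<in> I" "m \<le> t"
    have "\<delta> \<le> (cmod (F t) + cmod (G t)) * (cmod (der h t) + cmod (der k t))"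
      using t m by (intro one_le) auto
    also have "\<dots> \<le> (cmod (F t) + cmod (G t)) * C1"
      using C1(3) t m by (intro mult_left_mono) auto
    finally show "cmod 1 \<le> C1 / \<delta> * (cmod (F t) + cmod (G t))"
      using \<delta> by (simp add: pos_le_divide_eq mult.commute)
  qed auto
  moreover have "(\<lambda>t. complex_of_real (v t)) \<in> L2 M"
  proof -
    obtain K where K: "\<And>t. t \<in> {0..m} \<Longrightarrow> \<bar>v t\<bar> \<le> K" using v_bounded[OF m(1)] by blast
    show ?thesis
    proof (rule L2_if_bounded_near_b[OF of_real_v_measurable FL GL m(1)])
      show "cmod (complex_of_real (v t)) \<le> K" if "t \<in> {0..m}" for t using K[OF that] by simp
      fix t assume t: "t \<in> I" "m \<le> t"
      have "\<bar>v t\<bar> * \<delta> \<le> (cmod (F t) + cmod (G t)) * (cmod (amp c h t) + cmod (amp d k t))"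
        using t m by (intro v_le) auto
      also have "\<dots> \<le> (cmod (F t) + cmod (G t)) * C2"
        using C2(3) t m by (intro mult_left_mono) auto
      finally show "cmod (complex_of_real (v t)) \<le> C2 / \<delta> * (cmod (F t) + cmod (G t))"
        using \<delta> by (simp add: pos_le_divide_eq mult.commute)
    qed
  qed
  ultimately show ?thesis by blast
qed

text \<open>Conjugating \<open>(g, k)\<close> turns the sesquilinear boundary form into the bilinear
  one of \<open>limit_circle\<close>.\<close>

lemma T_max_symmetric:
  assumes "\<not> ((\<lambda>t. 1) \<in> L2 M \<and> (\<lambda>t. complex_of_real (v t)) \<in> L2 M)"
    and fh: "(f, h) \<in> T_max" and gk: "(g, k) \<in> T_max"
  shows "L2_inner M h g = L2_inner M f k"
proof -
  have L: "f \<in> L2 M" "h \<in> L2 M" "g \<in> L2 M" "k \<in> L2 M"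
    using fh gk by (auto simp: T_max_def)
  have "(LINT t|M. h t * cnj (g t) - cnj (k t) * f t) = 0"
    using limit_circle[OF fh T_max_cnj[OF gk]] assms(1) by blast
  moreover have "(LINT t|M. h t * cnj (g t) - cnj (k t) * f t) = L2_inner M h g - L2_inner M f k"
    using integrable_L2_inner[OF L(2,3)] integrable_L2_inner[OF L(1,4)]
    by (simp add: L2_inner_def mult.commute)
  ultimately show ?thesis by simp
qed

subsection \<open>Self-adjointness\<close>

text \<open>The adjoint has no multivalued part, which is the dual form of a dense domain. A
  solution that is zero almost everywhere vanishes on the open cells by continuity, and its
  derivative with it; continuity of \<open>der q\<close> across the centres then makes all integrals
  of \<open>q\<close> from \<open>0\<close> vanish.\<close>

lemma T_max_0_unique:
  assumes "((\<lambda>t. 0), q) \<in> T_max"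
  shows "AE t in M. q t = 0"
proof -
  obtain c where q: "q \<in> L2 M" and c: "AE t in M. 0 = sol c q t"
    using assms by (auto simp: T_max_def)
  note lq = loc_L2[OF q]
  obtain N where N: "N \<in> null_sets lebesgue" "{t \<in> space lebesgue. \<not> (t \<in> I \<longrightarrow> 0 = sol c q t)} \<subseteq> N"
    using c[unfolded AE_M_iff, unfolded eventually_ae_filter] by blast
  have negN: "negligible N" using N(1) by (simp add: negligible_iff_null_sets)
  have sol0: "sol c q t = 0" if t: "x n < t" "t < x (Suc n)" for n t
  proof (rule ccontr)
    assume ne: "sol c q t \<noteq> 0"
    let ?U = "{x n<..<x (Suc n)}"
    have "continuous_on ?U (sol c q)"
      by (rule continuous_at_imp_continuous_on)
         (use sol_has_derivative_at[OF lq] has_vector_derivative_continuous in force)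
    then have "open (?U \<inter> sol c q -` (- {0}))"
      by (rule continuous_open_preimage) auto
    moreover have "t \<in> ?U \<inter> sol c q -` (- {0})" using t ne by auto
    moreover have "?U \<inter> sol c q -` (- {0}) \<subseteq> N"
      using N(2) open_cell[of n] by fastforce
    ultimately show False
      using open_not_negligible negligible_subset[OF negN] by blast
  qed
  have der0: "der q t = 0" if t: "x n < t" "t < x (Suc n)" for n t
  proof -
    have "((\<lambda>_. 0) has_vector_derivative der q t) (at t)"
      by (rule has_vector_derivative_transform_within_open[OF sol_has_derivative_at[OF lq t, of c], of "{x n<..<x (Suc n)}"])
         (use t sol0 in auto)
    then show ?thesis
      using vector_derivative_unique_at has_vector_derivative_const by blast
  qed
  have "der q t = 0" if t: "t \<in> I" for t
  proof -
    obtain n where n: "x n \<le> t" "t < x (Suc n)" using cell[OF t] .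
    show ?thesis
    proof (cases "x n < t")
      case True
      then show ?thesis using n by (intro der0)
    next
      case False
      then have tn: "t = x n" using n by simp
      have "((\<lambda>_. 0) \<longlongrightarrow> der q (x n)) (at_right (x n))"
        by (rule Lim_transform_eventually[OF at_right_tendsto[OF der_continuous[OF lq] x_in_I] eventually_at_right_cell])
           (rule der0)
      then show ?thesis
        unfolding tn using tendsto_unique[OF _ _ tendsto_const, of "at_right (x n)"] by auto
    qed
  qed
  then show ?thesis
    using AE_M_eq_0_if_integrals_eq_0[OF lq] by (simp add: der_def)
qed

lemma H_min_nonempty: "H_delta'_min b x \<beta> \<noteq> {}"
proof -
  have "0 < x 1" using x_less_iff[of 0 1] by (simp add: x_0 del: x_less_iff)
  then show ?thesis using step_test_in_H_min[of "x 1" "x 1"] x_in_I by blast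
qed

lemma H_min_subset_H: "H_delta'_min b x \<beta> \<subseteq> H_delta' b x \<beta>"
proof (rule subrelI)
  fix f k assume fk: "(f, k) \<in> H_delta'_min b x \<beta>"
  have "\<exists>F G. (\<forall>n::nat. (F n, G n) \<in> H_delta'_min b x \<beta>) \<and> L2_tendsto M F f \<and> L2_tendsto M G k"
    by (rule exI[of _ "\<lambda>n. f"], rule exI[of _ "\<lambda>n. k"]) (simp add: fk)
  then show "(f, k) \<in> H_delta' b x \<beta>"
    unfolding H_delta'_def op_closure_def using H_min_form(1,2)[OF fk] by simp
qed

text \<open>The minimal domain becomes a graph by adding zero second components, so that
  \<open>graph_projection\<close> projects onto its closure. The residual \<open>f - f0\<close> is
  orthogonal to the domain; hence \<open>(0, f - f0)\<close> lies in the adjoint and the residual is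
  zero.\<close>

lemma H_densely_defined: "densely_defined M (H_delta' b x \<beta>)"
  unfolding densely_defined_def
proof
  fix f assume f: "f \<in> L2 M"
  define S where "S = {(u, w). u \<in> Domain (H_delta'_min b x \<beta>) \<and> w = (\<lambda>t::real. 0::complex)}"
  have S: "u \<in> L2 M \<and> w \<in> L2 M" if "(u, w) \<in> S" for u w
    using that H_min_form(1) by (auto simp: S_def)
  have S0: "S \<noteq> {}" using H_min_nonempty by (auto simp: S_def)
  have add: "((\<lambda>t. u t + u' t), (\<lambda>t. w t + w' t)) \<in> S" if "(u, w) \<in> S" "(u', w') \<in> S" for u w u' w'
    using that H_min_add by (fastforce simp: S_def)
  have mult: "((\<lambda>t. c * u t), (\<lambda>t. c * w t)) \<in> S" if "(u, w) \<in> S" for c u w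
    using that H_min_cmult by (fastforce simp: S_def)
  obtain f0 h0 where cl: "(f0, h0) \<in> op_closure M S"
    and orth: "\<And>u w. (u, w) \<in> S \<Longrightarrow> L2_inner M u (\<lambda>t. f t - f0 t) + L2_inner M w (\<lambda>t. 0 - h0 t) = 0"
    using graph_projection[OF S S0 add mult f L2_zero] by blast
  obtain F G where f0: "f0 \<in> L2 M" and FG: "\<And>n::nat. (F n, G n) \<in> S" and lim: "L2_tendsto M F f0"
    using cl by (auto simp: op_closure_def)
  have "L2_inner M k (\<lambda>t. 0) = L2_inner M u (\<lambda>t. f t - f0 t)" if "(u, k) \<in> H_delta'_min b x \<beta>" for u k
  proof -
    have "(u, \<lambda>t. 0) \<in> S" using that by (auto simp: S_def)
    from orth[OF this] show ?thesis by (simp add: L2_inner_def)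
  qed
  then have "((\<lambda>t. 0), (\<lambda>t. f t - f0 t)) \<in> op_adjoint M (H_delta'_min b x \<beta>)"
    using L2_diff[OF f f0] by (auto simp: op_adjoint_def)
  then have "AE t in M. f t - f0 t = 0"
    unfolding adjoint_H_min by (rule T_max_0_unique)
  then have ae: "AE t in M. f0 t = f t" by (rule eventually_mono) simp
  have FL: "F n \<in> L2 M" and FD: "F n \<in> Domain (H_delta'_min b x \<beta>)" for n
    using S[OF FG[of n]] FG[of n] by (auto simp: S_def)
  have "L2_tendsto M F f"
    by (rule L2_tendsto_AE_cong[OF lim FL f0 f ae])
  moreover have "F n \<in> Domain (H_delta' b x \<beta>)" for n
    using FD[of n] H_min_subset_H by blast
  ultimately show "\<exists>F. (\<forall>n::nat. F n \<in> Domain (H_delta' b x \<beta>)) \<and> L2_tendsto M F f" by blast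
qed

lemma self_adjoint_if_limit_point:
  assumes "\<not> ((\<lambda>t. 1) \<in> L2 M \<and> (\<lambda>t. complex_of_real (v t)) \<in> L2 M)"
  shows "self_adjoint M (H_delta' b x \<beta>)"
proof -
  have "op_closure M (H_delta'_min b x \<beta>) = op_adjoint M (H_delta'_min b x \<beta>)"
  proof (rule op_closure_eq_adjoint)
    show "H_delta'_min b x \<beta> \<subseteq> op_adjoint M (H_delta'_min b x \<beta>)"
      unfolding adjoint_H_min by (rule H_min_subset_T_max)
    show "L2_inner M h g = L2_inner M f k"
      if "(f, h) \<in> op_adjoint M (H_delta'_min b x \<beta>)" "(g, k) \<in> op_adjoint M (H_delta'_min b x \<beta>)" for f h g k
      using T_max_symmetric[OF assms] that unfolding adjoint_H_min by blast
    show "u \<in> L2 M \<and> w \<in> L2 M" if "(u, w) \<in> H_delta'_min b x \<beta>" for u w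
      using H_min_form(1,2)[OF that] by (rule conjI)
  qed (rule H_min_nonempty, erule (1) H_min_add, erule H_min_cmult)
  then have "H_delta' b x \<beta> = T_max"
    unfolding H_delta'_def adjoint_H_min .
  then show ?thesis
    using H_densely_defined adjoint_H by (simp add: self_adjoint_def)
qed

text \<open>Two elements of \<open>T_max\<close> with nonzero boundary form are
  \<open>(1, 0)\<close> and \<open>(sol 0 h, h)\<close> with \<open>h\<close> the indicator of
  \<open>{0..x 1}\<close>: beyond \<open>x 1\<close> the second solution is a combination of
  \<open>1\<close> and \<open>v\<close>, hence in \<open>L2\<close>, and the form is the integral of
  \<open>h\<close>, which is \<open>x 1\<close>.\<close>

lemma not_self_adjoint_if_limit_circle:
  assumes one: "(\<lambda>t. 1) \<in> L2 M" and vL: "(\<lambda>t. complex_of_real (v t)) \<in> L2 M"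
  shows "\<not> self_adjoint M (H_delta' b x \<beta>)"
proof
  assume sa: "self_adjoint M (H_delta' b x \<beta>)"
  then have H: "H_delta' b x \<beta> = T_max" unfolding self_adjoint_def adjoint_H by simp
  define m where "m = x 1"
  have m: "0 < m" "m \<in> I" using x_less_iff[of 0 1] by (auto simp: m_def x_0 x_in_I simp del: x_less_iff)
  define h :: "real \<Rightarrow> complex" where "h t = indicator {0..m} t" for t
  have h_meas: "h \<in> borel_measurable M"
  proof -
    have "(\<lambda>t. indicator {0..m} t :: complex) \<in> borel_measurable borel" by measurable
    then show ?thesis unfolding h_def[abs_def]
      by (intro measurable_restrict_space1 measurable_completion) simp
  qed
  have hL: "h \<in> L2 M"
    by (rule L2_bounded_support[OF h_meas m(2), of 1]) (auto simp: h_def)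
  note lh = loc_L2[OF hL]
  have tail: "integral {m..t} (\<lambda>s. D s * h s) = 0" if "m \<le> t" for t and D :: "real \<Rightarrow> complex"
  proof -
    have "integral {m..t} (\<lambda>s. D s * h s) = integral {m..t} (\<lambda>s. 0)"
      by (rule integral_spike[of "{m}"]) (auto simp: h_def)
    then show ?thesis by simp
  qed
  have amp: "amp 0 h t = amp 0 h m" if t: "t \<in> I" "m \<le> t" for t
    using loc_split[OF loc_v[OF lh] t(1) _ t(2)] tail[OF t(2)] m by (simp add: amp_def)
  have der: "der h t = der h m" if t: "t \<in> I" "m \<le> t" for t
    using loc_split[OF lh t(1) _ t(2)] tail[OF t(2), of "\<lambda>s. 1"] m by (simp add: der_def)
  have "integral {0..m} h = integral {0..m} (\<lambda>t. 1)"
    by (rule Henstock_Kurzweil_Integration.integral_cong) (simp add: h_def)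
  then have int: "integral {0..m} h = of_real m" using m by (simp add: scaleR_conv_of_real)
  define g where "g = sol 0 h"
  obtain K where K: "\<And>t. t \<in> {0..m} \<Longrightarrow> cmod (sol 0 h t) \<le> K"
    using sol_bounded[OF lh m(2), of 0] by blast
  have gL: "g \<in> L2 M"
    unfolding g_def
  proof (rule L2_if_bounded_near_b[OF sol_measurable[OF lh] one vL m(2) K])
    fix t assume t: "t \<in> I" "m \<le> t"
    have "cmod (sol 0 h t) \<le> cmod (amp 0 h m) + \<bar>v t\<bar> * cmod (der h m)"
      using norm_triangle_ineq[of "amp 0 h m" "of_real (v t) * der h m"]
      by (simp add: sol_def amp[OF t] der[OF t] norm_mult)
    also have "\<dots> \<le> (cmod (amp 0 h m) + cmod (der h m)) * (1 + \<bar>v t\<bar>)"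
      by (simp add: algebra_simps)
    finally show "cmod (sol 0 h t) \<le> (cmod (amp 0 h m) + cmod (der h m)) * (cmod 1 + cmod (complex_of_real (v t)))"
      by simp
  qed
  have gh: "(g, h) \<in> H_delta' b x \<beta>"
    unfolding H T_max_def using gL hL by (auto simp: g_def)
  have "sol 1 (\<lambda>t. 0) t = 1" for t by (simp add: sol_def amp_def der_def)
  then have "((\<lambda>t. 1), (\<lambda>t. 0)) \<in> T_max"
    unfolding T_max_def using one by (auto intro!: exI[of _ 1])
  then have "((\<lambda>t. 1), (\<lambda>t. 0)) \<in> op_adjoint M (H_delta' b x \<beta>)" by (simp only: adjoint_H)
  then have "L2_inner M h (\<lambda>t. 1) = L2_inner M g (\<lambda>t. 0)"
    using gh unfolding op_adjoint_def by blast
  then have "integral\<^sup>L M h = 0" by (simp add: L2_inner_def)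
  moreover have "integral\<^sup>L M h = integral {0..m} h"
  proof (rule integral_M_support[OF _ m(2)])
    show "integrable M h" using integrable_mult_L2[OF hL one] by simp
  qed (simp add: h_def)
  ultimately show False using int m(1) by simp
qed

lemma self_adjoint_iff:
  "self_adjoint M (H_delta' b x \<beta>) \<longleftrightarrow> \<not> ((\<lambda>t. 1) \<in> L2 M \<and> (\<lambda>t. complex_of_real (v t)) \<in> L2 M)"
  using self_adjoint_if_limit_point not_self_adjoint_if_limit_circle by blast

subsection \<open>The criterion in terms of the gaps and strengths\<close>

text \<open>The values are in \<open>ennreal\<close>, so integrals over cells turn into series
  without summability conditions.\<close>

definition cell_fun :: "(nat \<Rightarrow> ennreal) \<Rightarrow> real \<Rightarrow> ennreal" where
  "cell_fun a t = (\<Sum>n. a n * indicator {x n..<x (Suc n)} t)"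

lemma disjoint_cells: "disjoint_family (\<lambda>n. {x n..<x (Suc n)})"
  unfolding disjoint_family_on_def
proof (intro ballI impI)
  fix m n :: nat assume "m \<noteq> n"
  then have "Suc m \<le> n \<or> Suc n \<le> m" by auto
  then have "x (Suc m) \<le> x n \<or> x (Suc n) \<le> x m" by simp
  then show "{x m..<x (Suc m)} \<inter> {x n..<x (Suc n)} = {}" by auto
qed

lemma cell_fun_eq: "x n \<le> t \<Longrightarrow> t < x (Suc n) \<Longrightarrow> cell_fun a t = a n"
  unfolding cell_fun_def by (rule suminf_cmult_indicator[OF disjoint_cells]) auto

lemma cell_fun_measurable [measurable]: "cell_fun a \<in> borel_measurable M"
proof -
  have "cell_fun a \<in> borel_measurable borel"
    unfolding cell_fun_def[abs_def] by measurable
  then show ?thesis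
    by (intro measurable_restrict_space1 measurable_completion) simp
qed

lemma nn_integral_cell_fun: "(\<integral>\<^sup>+ t. cell_fun a t \<partial>M) = (\<Sum>n. a n * ennreal (gap x (Suc n)))"
proof -
  have "(\<integral>\<^sup>+ t. cell_fun a t \<partial>M) = (\<integral>\<^sup>+ t. cell_fun a t * indicator I t \<partial>lebesgue)"
    by (rule nn_integral_restrict_space) simp
  also have "\<dots> = (\<integral>\<^sup>+ t. (\<Sum>n. a n * indicator {x n..<x (Suc n)} t) \<partial>lebesgue)"
  proof (rule nn_integral_cong)
    fix t
    have "cell_fun a t = 0" if "t \<notin> I"
    proof -
      have "t \<notin> {x n..<x (Suc n)}" for n
        using that cell_in_I[of n t "Suc n"] by auto
      then show ?thesis by (simp add: cell_fun_def)
    qed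
    then show "cell_fun a t * indicator I t = (\<Sum>n. a n * indicator {x n..<x (Suc n)} t)"
      by (cases "t \<in> I") (auto simp: cell_fun_def)
  qed
  also have "\<dots> = (\<Sum>n. \<integral>\<^sup>+ t. a n * indicator {x n..<x (Suc n)} t \<partial>lebesgue)"
  proof (rule nn_integral_suminf)
    fix n
    have [measurable]: "(indicator {x n..<x (Suc n)} :: real \<Rightarrow> ennreal) \<in> borel_measurable lebesgue"
      by (rule borel_measurable_indicator) auto
    show "(\<lambda>t. a n * indicator {x n..<x (Suc n)} t) \<in> borel_measurable lebesgue"
      by measurable
  qed
  also have "\<dots> = (\<Sum>n. a n * ennreal (gap x (Suc n)))"
    by (simp add: nn_integral_cmult_indicator gap_def)
  finally show ?thesis .
qed

lemma one_L2_iff: "(\<lambda>t. 1) \<in> L2 M \<longleftrightarrow> (\<Sum>n. ennreal (gap x (Suc n))) \<noteq> \<infinity>"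
proof -
  have "(\<integral>\<^sup>+ t. 1 \<partial>M) = (\<integral>\<^sup>+ t. cell_fun (\<lambda>n. 1) t \<partial>M)"
  proof (rule nn_integral_cong)
    fix t assume "t \<in> space M"
    then obtain n where "x n \<le> t" "t < x (Suc n)" using cell[of t] by auto
    then show "1 = cell_fun (\<lambda>n. 1) t" by (simp add: cell_fun_eq)
  qed
  then have "(\<integral>\<^sup>+ t. 1 \<partial>M) = (\<Sum>n. ennreal (gap x (Suc n)))"
    by (simp add: nn_integral_cell_fun)
  moreover have "(\<lambda>t. 1) \<in> L2 M \<longleftrightarrow> (\<integral>\<^sup>+ t. 1 \<partial>M) < \<infinity>"
    by (simp add: L2_def integrable_iff_bounded)
  ultimately show ?thesis by (simp add: less_top)
qed

lemma sum_gap: "(\<Sum>i=1..n. gap x i) = x n"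
  by (induction n) (simp_all add: gap_def x_0)

text \<open>On each cell \<open>v\<close> differs from its value at the left endpoint by at most the
  total length \<open>L\<close>. Constants are square integrable when that length is finite, so
  \<open>v\<close> and the step function of left endpoint values are square integrable
  together.\<close>

lemma v_L2_iff:
  assumes fin: "(\<Sum>n. ennreal (gap x (Suc n))) \<noteq> \<infinity>"
  shows "(\<lambda>t. complex_of_real (v t)) \<in> L2 M \<longleftrightarrow>
    (\<Sum>n. ennreal (gap x (Suc n + 1) * \<bar>\<Sum>i = 1..Suc n. \<beta> i + gap x i\<bar>\<^sup>2)) \<noteq> \<infinity>"
proof -
  \<comment> \<open>This is the value of \<open>v\<close> at \<open>x n\<close>, since the gaps add
    up to \<open>x n\<close>.\<close>
  define s where "s n = (\<Sum>i=1..n. \<beta> i + gap x i)" for n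
  define \<sigma> where "\<sigma> = cell_fun (\<lambda>n. ennreal ((s n)\<^sup>2))"
  have [measurable]: "\<sigma> \<in> borel_measurable M" unfolding \<sigma>_def by (rule cell_fun_measurable)
  have gap_nonneg: "0 \<le> gap x (Suc n)" for n by (simp add: gap_def)
  obtain L where L: "L \<ge> 0" "(\<Sum>n. ennreal (gap x (Suc n))) = ennreal L"
    using fin by (cases "\<Sum>n. ennreal (gap x (Suc n))") auto
  have gap_le: "gap x (Suc n) \<le> L" for n
  proof -
    have "(\<Sum>j\<in>{n}. ennreal (gap x (Suc j))) \<le> (\<Sum>j. ennreal (gap x (Suc j)))"
      by (rule sum_le_suminf) auto
    then show ?thesis using L by (simp add: ennreal_le_iff)
  qed
  have mu: "(\<integral>\<^sup>+ t. ennreal (2 * L\<^sup>2) \<partial>M) < \<infinity>"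
  proof -
    have "(\<lambda>t. 1) \<in> L2 M" using fin one_L2_iff by simp
    then have "(\<integral>\<^sup>+ t. 1 \<partial>M) < \<infinity>" by (simp add: L2_def integrable_iff_bounded)
    then have "emeasure M I < \<infinity>" by simp
    then show ?thesis by (simp add: ennreal_mult_less_top)
  qed
  have near: "\<exists>r. \<sigma> t = ennreal (r\<^sup>2) \<and> \<bar>v t - r\<bar> \<le> L" if t: "t \<in> I" for t
  proof -
    obtain n where n: "x n \<le> t" "t < x (Suc n)" using cell[OF t] .
    have "s n = x n + (\<Sum>i=1..n. \<beta> i)" using sum_gap[of n] by (simp add: s_def sum.distrib)
    then have "v t - s n = t - x n" using v_cell[OF n] by simp
    then have "\<bar>v t - s n\<bar> \<le> gap x (Suc n)" using n by (simp add: gap_def)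
    then have "\<bar>v t - s n\<bar> \<le> L" using gap_le[of n] by linarith
    moreover have "\<sigma> t = ennreal ((s n)\<^sup>2)" unfolding \<sigma>_def using n by (rule cell_fun_eq)
    ultimately show ?thesis by blast
  qed
  have sq: "p\<^sup>2 \<le> 2 * r\<^sup>2 + 2 * L\<^sup>2" if "\<bar>p - r\<bar> \<le> L" for p r :: real
  proof -
    \<comment> \<open>The difference of the two sides is the square of
      \<open>p - 2 * r\<close>.\<close>
    have "p\<^sup>2 \<le> 2 * r\<^sup>2 + 2 * (p - r)\<^sup>2"
      using zero_le_power2[of "p - 2 * r"] by (simp add: power2_eq_square algebra_simps)
    moreover have "(p - r)\<^sup>2 \<le> L\<^sup>2" using that by (simp add: abs_le_square_iff[symmetric] L)
    ultimately show ?thesis by linarith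
  qed
  have v1: "ennreal ((v t)\<^sup>2) \<le> 2 * \<sigma> t + ennreal (2 * L\<^sup>2)" if t: "t \<in> I" for t
  proof -
    obtain r where r: "\<sigma> t = ennreal (r\<^sup>2)" "\<bar>v t - r\<bar> \<le> L" using near[OF t] by blast
    have "ennreal ((v t)\<^sup>2) \<le> ennreal (2 * r\<^sup>2 + 2 * L\<^sup>2)" using sq[OF r(2)] by (rule ennreal_leI)
    then show ?thesis using r(1) by (simp add: ennreal_mult)
  qed
  have v2: "\<sigma> t \<le> 2 * ennreal ((v t)\<^sup>2) + ennreal (2 * L\<^sup>2)" if t: "t \<in> I" for t
  proof -
    obtain r where r: "\<sigma> t = ennreal (r\<^sup>2)" "\<bar>v t - r\<bar> \<le> L" using near[OF t] by blast
    then have "ennreal (r\<^sup>2) \<le> ennreal (2 * (v t)\<^sup>2 + 2 * L\<^sup>2)" by (intro ennreal_leI sq) (simp add: abs_minus_commute)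
    then show ?thesis using r(1) by (simp add: ennreal_mult)
  qed
  have "(\<integral>\<^sup>+ t. ennreal ((v t)\<^sup>2) \<partial>M) < \<infinity> \<longleftrightarrow> (\<integral>\<^sup>+ t. \<sigma> t \<partial>M) < \<infinity>"
  proof
    assume a: "(\<integral>\<^sup>+ t. ennreal ((v t)\<^sup>2) \<partial>M) < \<infinity>"
    have "(\<integral>\<^sup>+ t. \<sigma> t \<partial>M) \<le> (\<integral>\<^sup>+ t. 2 * ennreal ((v t)\<^sup>2) + ennreal (2 * L\<^sup>2) \<partial>M)"
      using v2 by (intro nn_integral_mono) auto
    also have "\<dots> = 2 * (\<integral>\<^sup>+ t. ennreal ((v t)\<^sup>2) \<partial>M) + (\<integral>\<^sup>+ t. ennreal (2 * L\<^sup>2) \<partial>M)"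
      by (subst nn_integral_add) (auto simp: nn_integral_cmult)
    also have "\<dots> < \<infinity>" using a mu by (simp add: ennreal_mult_less_top)
    finally show "(\<integral>\<^sup>+ t. \<sigma> t \<partial>M) < \<infinity>" .
  next
    assume a: "(\<integral>\<^sup>+ t. \<sigma> t \<partial>M) < \<infinity>"
    have "(\<integral>\<^sup>+ t. ennreal ((v t)\<^sup>2) \<partial>M) \<le> (\<integral>\<^sup>+ t. 2 * \<sigma> t + ennreal (2 * L\<^sup>2) \<partial>M)"
      using v1 by (intro nn_integral_mono) auto
    also have "\<dots> = 2 * (\<integral>\<^sup>+ t. \<sigma> t \<partial>M) + (\<integral>\<^sup>+ t. ennreal (2 * L\<^sup>2) \<partial>M)"
      by (subst nn_integral_add) (auto simp: nn_integral_cmult)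
    also have "\<dots> < \<infinity>" using a mu by (simp add: ennreal_mult_less_top)
    finally show "(\<integral>\<^sup>+ t. ennreal ((v t)\<^sup>2) \<partial>M) < \<infinity>" .
  qed
  moreover have "(\<lambda>t. complex_of_real (v t)) \<in> L2 M \<longleftrightarrow> (\<integral>\<^sup>+ t. ennreal ((v t)\<^sup>2) \<partial>M) < \<infinity>"
    using of_real_v_measurable by (simp add: L2_def integrable_iff_bounded)
  moreover have "(\<integral>\<^sup>+ t. \<sigma> t \<partial>M) = (\<Sum>n. ennreal (gap x (Suc n + 1) * \<bar>\<Sum>i = 1..Suc n. \<beta> i + gap x i\<bar>\<^sup>2))"
  proof -
    define a where "a n = ennreal (gap x (Suc n) * (s n)\<^sup>2)" for n
    have "(\<integral>\<^sup>+ t. \<sigma> t \<partial>M) = (\<Sum>n. a n)"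
      unfolding \<sigma>_def nn_integral_cell_fun a_def using gap_nonneg by (simp add: ennreal_mult mult.commute)
    \<comment> \<open>The first cell carries the empty sum \<open>s 0 = 0\<close>; dropping it
      shifts the series to the indexing of the statement.\<close>
    moreover have "(\<lambda>n. a (Suc n)) sums (\<Sum>n. a (Suc n))"
      by (rule summable_sums) (rule summableI)
    then have "a sums ((\<Sum>n. a (Suc n)) + a 0)" by (rule sums_Suc)
    then have "(\<Sum>n. a n) = (\<Sum>n. a (Suc n)) + a 0" by (rule sums_unique[symmetric])
    moreover have "a 0 = 0" by (simp add: a_def s_def)
    ultimately show ?thesis by (simp add: a_def s_def)
  qed
  ultimately show ?thesis by (simp add: less_top)
qed

end

theorem theorem6p3:
  fixes b :: ereal and x \<beta> :: "nat \<Rightarrow> real"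
  assumes "0 < b"
    and "x 0 = 0"
    and "strict_mono x"
    and "\<And>n. ereal (x n) < b"
    and "(\<lambda>n. ereal (x n)) \<longlonglongrightarrow> b"
    and "bdd_above (gap x ` {1..})"
    and "\<And>n. n \<ge> 1 \<Longrightarrow> \<beta> n \<noteq> 0"
  defines "M \<equiv> lebesgue_on (half_open b)"
  shows "deficiency_plus M (H_delta' b x \<beta>) = deficiency_minus M (H_delta' b x \<beta>) \<and>
         deficiency_plus M (H_delta' b x \<beta>) \<le> 1 \<and>
         (self_adjoint M (H_delta' b x \<beta>) \<longleftrightarrow>
            (\<Sum>n. ennreal (gap x (Suc n))) = \<infinity> \<or>
            (\<Sum>n. ennreal (gap x (Suc n + 1) * \<bar>\<Sum>i = 1..Suc n. \<beta> i + gap x i\<bar>\<^sup>2)) = \<infinity>)"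
proof -
  interpret interface_problem b x \<beta>
    using assms(2-5) by unfold_locales
  \<comment> \<open>\<open>v_L2_iff\<close> presupposes that the first series converges. If it
    diverges, condition (i) holds and already \<open>1\<close> is not in \<open>L2\<close>.\<close>
  show ?thesis
    unfolding M_def using deficiency_indices self_adjoint_iff one_L2_iff v_L2_iff by blast
qed

end
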